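(* Let $\Omega\subset\mathbb{R}^N$ be a bounded domain, $a\in C^2(\overline\Omega)$ with $a>0$ in $\overline\Omega$, $G\in C^2(\mathbb{R})$, and $\varphi\in (H^1\cap L^\infty)(\Omega)$. Assume there exists $M>0$ such that $G'(s)\le 0$ for all $s<-M$ and $G'(s)\ge 0$ for all $s>M$. Assume $$\frac{\Delta\sqrt a}{\sqrt a}\ge -G''(0)\ \text{in }\Omega\quad\text{and}\quad -G''(0)>-G''(s)\ \text{for all } s\neq 0.$$ Then the functional $$\mathcal{E}(u,\Omega):=\int_\Omega\Big\{\tfrac12 a(x)|\nabla u|^2+a(x)G(u)\Big\}\,dx$$ admits a unique critical point in $H^1_\varphi(\Omega):=\{u\in H^1(\Omega): u-\varphi\in H^1_0(\Omega)\}$.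
   Context: A critical point is a weak solution $u\in H^1_\varphi(\Omega)$ of $-\mathrm{div}(a\nabla u)+aG'(u)=0$ in $\Omega$. *)

theory Defs
  imports "HOL-Analysis.Analysis"
begin

definition pderiv_dir :: "('a::euclidean_space \<Rightarrow> real) \<Rightarrow> 'a \<Rightarrow> 'a \<Rightarrow> real" where
  "pderiv_dir f v x = frechet_derivative f (at x) v"

fun Ck_on :: "nat \<Rightarrow> 'a::euclidean_space set \<Rightarrow> ('a \<Rightarrow> real) \<Rightarrow> bool" where
  "Ck_on 0 S f = continuous_on S f"
| "Ck_on (Suc k) S f = (f differentiable_on S \<and> (\<forall>v. Ck_on k S (pderiv_dir f v)))"

definition smooth_on :: "'a::euclidean_space set \<Rightarrow> ('a \<Rightarrow> real) \<Rightarrow> bool" where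
  "smooth_on S f = (\<forall>k. Ck_on k S f)"

definition grad :: "('a::euclidean_space \<Rightarrow> real) \<Rightarrow> 'a \<Rightarrow> 'a" where
  "grad f x = (\<Sum>i\<in>Basis. pderiv_dir f i x *\<^sub>R i)"

definition laplacian :: "('a::euclidean_space \<Rightarrow> real) \<Rightarrow> 'a \<Rightarrow> real" where
  "laplacian f x = (\<Sum>i\<in>Basis. pderiv_dir (pderiv_dir f i) i x)"

definition test_fun :: "'a::euclidean_space set \<Rightarrow> ('a \<Rightarrow> real) \<Rightarrow> bool" where
  "test_fun \<Omega> \<psi> = (smooth_on UNIV \<psi> \<and> compact (closure {x. \<psi> x \<noteq> 0})
                      \<and> closure {x. \<psi> x \<noteq> 0} \<subseteq> \<Omega>)"

definition L2_on :: "'a::euclidean_space set \<Rightarrow> ('a \<Rightarrow> real) \<Rightarrow> bool" where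
  "L2_on \<Omega> u = (u \<in> borel_measurable (lebesgue_on \<Omega>) \<and> integrable (lebesgue_on \<Omega>) (\<lambda>x. (u x)\<^sup>2))"

definition L2_vec_on :: "'a::euclidean_space set \<Rightarrow> ('a \<Rightarrow> 'a) \<Rightarrow> bool" where
  "L2_vec_on \<Omega> g = (g \<in> borel_measurable (lebesgue_on \<Omega>) \<and> integrable (lebesgue_on \<Omega>) (\<lambda>x. (norm (g x))\<^sup>2))"

definition Linfty_on :: "'a::euclidean_space set \<Rightarrow> ('a \<Rightarrow> real) \<Rightarrow> bool" where
  "Linfty_on \<Omega> u = (u \<in> borel_measurable (lebesgue_on \<Omega>) \<and> (\<exists>C. AE x in lebesgue_on \<Omega>. \<bar>u x\<bar> \<le> C))"

definition weak_grad :: "'a::euclidean_space set \<Rightarrow> ('a \<Rightarrow> real) \<Rightarrow> ('a \<Rightarrow> 'a) \<Rightarrow> bool" where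
  "weak_grad \<Omega> u g =
     ((\<forall>K. compact K \<and> K \<subseteq> \<Omega> \<longrightarrow> integrable (lebesgue_on K) u \<and> integrable (lebesgue_on K) g) \<and>
      (\<forall>\<psi>. test_fun \<Omega> \<psi> \<longrightarrow> (\<forall>i\<in>Basis.
         integral\<^sup>L (lebesgue_on \<Omega>) (\<lambda>x. u x * pderiv_dir \<psi> i x)
           = - integral\<^sup>L (lebesgue_on \<Omega>) (\<lambda>x. (g x \<bullet> i) * \<psi> x))))"

definition H1 :: "'a::euclidean_space set \<Rightarrow> ('a \<Rightarrow> real) \<Rightarrow> bool" where
  "H1 \<Omega> u = (L2_on \<Omega> u \<and> (\<exists>g. weak_grad \<Omega> u g \<and> L2_vec_on \<Omega> g))"

definition H1_0 :: "'a::euclidean_space set \<Rightarrow> ('a \<Rightarrow> real) \<Rightarrow> bool" where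
  "H1_0 \<Omega> u = (L2_on \<Omega> u \<and> (\<exists>g. weak_grad \<Omega> u g \<and> L2_vec_on \<Omega> g \<and>
      (\<exists>\<psi>::nat \<Rightarrow> 'a \<Rightarrow> real. (\<forall>k. test_fun \<Omega> (\<psi> k)) \<and>
         (\<lambda>k. integral\<^sup>L (lebesgue_on \<Omega>) (\<lambda>x. (u x - \<psi> k x)\<^sup>2)
             + integral\<^sup>L (lebesgue_on \<Omega>) (\<lambda>x. (norm (g x - grad (\<psi> k) x))\<^sup>2))
         \<longlonglongrightarrow> 0)))"

definition H1_bc :: "'a::euclidean_space set \<Rightarrow> ('a \<Rightarrow> real) \<Rightarrow> ('a \<Rightarrow> real) \<Rightarrow> bool" where
  "H1_bc \<Omega> \<phi> u = (H1 \<Omega> u \<and> H1_0 \<Omega> (\<lambda>x. u x - \<phi> x))"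

text \<open>Critical point of E(u,\<Omega>) = \<integral> (1/2) a |\<nabla>u|^2 + a G(u) in H^1_\<phi>(\<Omega>):
  a weak solution of -div(a \<nabla>u) + a G'(u) = 0 in \<Omega>.\<close>
definition critical_point ::
  "'a::euclidean_space set \<Rightarrow> ('a \<Rightarrow> real) \<Rightarrow> (real \<Rightarrow> real) \<Rightarrow> ('a \<Rightarrow> real) \<Rightarrow> ('a \<Rightarrow> real) \<Rightarrow> bool" where
  "critical_point \<Omega> a G \<phi> u =
     (H1_bc \<Omega> \<phi> u \<and> (\<exists>g. weak_grad \<Omega> u g \<and> L2_vec_on \<Omega> g \<and>
        (\<forall>\<psi>. test_fun \<Omega> \<psi> \<longrightarrow>
           integrable (lebesgue_on \<Omega>) (\<lambda>x. a x * deriv G (u x) * \<psi> x) \<and>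
           integral\<^sup>L (lebesgue_on \<Omega>)
             (\<lambda>x. a x * (g x \<bullet> grad \<psi> x) + a x * deriv G (u x) * \<psi> x) = 0)))"

end

theory Submission
  imports Defs
begin

text \<open>
  Put \<open>m = G''(0)\<close>. For \<open>z \<in> H\<^sub>0\<^sup>1\<close> the substitution \<open>v = \<surd>a z\<close> gives
  \<open>\<integral> a |\<nabla>z|\<^sup>2 + m a z\<^sup>2 = \<integral> |\<nabla>v|\<^sup>2 + (\<Delta>\<surd>a/\<surd>a + m) v\<^sup>2 \<ge> \<integral> |\<nabla>v|\<^sup>2\<close>, so by Poincare's inequality this quadratic
  form is coercive on \<open>H\<^sub>0\<^sup>1\<close>, while \<open>G'(s) - m s\<close> is increasing. Hence the energy is strictly convex on
  \<open>H\<^sub>\<phi>\<^sup>1\<close>. For existence, \<open>G'\<close> is made Lipschitz outside of a large interval \<open>[-K, K]\<close>; minimizing sequences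
  of the modified energy converge strongly, and the sign condition on \<open>G'\<close> confines the minimizer to \<open>[-K, K]\<close>, where
  nothing was modified. For uniqueness, critical points are not known to be bounded, so their difference \<open>z\<close> is
  not admissible in the equation; it is replaced by suitable test functions below \<open>|z|\<close>, as in the theorem of
  Brezis and Browder.
\<close>

section \<open>Functions of class Ck\<close>

text \<open>Only the lower bound G'' \<ge> m is global. G may grow arbitrarily fast, so the energy
  need not be finite on the affine space H^1_\<phi>, and a critical point is known to satisfy its
  equation only against smooth functions of compact support. The boundary of \<Omega> is arbitrary
  as well, so \<phi> can be smoothed with control of its gradient only on compact subsets. Every
  nonlinear operation is therefore carried out on smooth functions, with a smooth profile whose
  result is again a test function: \<open>bump\<close> replaces the positive part,
  \<open>smin\<close> replaces a minimum. Limits are taken afterwards in L2. To make this uniform,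
  H^1_0 is handled as the L2 closure of the pairs (\<psi>, grad \<psi>), so that an element carries
  its gradient along and every bilinear expression is an L2 product of pairs. The sign of m is free;
  coercivity comes from the integral of |grad (sqrt a \<psi>)|^2 and a Poincare inequality with
  constant 4 R^2, where R bounds \<Omega>.\<close>

lemma has_derivative_pderiv_dir:
  "f differentiable (at x) \<Longrightarrow> (f has_derivative (\<lambda>v. pderiv_dir f v x)) (at x)"
  by (simp add: pderiv_dir_def frechet_derivative_works)

lemma pderiv_dir_eqI: "(f has_derivative D) (at x) \<Longrightarrow> pderiv_dir f v x = D v"
  using frechet_derivative_at[of f D x] by (simp add: pderiv_dir_def)

text \<open>No differentiability is assumed: \<open>f\<close> and \<open>g\<close> have the same
  Frechet derivatives at \<open>x\<close>, possibly none, so the choice operator behind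
  \<open>frechet_derivative\<close> returns the same function for both.\<close>

lemma pderiv_dir_cong:
  assumes "open S" "x \<in> S" "\<And>y. y \<in> S \<Longrightarrow> f y = g y"
  shows "pderiv_dir f v x = pderiv_dir g v x"
proof -
  have "(f has_derivative D) (at x) \<longleftrightarrow> (g has_derivative D) (at x)" for D
    using assms has_derivative_transform_within_open[of f D x UNIV S g]
      has_derivative_transform_within_open[of g D x UNIV S f] by auto
  then show ?thesis by (simp add: pderiv_dir_def frechet_derivative_def)
qed

lemma Ck_on_cong:
  assumes "open S" "\<And>y. y \<in> S \<Longrightarrow> f y = g y"
  shows "Ck_on k S f \<longleftrightarrow> Ck_on k S g"
  using assms(2)
proof (induction k arbitrary: f g)
  case 0
  then show ?case by (simp cong: continuous_on_cong)
next
  case (Suc k)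
  have "f differentiable_on S \<longleftrightarrow> g differentiable_on S"
    using Suc.prems unfolding differentiable_on_def
    by (metis differentiable_transform_within zero_less_one)
  moreover have "Ck_on k S (pderiv_dir f v) \<longleftrightarrow> Ck_on k S (pderiv_dir g v)" for v
    by (rule Suc.IH) (use Suc.prems assms(1) pderiv_dir_cong in blast)
  ultimately show ?case by simp
qed

lemma Ck_on_congI:
  "open S \<Longrightarrow> Ck_on k S g \<Longrightarrow> (\<And>y. y \<in> S \<Longrightarrow> f y = g y) \<Longrightarrow> Ck_on k S f"
  using Ck_on_cong[of S f g k] by simp

lemma Ck_on_SucD: "Ck_on (Suc k) S f \<Longrightarrow> Ck_on k S f"
  by (induction k arbitrary: f) (auto simp: differentiable_imp_continuous_on)

lemma Ck_on_le: "Ck_on k S f \<Longrightarrow> j \<le> k \<Longrightarrow> Ck_on j S f"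
  by (induction k) (auto simp: le_Suc_eq simp del: Ck_on.simps dest: Ck_on_SucD)

lemma Ck_on_continuous: "Ck_on k S f \<Longrightarrow> continuous_on S f"
  using Ck_on_le[of k S f 0] by simp

lemma Ck_on_differentiable:
  "open S \<Longrightarrow> Ck_on (Suc k) S f \<Longrightarrow> x \<in> S \<Longrightarrow> f differentiable (at x)"
  using differentiable_on_eq_differentiable_at[of S f] by simp

lemma pderiv_dir_add:
  assumes "f differentiable (at x)" "g differentiable (at x)"
  shows "pderiv_dir (\<lambda>x. f x + g x) v x = pderiv_dir f v x + pderiv_dir g v x"
proof -
  have "((\<lambda>x. f x + g x) has_derivative (\<lambda>v. pderiv_dir f v x + pderiv_dir g v x)) (at x)"
    using assms by (intro has_derivative_add has_derivative_pderiv_dir)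
  from pderiv_dir_eqI[OF this] show ?thesis .
qed

lemma pderiv_dir_mult:
  assumes "f differentiable (at x)" "g differentiable (at x)"
  shows "pderiv_dir (\<lambda>x. f x * g x) v x = f x * pderiv_dir g v x + pderiv_dir f v x * g x"
proof -
  have "((\<lambda>x. f x * g x) has_derivative (\<lambda>v. f x * pderiv_dir g v x + pderiv_dir f v x * g x)) (at x)"
    using assms by (intro has_derivative_mult has_derivative_pderiv_dir)
  from pderiv_dir_eqI[OF this] show ?thesis .
qed

lemma has_derivative_compose_real:
  fixes b :: "real \<Rightarrow> real"
  assumes "f differentiable (at x)" "(b has_real_derivative b') (at (f x))"
  shows "((\<lambda>x. b (f x)) has_derivative (\<lambda>v. b' * pderiv_dir f v x)) (at x)"
proof -
  have "(b has_derivative (\<lambda>t. b' * t)) (at (f x))"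
    using assms(2) unfolding has_field_derivative_def .
  from has_derivative_compose[OF has_derivative_pderiv_dir[OF assms(1)] this] show ?thesis .
qed

lemma pderiv_dir_const [simp]: "pderiv_dir (\<lambda>x. c) v x = 0"
proof -
  have "((\<lambda>x. c) has_derivative (\<lambda>v. 0)) (at x)" by (rule has_derivative_const)
  from pderiv_dir_eqI[OF this] show ?thesis .
qed

lemma pderiv_dir_inner: "pderiv_dir (\<lambda>x. x \<bullet> i) v x = v \<bullet> i"
proof -
  have "((\<lambda>x. x \<bullet> i) has_derivative (\<lambda>v. v \<bullet> i)) (at x)"
    by (rule bounded_linear_imp_has_derivative) (rule bounded_linear_inner_left)
  from pderiv_dir_eqI[OF this] show ?thesis .
qed

lemma Ck_on_const: "Ck_on k S (\<lambda>x. c)"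
proof (induction k arbitrary: c)
  case (Suc k)
  have "pderiv_dir (\<lambda>x. c) v = (\<lambda>x. 0)" for v :: 'a by auto
  then show ?case using Suc by simp
qed auto

lemma Ck_on_inner: "Ck_on k S (\<lambda>x. x \<bullet> i)"
proof (cases k)
  case (Suc j)
  have "pderiv_dir (\<lambda>x. x \<bullet> i) v = (\<lambda>x. v \<bullet> i)" for v by (auto simp: pderiv_dir_inner)
  moreover have "(\<lambda>x. x \<bullet> i) differentiable_on S"
    by (intro linear_imp_differentiable_on bounded_linear.linear bounded_linear_inner_left)
  ultimately show ?thesis using Suc by (simp add: Ck_on_const)
qed (auto intro: continuous_intros)

lemma Ck_on_add:
  assumes "open S" "Ck_on k S f" "Ck_on k S g"
  shows "Ck_on k S (\<lambda>x. f x + g x)"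
  using assms(2,3)
proof (induction k arbitrary: f g)
  case (Suc k)
  have "Ck_on k S (pderiv_dir (\<lambda>x. f x + g x) v)" for v
  proof -
    have "Ck_on k S (\<lambda>x. pderiv_dir f v x + pderiv_dir g v x)" by (rule Suc.IH) (use Suc.prems in auto)
    moreover have "pderiv_dir (\<lambda>x. f x + g x) v x = pderiv_dir f v x + pderiv_dir g v x" if "x \<in> S" for x
      using Ck_on_differentiable[OF assms(1) _ that] Suc.prems by (blast intro: pderiv_dir_add)
    ultimately show ?thesis by (rule Ck_on_congI[OF assms(1)])
  qed
  then show ?case using Suc.prems by auto
qed (auto intro: continuous_intros)

lemma Ck_on_mult:
  assumes "open S" "Ck_on k S f" "Ck_on k S g"
  shows "Ck_on k S (\<lambda>x. f x * g x)"
  using assms(2,3)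
proof (induction k arbitrary: f g)
  case (Suc k)
  have "Ck_on k S (pderiv_dir (\<lambda>x. f x * g x) v)" for v
  proof -
    have "Ck_on k S f" "Ck_on k S g" using Suc.prems by (blast dest: Ck_on_SucD)+
    then have "Ck_on k S (\<lambda>x. f x * pderiv_dir g v x + pderiv_dir f v x * g x)"
      using Suc.prems by (intro Ck_on_add[OF assms(1)] Suc.IH) auto
    moreover have "pderiv_dir (\<lambda>x. f x * g x) v x = f x * pderiv_dir g v x + pderiv_dir f v x * g x" if "x \<in> S" for x
      using Ck_on_differentiable[OF assms(1) _ that] Suc.prems by (blast intro: pderiv_dir_mult)
    ultimately show ?thesis by (rule Ck_on_congI[OF assms(1)])
  qed
  then show ?case using Suc.prems by auto
qed (auto intro: continuous_intros)

text \<open>Here \<open>b n\<close> is the \<open>n\<close>-th derivative of \<open>b 0\<close> on \<open>D\<close>.\<close>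

lemma Ck_on_compose_real:
  fixes b :: "nat \<Rightarrow> real \<Rightarrow> real"
  assumes "open S" and b: "\<And>n t. t \<in> D \<Longrightarrow> (b n has_real_derivative b (Suc n) t) (at t)"
    and fD: "\<And>x. x \<in> S \<Longrightarrow> f x \<in> D" and "Ck_on k S f"
  shows "Ck_on k S (\<lambda>x. b n (f x))"
  using assms(4)
proof (induction k arbitrary: n)
  case 0
  have "continuous_on D (b n)"
    using b by (meson DERIV_isCont continuous_at_imp_continuous_on)
  then show ?case using 0 fD by (auto intro: continuous_on_compose2)
next
  case (Suc k)
  have d: "((\<lambda>x. b n (f x)) has_derivative (\<lambda>v. b (Suc n) (f x) * pderiv_dir f v x)) (at x)" if "x \<in> S" for x
    using has_derivative_compose_real[OF Ck_on_differentiable[OF assms(1) Suc.prems that] b[OF fD[OF that]]] .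
  then have "(\<lambda>x. b n (f x)) differentiable_on S"
    by (meson differentiable_def differentiable_at_imp_differentiable_on)
  moreover have "Ck_on k S (pderiv_dir (\<lambda>x. b n (f x)) v)" for v
  proof -
    have "Ck_on k S (\<lambda>x. b (Suc n) (f x) * pderiv_dir f v x)"
      using Suc.prems Suc.IH[OF Ck_on_SucD] by (intro Ck_on_mult[OF assms(1)]) auto
    moreover have "pderiv_dir (\<lambda>x. b n (f x)) v x = b (Suc n) (f x) * pderiv_dir f v x" if "x \<in> S" for x
      by (rule pderiv_dir_eqI[OF d[OF that]])
    ultimately show ?thesis by (rule Ck_on_congI[OF assms(1)])
  qed
  ultimately show ?case by simp
qed

text \<open>One real exponent serves two purposes below: 1/2 gives the square root of the weight,
  and -1 gives the reciprocal of the denominator of \<open>smin\<close>.\<close>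

lemma Ck_on_powr:
  assumes "open S" "Ck_on k S f" "\<And>x. x \<in> S \<Longrightarrow> f x > 0"
  shows "Ck_on k S (\<lambda>x. f x powr r)"
proof -
  \<comment> \<open>The \<open>n\<close>-th derivative of \<open>t powr r\<close> on the positive
    half line, with a falling factorial as coefficient.\<close>
  define b where "b n t = (\<Prod>i<n. r - real i) * t powr (r - real n)" for n t
  have "(b n has_real_derivative b (Suc n) t) (at t)" if "t \<in> {0<..}" for n t
    unfolding b_def using that
    by (auto intro!: derivative_eq_intros simp: algebra_simps)
  then have "Ck_on k S (\<lambda>x. b 0 (f x))"
    by (rule Ck_on_compose_real[where D="{0<..}", OF assms(1)]) (use assms(2,3) in auto)
  then show ?thesis by (simp add: b_def)
qed

lemma Ck_on_sqrt:
  assumes "open S" "Ck_on k S f" "\<And>x. x \<in> S \<Longrightarrow> f x > 0"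
  shows "Ck_on k S (\<lambda>x. sqrt (f x))"
  using Ck_on_powr[OF assms, of "1/2"] Ck_on_cong[OF assms(1), of "\<lambda>x. f x powr (1/2)" "\<lambda>x. sqrt (f x)"] assms(3)
  by (simp add: powr_half_sqrt less_imp_le)

lemma Ck_on_inverse:
  assumes "open S" "Ck_on k S f" "\<And>x. x \<in> S \<Longrightarrow> f x > 0"
  shows "Ck_on k S (\<lambda>x. inverse (f x))"
  using Ck_on_powr[OF assms, of "-1"] Ck_on_cong[OF assms(1), of "\<lambda>x. f x powr -1" "\<lambda>x. inverse (f x)"] assms(3)
  by (simp add: powr_minus less_imp_le)

lemma Ck_on_sum:
  assumes "open S" "finite I" "\<And>i. i \<in> I \<Longrightarrow> Ck_on k S (f i)"
  shows "Ck_on k S (\<lambda>x. \<Sum>i\<in>I. f i x)"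
  using assms(2,3) by (induction I rule: finite_induct) (auto simp: Ck_on_const Ck_on_add[OF assms(1)])

lemma Ck_on_norm_power2: "open S \<Longrightarrow> Ck_on k S (\<lambda>x. (norm x)\<^sup>2)"
proof -
  assume S: "open S"
  have *: "(norm x)\<^sup>2 = (\<Sum>i\<in>Basis. (x \<bullet> i) * (x \<bullet> i))" for x :: 'a
    unfolding power2_norm_eq_inner by (rule euclidean_inner)
  have "Ck_on k S (\<lambda>x. \<Sum>i\<in>Basis. (x \<bullet> i) * (x \<bullet> i))"
    by (rule Ck_on_sum[OF S finite_Basis], rule Ck_on_mult[OF S Ck_on_inner Ck_on_inner])
  then show ?thesis by (rule Ck_on_congI[OF S]) (rule *)
qed

lemma smooth_onD: "smooth_on S f \<Longrightarrow> Ck_on k S f"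
  by (simp add: smooth_on_def)

lemma smooth_on_pderiv_dir: "smooth_on S f \<Longrightarrow> smooth_on S (pderiv_dir f v)"
  unfolding smooth_on_def by (metis Ck_on.simps(2))

lemma smooth_on_add: "open S \<Longrightarrow> smooth_on S f \<Longrightarrow> smooth_on S g \<Longrightarrow> smooth_on S (\<lambda>x. f x + g x)"
  and smooth_on_mult: "open S \<Longrightarrow> smooth_on S f \<Longrightarrow> smooth_on S g \<Longrightarrow> smooth_on S (\<lambda>x. f x * g x)"
  and smooth_on_inverse: "open S \<Longrightarrow> smooth_on S f \<Longrightarrow> (\<And>x. x \<in> S \<Longrightarrow> f x > 0) \<Longrightarrow> smooth_on S (\<lambda>x. inverse (f x))"
  and smooth_on_const: "smooth_on S (\<lambda>x. c)"
  by (simp_all add: smooth_on_def Ck_on_add Ck_on_mult Ck_on_inverse Ck_on_const)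

lemma smooth_differentiable: "smooth_on UNIV f \<Longrightarrow> f differentiable (at x)"
  using Ck_on_differentiable[of UNIV 0 f x] smooth_onD[of UNIV f "Suc 0"] by auto

lemma smooth_continuous: "smooth_on S f \<Longrightarrow> continuous_on S f"
  using smooth_onD Ck_on_continuous by blast

text \<open>The weight \<open>a\<close> is only C2, so its product with a test function need not be
  a test function. Polynomial approximants of \<open>a\<close> are admissible multipliers, and this
  is what they are for.\<close>

lemma smooth_real_polynomial_function: "real_polynomial_function p \<Longrightarrow> smooth_on UNIV p"
proof (induction p rule: real_polynomial_function.induct)
  case (linear f)
  \<comment> \<open>A linear functional is the inner product with a fixed vector, which reduces the
    case to \<open>Ck_on_inner\<close>.\<close>
  have "f x = x \<bullet> (\<Sum>i\<in>Basis. f i *\<^sub>R i)" for x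
  proof -
    have "f x = f (\<Sum>i\<in>Basis. (x \<bullet> i) *\<^sub>R i)" by (simp add: euclidean_representation)
    also have "\<dots> = (\<Sum>i\<in>Basis. (x \<bullet> i) * f i)"
      using bounded_linear.linear[OF linear] by (simp add: linear_sum linear_cmul)
    finally show ?thesis by (simp add: inner_sum_right mult.commute)
  qed
  then have "f = (\<lambda>x. x \<bullet> (\<Sum>i\<in>Basis. f i *\<^sub>R i))" by blast
  then show ?case by (metis smooth_on_def Ck_on_inner)
qed (auto intro: smooth_on_add smooth_on_mult smooth_on_const)

section \<open>Test functions and integration by parts\<close>

lemma test_funI:
  assumes "smooth_on UNIV f" "compact C" "C \<subseteq> \<Omega>" "\<And>x. x \<notin> C \<Longrightarrow> f x = 0"
  shows "test_fun \<Omega> f"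
proof -
  have "closure {x. f x \<noteq> 0} \<subseteq> C"
    by (rule closure_minimal) (use assms compact_imp_closed in auto)
  moreover from this have "compact (closure {x. f x \<noteq> 0})"
    using assms(2) by (metis closed_closure compact_Int_closed inf.absorb2)
  ultimately show ?thesis using assms by (auto simp: test_fun_def)
qed

lemma test_fun_smooth: "test_fun \<Omega> f \<Longrightarrow> smooth_on UNIV f"
  by (simp add: test_fun_def)

lemma test_fun_supportE:
  assumes "test_fun \<Omega> f"
  obtains C where "compact C" "C \<subseteq> \<Omega>" "\<And>x. x \<notin> C \<Longrightarrow> f x = 0"
  using assms closure_subset[of "{x. f x \<noteq> 0}"] unfolding test_fun_def by blast

lemma test_fun_weaken_support:
  assumes "test_fun \<Omega> f" "smooth_on UNIV g" "\<And>x. f x = 0 \<Longrightarrow> g x = 0"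
  shows "test_fun \<Omega> g"
  using test_fun_supportE[OF assms(1)] test_funI[OF assms(2)] assms(3) by metis

lemma test_fun_pderiv_dir:
  assumes "test_fun \<Omega> f"
  shows "test_fun \<Omega> (pderiv_dir f v)"
proof -
  obtain C where C: "compact C" "C \<subseteq> \<Omega>" "\<And>x. x \<notin> C \<Longrightarrow> f x = 0" by (rule test_fun_supportE[OF assms]) auto
  have "pderiv_dir f v x = 0" if "x \<notin> C" for x
    using pderiv_dir_cong[of "-C" x f "\<lambda>_. 0"] that C compact_imp_closed[OF C(1)] by auto
  then show ?thesis using C test_funI smooth_on_pderiv_dir[OF test_fun_smooth[OF assms]] by metis
qed

lemma test_fun_mult_smooth:
  assumes "test_fun \<Omega> f" "smooth_on UNIV g"
  shows "test_fun \<Omega> (\<lambda>x. g x * f x)"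
  by (rule test_fun_weaken_support[OF assms(1)])
    (use smooth_on_mult[OF open_UNIV assms(2) test_fun_smooth[OF assms(1)]] in auto)

lemma test_fun_mult: "test_fun \<Omega> f \<Longrightarrow> test_fun \<Omega> g \<Longrightarrow> test_fun \<Omega> (\<lambda>x. g x * f x)"
  by (simp add: test_fun_mult_smooth test_fun_smooth)

lemma test_fun_cmult: "test_fun \<Omega> f \<Longrightarrow> test_fun \<Omega> (\<lambda>x. c * f x)"
  by (simp add: test_fun_mult_smooth smooth_on_const)

lemma test_fun_add:
  assumes "test_fun \<Omega> f" "test_fun \<Omega> g"
  shows "test_fun \<Omega> (\<lambda>x. f x + g x)"
proof -
  obtain C where C: "compact C" "C \<subseteq> \<Omega>" "\<And>x. x \<notin> C \<Longrightarrow> f x = 0" by (rule test_fun_supportE[OF assms(1)]) auto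
  obtain D where D: "compact D" "D \<subseteq> \<Omega>" "\<And>x. x \<notin> D \<Longrightarrow> g x = 0" by (rule test_fun_supportE[OF assms(2)]) auto
  show ?thesis
    by (rule test_funI[of _ "C \<union> D"])
      (use C D assms in \<open>auto intro: smooth_on_add test_fun_smooth\<close>)
qed

lemma test_fun_diff: "test_fun \<Omega> f \<Longrightarrow> test_fun \<Omega> g \<Longrightarrow> test_fun \<Omega> (\<lambda>x. f x - g x)"
  using test_fun_add[of \<Omega> f "\<lambda>x. -1 * g x"] test_fun_cmult[of \<Omega> g "-1"] by simp

lemma test_fun_zero: "test_fun \<Omega> (\<lambda>x. 0)"
  by (rule test_funI[of _ "{}"]) (auto simp: smooth_on_const)

lemma test_fun_differentiable: "test_fun \<Omega> f \<Longrightarrow> f differentiable (at x)"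
  using smooth_differentiable test_fun_smooth by blast

lemma test_fun_continuous: "test_fun \<Omega> f \<Longrightarrow> continuous_on S f"
  using smooth_continuous test_fun_smooth continuous_on_subset by blast

lemma differentiable_transform_open:
  assumes "f differentiable (at x)" "open S" "x \<in> S" "\<And>y. y \<in> S \<Longrightarrow> f y = g y"
  shows "g differentiable (at x)"
  using assms has_derivative_transform_within_open[of f _ x UNIV S g] unfolding differentiable_def by blast

text \<open>The open sets \<Omega> and \<open>- C\<close> cover the space. The extension is
  continuous on the first by assumption and identically zero on the second.\<close>

lemma continuous_on_zero_extension:
  fixes f :: "'a::euclidean_space \<Rightarrow> 'b::real_normed_vector"
  assumes "open \<Omega>" "compact C" "C \<subseteq> \<Omega>" "continuous_on \<Omega> f" "\<And>x. x \<in> \<Omega> - C \<Longrightarrow> f x = 0"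
  shows "continuous_on UNIV (\<lambda>x. if x \<in> \<Omega> then f x else 0)"
proof -
  have "continuous_on (\<Omega> \<union> - C) (\<lambda>x. if x \<in> \<Omega> then f x else 0)"
  proof (rule continuous_on_open_Un)
    show "continuous_on \<Omega> (\<lambda>x. if x \<in> \<Omega> then f x else 0)"
      using assms(4) by (simp cong: continuous_on_cong)
    have "continuous_on (-C) (\<lambda>x. 0::'b)" by simp
    then show "continuous_on (-C) (\<lambda>x. if x \<in> \<Omega> then f x else 0)"
      using assms(5) by (elim continuous_on_eq) auto
  qed (use assms compact_imp_closed in auto)
  then show ?thesis using assms(3) by (metis Compl_partition2 UNIV_eq_I Un_iff subset_Un_eq sup_assoc sup_commute Compl_partition top.extremum_uniqueI sup_ge1)
qed

lemma integrable_compact_support: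
  fixes f :: "'a::euclidean_space \<Rightarrow> 'b::euclidean_space"
  assumes "open \<Omega>" "compact C" "C \<subseteq> \<Omega>" "continuous_on \<Omega> f" "\<And>x. x \<in> \<Omega> - C \<Longrightarrow> f x = 0"
  shows "integrable (lebesgue_on \<Omega>) f"
proof -
  have "integrable lborel (\<lambda>x. indicator C x *\<^sub>R f x)"
    by (rule borel_integrable_compact) (use assms continuous_on_subset in auto)
  then have "integrable lebesgue (\<lambda>x. indicator C x *\<^sub>R f x)" by (simp add: integrable_completion)
  moreover have "indicator C x *\<^sub>R f x = indicator \<Omega> x *\<^sub>R f x" for x
    using assms(3,5) by (auto simp: indicator_def)
  ultimately show ?thesis using assms(1) by (simp add: integrable_restrict_space)
qed

lemma has_derivative_along_line:
  assumes "h differentiable (at (x + s *\<^sub>R v))"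
  shows "((\<lambda>s. h (x + s *\<^sub>R v)) has_real_derivative pderiv_dir h v (x + s *\<^sub>R v)) (at s)"
proof -
  let ?D = "\<lambda>w. pderiv_dir h w (x + s *\<^sub>R v)"
  have D: "(h has_derivative ?D) (at (x + s *\<^sub>R v))" by (rule has_derivative_pderiv_dir[OF assms])
  have "((\<lambda>s. x + s *\<^sub>R v) has_derivative (\<lambda>t. t *\<^sub>R v)) (at s)"
    by (auto intro!: derivative_eq_intros)
  from has_derivative_compose[OF this D]
  have "((\<lambda>s. h (x + s *\<^sub>R v)) has_derivative (\<lambda>t. ?D (t *\<^sub>R v))) (at s)" .
  moreover have "?D (t *\<^sub>R v) = ?D v * t" for t
    using linear_cmul[OF has_derivative_linear[OF D], of t v] by simp
  ultimately show ?thesis unfolding has_field_derivative_def by simp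
qed

text \<open>Translation invariance makes the integral of every difference quotient vanish.\<close>

lemma integral_pderiv_dir_eq_0:
  fixes h :: "'a::euclidean_space \<Rightarrow> real"
  assumes diff: "\<And>x. h differentiable (at x)" and cont: "continuous_on UNIV (pderiv_dir h v)"
    and C: "compact C" "\<And>x. x \<notin> C \<Longrightarrow> h x = 0"
  shows "integral\<^sup>L lborel (pderiv_dir h v) = 0"
proof -
  define t where "t n = inverse (real (Suc n))" for n
  have t: "t n > 0" "t n \<le> 1" for n by (auto simp: t_def inverse_le_1_iff)
  have t0: "t \<longlonglongrightarrow> 0" unfolding t_def by (rule LIMSEQ_inverse_real_of_nat)
  define q where "q n x = (h (x + t n *\<^sub>R v) - h x) / t n" for n x
  obtain R where R: "\<And>x. x \<in> C \<Longrightarrow> norm x \<le> R" using compact_imp_bounded[OF C(1)] bounded_iff by metis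
  have D0: "pderiv_dir h v x = 0" if "x \<notin> C" for x
    using pderiv_dir_cong[of "-C" x h "\<lambda>_. 0"] that C compact_imp_closed[OF C(1)] by auto
  have "compact (pderiv_dir h v ` C)"
    using compact_continuous_image[OF continuous_on_subset[OF cont] C(1)] by simp
  then obtain B where "\<And>x. x \<in> C \<Longrightarrow> \<bar>pderiv_dir h v x\<bar> \<le> B"
    using compact_imp_bounded bounded_iff by (metis imageI real_norm_def)
  then have B: "\<bar>pderiv_dir h v x\<bar> \<le> max B 0" for x
  proof (cases "x \<in> C")
    case True
    then show ?thesis using \<open>\<And>x. x \<in> C \<Longrightarrow> \<bar>pderiv_dir h v x\<bar> \<le> B\<close>[of x] by linarith
  qed (simp add: D0)
  have hc: "continuous_on UNIV h" using diff by (simp add: continuous_on_eq_continuous_at differentiable_imp_continuous_within)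
  have hi: "integrable lborel h"
  proof -
    have "integrable lborel (\<lambda>x. indicator C x *\<^sub>R h x)"
      by (rule borel_integrable_compact[OF C(1) continuous_on_subset[OF hc]]) simp
    moreover have "(\<lambda>x. indicator C x *\<^sub>R h x) = h"
    proof
      show "indicator C x *\<^sub>R h x = h x" for x using C(2) by (cases "x \<in> C") auto
    qed
    ultimately show ?thesis by simp
  qed
  have tr: "integrable lborel (\<lambda>x. h (c + x))" "integral\<^sup>L lborel (\<lambda>x. h (c + x)) = integral\<^sup>L lborel h" for c
    using hi integrable_distr_eq[of "(+) c" lborel borel h] integral_distr[of "(+) c" lborel borel h]
    by (auto simp: lborel_distr_plus)
  have iq: "integral\<^sup>L lborel (q n) = 0" for n
    unfolding q_def using tr[of "t n *\<^sub>R v"] hi by (simp add: add.commute[of _ "t n *\<^sub>R v"])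
  \<comment> \<open>By the mean value theorem each quotient is a value of the derivative, hence
    bounded by \<open>max B 0\<close>. As \<open>t n\<close> is at most 1, all quotients vanish
    outside the ball of radius \<open>R + norm v\<close>, so one integrable function dominates
    them.\<close>
  have "(\<lambda>n. integral\<^sup>L lborel (q n)) \<longlonglongrightarrow> integral\<^sup>L lborel (pderiv_dir h v)"
  proof (rule integral_dominated_convergence[where w="\<lambda>x. indicator (cball 0 (R + norm v)) x *\<^sub>R max B 0"])
    show "pderiv_dir h v \<in> borel_measurable lborel"
      using borel_measurable_continuous_onI[OF cont] by simp
    show "q n \<in> borel_measurable lborel" for n
      unfolding q_def using hi tr(1)[of "t n *\<^sub>R v"] by (simp add: add.commute[of _ "t n *\<^sub>R v"])
    show "integrable lborel (\<lambda>x. indicator (cball 0 (R + norm v)) x *\<^sub>R max B 0)"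
      by (rule borel_integrable_compact) auto
    show "AE x in lborel. (\<lambda>n. q n x) \<longlonglongrightarrow> pderiv_dir h v x"
    proof (intro AE_I2)
      fix x
      have "((\<lambda>s. h (x + s *\<^sub>R v)) has_real_derivative pderiv_dir h v (x + 0 *\<^sub>R v)) (at 0)"
        by (rule has_derivative_along_line[OF diff])
      then have "((\<lambda>s. (h (x + s *\<^sub>R v) - h x) / s) \<longlongrightarrow> pderiv_dir h v x) (at 0)"
        by (simp add: has_field_derivative_iff)
      moreover have "filterlim t (at 0) sequentially"
        unfolding filterlim_at using t0 t(1) by (auto simp: less_imp_neq[symmetric])
      ultimately show "(\<lambda>n. q n x) \<longlonglongrightarrow> pderiv_dir h v x"
        unfolding q_def by (rule filterlim_compose)
    qed
    fix n
    show "AE x in lborel. norm (q n x) \<le> indicator (cball 0 (R + norm v)) x *\<^sub>R max B 0"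
    proof (intro AE_I2)
      fix x
      obtain z where z: "0 < z" "z < t n" "h (x + t n *\<^sub>R v) - h (x + 0 *\<^sub>R v) = (t n - 0) * pderiv_dir h v (x + z *\<^sub>R v)"
        using MVT2[of 0 "t n" "\<lambda>s. h (x + s *\<^sub>R v)" "\<lambda>s. pderiv_dir h v (x + s *\<^sub>R v)"] t(1)[of n]
          has_derivative_along_line[OF diff] by blast
      have q: "q n x = pderiv_dir h v (x + z *\<^sub>R v)" using z(3) t(1)[of n] by (simp add: q_def)
      show "norm (q n x) \<le> indicator (cball 0 (R + norm v)) x *\<^sub>R max B 0"
      proof (cases "x + z *\<^sub>R v \<in> C")
        case True
        have "norm (z *\<^sub>R v) \<le> norm v" using z(1,2) t(2)[of n] mult_right_mono[of z 1 "norm v"] by simp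
        then have "norm x \<le> R + norm v"
          using R[OF True] norm_triangle_ineq4[of "x + z *\<^sub>R v" "z *\<^sub>R v"] by simp
        then show ?thesis using q B by simp
      qed (use D0 q in simp)
    qed
  qed
  then show ?thesis using iq LIMSEQ_const_iff[of 0 "integral\<^sup>L lborel (pderiv_dir h v)"] by simp
qed

text \<open>\<open>f\<close> is differentiable only inside \<Omega>, but \<open>f * \<psi>\<close>
  extended by zero is differentiable on the whole space with compact support and continuous
  directional derivative. The integral of that derivative vanishes, and the product rule splits
  it.\<close>

lemma integral_by_parts:
  fixes f :: "'a::euclidean_space \<Rightarrow> real"
  assumes "open \<Omega>" "Ck_on 1 \<Omega> f" "test_fun \<Omega> \<psi>"
  shows "integrable (lebesgue_on \<Omega>) (\<lambda>x. pderiv_dir f v x * \<psi> x)" (is ?i1)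
    and "integrable (lebesgue_on \<Omega>) (\<lambda>x. f x * pderiv_dir \<psi> v x)" (is ?i2)
    and "integral\<^sup>L (lebesgue_on \<Omega>) (\<lambda>x. pderiv_dir f v x * \<psi> x)
      = - integral\<^sup>L (lebesgue_on \<Omega>) (\<lambda>x. f x * pderiv_dir \<psi> v x)"
proof -
  obtain C where C: "compact C" "C \<subseteq> \<Omega>" "\<And>x. x \<notin> C \<Longrightarrow> \<psi> x = 0" by (rule test_fun_supportE[OF assms(3)]) auto
  have D0: "pderiv_dir \<psi> v x = 0" if "x \<notin> C" for x
    using pderiv_dir_cong[of "-C" x \<psi> "\<lambda>_. 0"] that C compact_imp_closed[OF C(1)] by auto
  have fd: "f differentiable (at x)" if "x \<in> \<Omega>" for x
    using Ck_on_differentiable[of \<Omega> 0 f x] assms that by simp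
  have cont: "continuous_on \<Omega> (pderiv_dir f v)" "continuous_on \<Omega> f"
    using assms(2) Ck_on_continuous[OF assms(2)] by auto
  have \<psi>: "continuous_on \<Omega> \<psi>" "continuous_on \<Omega> (pderiv_dir \<psi> v)"
    using assms(3) test_fun_pderiv_dir test_fun_continuous by blast+
  show i1: ?i1
    by (rule integrable_compact_support[OF assms(1) C(1,2)])
      (use C(3) cont \<psi> in \<open>auto intro: continuous_intros\<close>)
  show i2: ?i2
    by (rule integrable_compact_support[OF assms(1) C(1,2)])
      (use D0 cont \<psi> in \<open>auto intro: continuous_intros\<close>)
  define h where "h x = (if x \<in> \<Omega> then f x * \<psi> x else 0)" for x
  define k where "k x = f x * pderiv_dir \<psi> v x + pderiv_dir f v x * \<psi> x" for x
  have h_in: "h differentiable (at x)" "pderiv_dir h v x = k x" if "x \<in> \<Omega>" for x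
  proof -
    have d: "(\<lambda>x. f x * \<psi> x) differentiable (at x)"
      using fd[OF that] test_fun_differentiable[OF assms(3)] by (rule differentiable_mult)
    then show "h differentiable (at x)"
      by (rule differentiable_transform_open) (use that assms(1) in \<open>auto simp: h_def\<close>)
    have "pderiv_dir h v x = pderiv_dir (\<lambda>x. f x * \<psi> x) v x"
      by (rule pderiv_dir_cong[OF assms(1) that]) (simp add: h_def)
    then show "pderiv_dir h v x = k x"
      using pderiv_dir_mult[OF fd[OF that] test_fun_differentiable[OF assms(3)]] by (simp add: k_def)
  qed
  have h_out: "h differentiable (at x)" "pderiv_dir h v x = 0" if "x \<notin> C" for x
  proof -
    have o: "open (-C)" using C compact_imp_closed by auto
    show "h differentiable (at x)"
      by (rule differentiable_transform_open[OF _ o, of "\<lambda>_. 0"]) (use that C in \<open>auto simp: h_def\<close>)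
    show "pderiv_dir h v x = 0"
      using pderiv_dir_cong[OF o, of x h "\<lambda>_. 0"] that C by (auto simp: h_def)
  qed
  have k: "pderiv_dir h v = (\<lambda>x. if x \<in> \<Omega> then k x else 0)"
  proof
    show "pderiv_dir h v x = (if x \<in> \<Omega> then k x else 0)" for x
      using h_in(2)[of x] h_out(2)[of x] C(2) by (cases "x \<in> \<Omega>") auto
  qed
  have "continuous_on UNIV (pderiv_dir h v)" unfolding k
    by (rule continuous_on_zero_extension[OF assms(1) C(1,2)])
     (use C(3) D0 cont \<psi> in \<open>auto simp: k_def intro!: continuous_intros\<close>)
  moreover have "h differentiable (at x)" for x using h_in h_out C(2) by blast
  ultimately have "integral\<^sup>L lborel (pderiv_dir h v) = 0"
    using C(3) by (intro integral_pderiv_dir_eq_0[OF _ _ C(1)]) (auto simp: h_def)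
  moreover have "integral\<^sup>L lborel (pderiv_dir h v) = integral\<^sup>L (lebesgue_on \<Omega>) k"
  proof -
    have "pderiv_dir h v \<in> borel_measurable lborel"
      using \<open>continuous_on UNIV (pderiv_dir h v)\<close> borel_measurable_continuous_onI by simp
    then have "integral\<^sup>L lborel (pderiv_dir h v) = integral\<^sup>L lebesgue (pderiv_dir h v)"
      by (simp add: integral_completion)
    also have "\<dots> = integral\<^sup>L lebesgue (\<lambda>x. indicator \<Omega> x *\<^sub>R k x)"
      unfolding k by (intro Bochner_Integration.integral_cong) (auto simp: indicator_def)
    finally show ?thesis using assms(1) by (simp add: integral_restrict_space)
  qed
  ultimately show "integral\<^sup>L (lebesgue_on \<Omega>) (\<lambda>x. pderiv_dir f v x * \<psi> x)
      = - integral\<^sup>L (lebesgue_on \<Omega>) (\<lambda>x. f x * pderiv_dir \<psi> v x)"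
    using Bochner_Integration.integral_add[OF i2 i1] by (simp add: k_def[abs_def])
qed

section \<open>A smooth bump function\<close>

text \<open>The classical flat function exp (-1/t), with a polynomial in 1/t as prefactor. The
  prefactor closes the family under differentiation: p becomes X^2 (p - p'), so smoothness follows
  by iteration.\<close>

definition bump_poly :: "real poly \<Rightarrow> real \<Rightarrow> real" where
  "bump_poly p t = (if t > 0 then poly p (1/t) * exp (-1/t) else 0)"

lemma poly_times_exp_uminus_tendsto_0: "((\<lambda>y::real. poly p y * exp (-y)) \<longlongrightarrow> 0) at_top"
proof -
  have "((\<lambda>y::real. \<Sum>i\<le>degree p. coeff p i * (y ^ i / exp y)) \<longlongrightarrow> (\<Sum>i\<le>degree p. coeff p i * 0)) at_top"
    by (intro tendsto_sum tendsto_mult tendsto_const tendsto_power_div_exp_0)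
  then show ?thesis by (simp add: poly_altdef sum_distrib_right exp_minus divide_inverse mult.assoc)
qed

lemma bump_poly_has_derivative:
  "(bump_poly p has_real_derivative bump_poly ([:0,0,1:] * (p - pderiv p)) t) (at t)"
proof -
  let ?q = "[:0,0,1:] * (p - pderiv p)"
  consider "t > 0" | "t < 0" | "t = 0" by linarith
  then show ?thesis
  proof cases
    case 1
    have "((\<lambda>t. poly p (1/t) * exp (-1/t)) has_real_derivative poly ?q (1/t) * exp (-1/t)) (at t)"
      using 1 by (auto intro!: derivative_eq_intros simp: field_simps power2_eq_square)
    then have "(bump_poly p has_real_derivative poly ?q (1/t) * exp (-1/t)) (at t)"
      by (rule has_field_derivative_transform_within_open[of _ _ _ "{0<..}"]) (use 1 in \<open>auto simp: bump_poly_def\<close>)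
    then show ?thesis using 1 by (simp add: bump_poly_def)
  next
    case 2
    have "((\<lambda>t. 0) has_real_derivative 0) (at t)" by simp
    then have "(bump_poly p has_real_derivative 0) (at t)"
      by (rule has_field_derivative_transform_within_open[of _ _ _ "{..<0}"]) (use 2 in \<open>auto simp: bump_poly_def\<close>)
    then show ?thesis using 2 by (simp add: bump_poly_def)
  next
    case 3
    \<comment> \<open>Dividing by \<open>s\<close> in the difference quotient at 0 is one more
      factor 1/s in front of the polynomial, that is, \<open>pCons 0 p\<close> in place of
      \<open>p\<close>.\<close>
    have "((\<lambda>s. poly (pCons 0 p) (1/s) * exp (-(1/s))) \<longlongrightarrow> 0) (at_right 0)"
      using filterlim_compose[OF poly_times_exp_uminus_tendsto_0 filterlim_inverse_at_top_right, of "pCons 0 p"]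
      by (simp add: inverse_eq_divide)
    then have "((\<lambda>s. (bump_poly p s - bump_poly p 0) / (s - 0)) \<longlongrightarrow> 0) (at_right 0)"
      by (rule Lim_transform_eventually) (auto simp: bump_poly_def eventually_at_filter)
    moreover have "((\<lambda>s. (bump_poly p s - bump_poly p 0) / (s - 0)) \<longlongrightarrow> 0) (at_left 0)"
      by (rule Lim_transform_eventually[of "\<lambda>_. 0"]) (auto simp: bump_poly_def eventually_at_filter)
    ultimately show ?thesis using 3
      by (simp add: has_field_derivative_iff filterlim_at_split bump_poly_def)
  qed
qed

definition bump :: "real \<Rightarrow> real" where "bump = bump_poly 1"

definition bump' :: "real \<Rightarrow> real" where "bump' = bump_poly [:0,0,1:]"

lemma bump_has_derivative: "(bump has_real_derivative bump' t) (at t)"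
  using bump_poly_has_derivative[of 1 t] by (simp add: bump_def bump'_def pderiv_1)

lemma bump_nonneg: "0 \<le> bump t" and bump_eq_0_iff: "bump t = 0 \<longleftrightarrow> t \<le> 0"
  by (auto simp: bump_def bump_poly_def)

lemma bump'_eq_0: "t \<le> 0 \<Longrightarrow> bump' t = 0"
  by (auto simp: bump'_def bump_poly_def)

text \<open>With y = 1/t the derivative is y^2 exp (-y), and y/2 \<le> exp (y/2) gives the bound.
  Nonnegativity makes the gradient term of the maximum principle nonnegative; the upper bound
  provides domination in its limit passage.\<close>

lemma bump'_bounds: "0 \<le> bump' t" "bump' t \<le> 4"
proof -
  show "0 \<le> bump' t" by (auto simp: bump'_def bump_poly_def)
  show "bump' t \<le> 4"
  proof (cases "t > 0")
    case True
    define y where "y = 1/t"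
    have "y > 0" using True by (simp add: y_def)
    have "y/2 \<le> exp (y/2)" using exp_ge_add_one_self[of "y/2"] by linarith
    then have "(y/2)\<^sup>2 \<le> (exp (y/2))\<^sup>2" using \<open>y > 0\<close> by (intro power_mono) auto
    then have "y\<^sup>2 \<le> 4 * exp y" by (simp add: power2_eq_square flip: exp_add)
    then have "y\<^sup>2 * exp (-y) \<le> 4 * exp y * exp (-y)" by (intro mult_right_mono) auto
    then have "y\<^sup>2 * exp (-y) \<le> 4" by (simp add: mult.assoc flip: exp_add)
    then show ?thesis using True by (simp add: bump'_def bump_poly_def y_def power2_eq_square)
  qed (simp add: bump'_eq_0)
qed

lemma continuous_bump: "continuous_on S bump"
  by (rule DERIV_continuous_on[OF DERIV_subset[OF bump_has_derivative subset_UNIV]])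

lemma continuous_bump': "continuous_on S bump'"
  unfolding bump'_def by (rule DERIV_continuous_on[OF DERIV_subset[OF bump_poly_has_derivative subset_UNIV]])

lemma smooth_bump_compose:
  assumes "smooth_on UNIV f"
  shows "smooth_on UNIV (\<lambda>x. bump (f x))"
proof -
  define b where "b n = bump_poly (((\<lambda>p. [:0,0,1:] * (p - pderiv p)) ^^ n) 1)" for n
  have "(b n has_real_derivative b (Suc n) t) (at t)" if "t \<in> UNIV" for n t
    using bump_poly_has_derivative by (simp add: b_def)
  then have "Ck_on k UNIV (\<lambda>x. b 0 (f x))" for k
    by (rule Ck_on_compose_real[where D=UNIV, OF open_UNIV _ _ smooth_onD[OF assms]]) auto
  then show ?thesis by (simp add: smooth_on_def b_def bump_def)
qed

lemma pderiv_dir_bump: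
  assumes "f differentiable (at x)"
  shows "pderiv_dir (\<lambda>x. bump (f x)) v x = bump' (f x) * pderiv_dir f v x"
  by (rule pderiv_dir_eqI[OF has_derivative_compose_real[OF assms bump_has_derivative]])

section \<open>Square integrable functions\<close>

text \<open>One notion for scalar functions, vector fields and pairs of value and gradient, since
  \<open>real \<times> 'a\<close> is again a Euclidean space. \<open>L2_on_iff\<close> and
  \<open>L2_vec_on_iff\<close> connect it with the two given notions.\<close>

definition L2 :: "'m measure \<Rightarrow> ('m \<Rightarrow> 'b::euclidean_space) \<Rightarrow> bool" where
  "L2 M f \<longleftrightarrow> f \<in> borel_measurable M \<and> integrable M (\<lambda>x. (norm (f x))\<^sup>2)"

text \<open>The square of the L2 norm. Keeping the square avoids most square roots; the triangle
  inequality takes the form of \<open>sqn_triangle\<close>, with factors 2 that account for the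
  constants in later estimates.\<close>

definition sqn :: "'m measure \<Rightarrow> ('m \<Rightarrow> 'b::euclidean_space) \<Rightarrow> real" where
  "sqn M f = integral\<^sup>L M (\<lambda>x. (norm (f x))\<^sup>2)"

lemma L2_measurable [measurable_dest]: "L2 M f \<Longrightarrow> f \<in> borel_measurable M"
  by (simp add: L2_def)

lemma L2_integrable: "L2 M f \<Longrightarrow> integrable M (\<lambda>x. (norm (f x))\<^sup>2)"
  by (simp add: L2_def)

lemma sqn_nonneg [simp]: "0 \<le> sqn M f"
  by (simp add: sqn_def)

lemma norm_add_power2_le:
  fixes x y :: "'b::real_inner"
  shows "(norm (x + y))\<^sup>2 \<le> 2 * (norm x)\<^sup>2 + 2 * (norm y)\<^sup>2"
proof -
  have "0 \<le> (norm (x - y))\<^sup>2" by simp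
  moreover have "(norm (x + y))\<^sup>2 + (norm (x - y))\<^sup>2 = 2 * (norm x)\<^sup>2 + 2 * (norm y)\<^sup>2"
    by (simp add: power2_norm_eq_inner inner_simps algebra_simps)
  ultimately show ?thesis by linarith
qed

lemma L2_bound:
  assumes "L2 M g" "f \<in> borel_measurable M" "AE x in M. norm (f x) \<le> norm (g x)"
  shows "L2 M f" "sqn M f \<le> sqn M g"
proof -
  have ae: "AE x in M. (norm (f x))\<^sup>2 \<le> (norm (g x))\<^sup>2"
    using assms(3) by eventually_elim (auto intro: power_mono)
  show "L2 M f" unfolding L2_def
    using assms(2) Bochner_Integration.integrable_bound[OF L2_integrable[OF assms(1)], of "\<lambda>x. (norm (f x))\<^sup>2"] ae by auto
  then show "sqn M f \<le> sqn M g" unfolding sqn_def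
    by (intro integral_mono_AE L2_integrable assms ae)
qed

lemma L2_add:
  assumes "L2 M f" "L2 M g"
  shows "L2 M (\<lambda>x. f x + g x)" "sqn M (\<lambda>x. f x + g x) \<le> 2 * sqn M f + 2 * sqn M g"
proof -
  have i: "integrable M (\<lambda>x. 2 * (norm (f x))\<^sup>2 + 2 * (norm (g x))\<^sup>2)"
    using assms by (auto simp: L2_def)
  show L: "L2 M (\<lambda>x. f x + g x)" unfolding L2_def
    using assms by (auto intro!: Bochner_Integration.integrable_bound[OF i] norm_add_power2_le simp: L2_def)
  have "sqn M (\<lambda>x. f x + g x) \<le> integral\<^sup>L M (\<lambda>x. 2 * (norm (f x))\<^sup>2 + 2 * (norm (g x))\<^sup>2)"
    unfolding sqn_def by (intro integral_mono L2_integrable[OF L] i norm_add_power2_le)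
  then show "sqn M (\<lambda>x. f x + g x) \<le> 2 * sqn M f + 2 * sqn M g"
    using assms by (simp add: sqn_def L2_def)
qed

lemma L2_scaleR: "L2 M f \<Longrightarrow> L2 M (\<lambda>x. c *\<^sub>R f x)"
  by (auto simp: L2_def power_mult_distrib)

lemma sqn_scaleR: "sqn M (\<lambda>x. c *\<^sub>R f x) = c\<^sup>2 * sqn M f"
  by (simp add: sqn_def power_mult_distrib)

lemma L2_uminus: "L2 M f \<Longrightarrow> L2 M (\<lambda>x. - f x)"
  by (auto simp: L2_def)

lemma L2_diff:
  assumes "L2 M f" "L2 M g"
  shows "L2 M (\<lambda>x. f x - g x)" "sqn M (\<lambda>x. f x - g x) \<le> 2 * sqn M f + 2 * sqn M g"
  using L2_add[OF assms(1) L2_uminus[OF assms(2)]] by (simp_all add: sqn_def)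

lemma sqn_commute: "sqn M (\<lambda>x. f x - g x) = sqn M (\<lambda>x. g x - f x)"
  by (simp add: sqn_def norm_minus_commute)

lemma sqn_triangle:
  assumes "L2 M f" "L2 M g" "L2 M h"
  shows "sqn M (\<lambda>x. f x - h x) \<le> 2 * sqn M (\<lambda>x. f x - g x) + 2 * sqn M (\<lambda>x. g x - h x)"
  using L2_add(2)[OF L2_diff(1)[OF assms(1,2)] L2_diff(1)[OF assms(2,3)]] by simp

lemma L2_bounded_scaleR:
  assumes "L2 M f" "c \<in> borel_measurable M" "AE x in M. \<bar>c x\<bar> \<le> C"
  shows "L2 M (\<lambda>x. c x *\<^sub>R f x)" "sqn M (\<lambda>x. c x *\<^sub>R f x) \<le> C\<^sup>2 * sqn M f"
proof -
  have ae: "AE x in M. norm (c x *\<^sub>R f x) \<le> norm (C *\<^sub>R f x)"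
    using assms(3) by eventually_elim (auto intro!: mult_right_mono)
  show "L2 M (\<lambda>x. c x *\<^sub>R f x)" "sqn M (\<lambda>x. c x *\<^sub>R f x) \<le> C\<^sup>2 * sqn M f"
    using L2_bound[OF L2_scaleR[OF assms(1)] _ ae] assms by (simp_all add: sqn_scaleR L2_measurable)
qed

lemma L2_norm: "L2 M f \<Longrightarrow> L2 M (\<lambda>x. norm (f x))" "sqn M (\<lambda>x. norm (f x)) = sqn M f"
  by (auto simp: L2_def sqn_def)

lemma L2_integrable_mult_norm:
  assumes "L2 M f" "L2 M g"
  shows "integrable M (\<lambda>x. norm (f x) * norm (g x))"
proof -
  have i: "integrable M (\<lambda>x. (norm (f x))\<^sup>2 + (norm (g x))\<^sup>2)" using assms by (auto simp: L2_def)
  have "norm (norm (f x) * norm (g x)) \<le> norm ((norm (f x))\<^sup>2 + (norm (g x))\<^sup>2)" for x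
  proof -
    have "2 * (norm (f x) * norm (g x)) \<le> (norm (f x))\<^sup>2 + (norm (g x))\<^sup>2"
      using sum_squares_bound[of "norm (f x)" "norm (g x)"] by simp
    moreover have "0 \<le> norm (f x) * norm (g x)" by simp
    ultimately have "norm (f x) * norm (g x) \<le> (norm (f x))\<^sup>2 + (norm (g x))\<^sup>2" by linarith
    then show ?thesis by simp
  qed
  then show ?thesis
    using assms by (intro Bochner_Integration.integrable_bound[OF i]) auto
qed

lemma L2_integrable_inner:
  assumes "L2 M f" "L2 M g"
  shows "integrable M (\<lambda>x. f x \<bullet> g x)"
  using assms
  by (intro Bochner_Integration.integrable_bound[OF L2_integrable_mult_norm[OF assms]])
    (auto simp: Cauchy_Schwarz_ineq2)

lemma L2_integrable_mult:
  fixes f g :: "'m \<Rightarrow> real"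
  shows "L2 M f \<Longrightarrow> L2 M g \<Longrightarrow> integrable M (\<lambda>x. f x * g x)"
  using L2_integrable_inner[of M f g] by simp

lemma L2_Cauchy_Schwarz:
  assumes "L2 M f" "L2 M g"
  shows "\<bar>integral\<^sup>L M (\<lambda>x. f x \<bullet> g x)\<bar> \<le> sqrt (sqn M f) * sqrt (sqn M g)"
proof -
  let ?I = "integral\<^sup>L M (\<lambda>x. f x \<bullet> g x)"
  note i = L2_integrable[OF assms(1)] L2_integrable[OF assms(2)] L2_integrable_inner[OF assms]
  have quad: "0 \<le> sqn M f + 2 * t * ?I + t\<^sup>2 * sqn M g" for t
  proof -
    have "(norm (f x + t *\<^sub>R g x))\<^sup>2 = (norm (f x))\<^sup>2 + 2 * t * (f x \<bullet> g x) + t\<^sup>2 * (norm (g x))\<^sup>2" for x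
      unfolding power2_norm_eq_inner power2_eq_square[of t] by (simp add: inner_simps inner_commute algebra_simps)
    then have "sqn M (\<lambda>x. f x + t *\<^sub>R g x) = sqn M f + 2 * t * ?I + t\<^sup>2 * sqn M g"
      using i by (simp add: sqn_def)
    then show ?thesis using sqn_nonneg[of M "\<lambda>x. f x + t *\<^sub>R g x"] by simp
  qed
  have "?I\<^sup>2 \<le> sqn M f * sqn M g"
  proof (cases "sqn M g = 0")
    case True
    \<comment> \<open>With \<open>sqn M g = 0\<close> the quadratic in \<open>t\<close> is affine.
      If its slope were nonzero, it would take the value -1 at the chosen \<open>t\<close>.\<close>
    have "?I = 0"
    proof (rule ccontr)
      assume "?I \<noteq> 0"
      then show False using quad[of "- (sqn M f + 1) / (2 * ?I)"] True by (simp add: field_simps)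
    qed
    then show ?thesis using True by simp
  next
    case False
    then have "0 < sqn M g" using sqn_nonneg[of M g] by linarith
    \<comment> \<open>The quadratic is evaluated at its minimizer
      \<open>t = - ?I / sqn M g\<close>.\<close>
    have "0 \<le> (sqn M f + 2 * (- ?I / sqn M g) * ?I + (- ?I / sqn M g)\<^sup>2 * sqn M g) * sqn M g"
      using quad[of "- ?I / sqn M g"] \<open>0 < sqn M g\<close> by (intro mult_nonneg_nonneg) auto
    also have "\<dots> = sqn M f * sqn M g - ?I\<^sup>2"
      using \<open>0 < sqn M g\<close> by (simp add: field_simps power2_eq_square)
    finally show ?thesis by simp
  qed
  then have "sqrt (?I\<^sup>2) \<le> sqrt (sqn M f * sqn M g)" by (rule real_sqrt_le_mono)
  then show ?thesis by (simp add: real_sqrt_mult)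
qed

lemma L2_tendsto_inner:
  assumes f: "\<And>n. L2 M (f n)" "L2 M f'" "(\<lambda>n. sqn M (\<lambda>x. f n x - f' x)) \<longlonglongrightarrow> 0" and g: "L2 M g"
  shows "(\<lambda>n. integral\<^sup>L M (\<lambda>x. f n x \<bullet> g x)) \<longlonglongrightarrow> integral\<^sup>L M (\<lambda>x. f' x \<bullet> g x)"
proof -
  have "(\<lambda>n. sqrt (sqn M (\<lambda>x. f n x - f' x)) * sqrt (sqn M g)) \<longlonglongrightarrow> 0"
    using tendsto_real_sqrt[OF f(3)] by (intro tendsto_mult_left_zero) simp
  moreover have "norm (integral\<^sup>L M (\<lambda>x. f n x \<bullet> g x) - integral\<^sup>L M (\<lambda>x. f' x \<bullet> g x))
      \<le> sqrt (sqn M (\<lambda>x. f n x - f' x)) * sqrt (sqn M g)" for n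
    using L2_Cauchy_Schwarz[OF L2_diff(1)[OF f(1) f(2)] g, of n] L2_integrable_inner[OF f(1) g, of n] L2_integrable_inner[OF f(2) g]
    by (simp add: inner_diff_left)
  ultimately have "(\<lambda>n. integral\<^sup>L M (\<lambda>x. f n x \<bullet> g x) - integral\<^sup>L M (\<lambda>x. f' x \<bullet> g x)) \<longlonglongrightarrow> 0"
    by (metis (no_types, lifting) Lim_null_comparison always_eventually)
  then show ?thesis by (simp add: LIM_zero_iff)
qed

text \<open>Convergence of \<open>f\<close> is uniform over a bounded family of second factors. Only
  the difference is claimed to converge, because the \<open>g n\<close> need not converge and
  neither integral need have a limit by itself.\<close>

lemma L2_tendsto_inner_bounded:
  assumes f: "\<And>n. L2 M (f n)" "L2 M f'" "(\<lambda>n. sqn M (\<lambda>x. f n x - f' x)) \<longlonglongrightarrow> 0"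
    and g: "\<And>n. L2 M (g n)" "\<And>n. sqn M (g n) \<le> C"
  shows "(\<lambda>n. integral\<^sup>L M (\<lambda>x. f n x \<bullet> g n x) - integral\<^sup>L M (\<lambda>x. f' x \<bullet> g n x)) \<longlonglongrightarrow> 0"
proof -
  have "(\<lambda>n. sqrt (sqn M (\<lambda>x. f n x - f' x)) * sqrt C) \<longlonglongrightarrow> 0"
    using tendsto_real_sqrt[OF f(3)] by (intro tendsto_mult_left_zero) simp
  moreover have "norm (integral\<^sup>L M (\<lambda>x. f n x \<bullet> g n x) - integral\<^sup>L M (\<lambda>x. f' x \<bullet> g n x))
      \<le> sqrt (sqn M (\<lambda>x. f n x - f' x)) * sqrt C" for n
  proof -
    have "norm (integral\<^sup>L M (\<lambda>x. f n x \<bullet> g n x) - integral\<^sup>L M (\<lambda>x. f' x \<bullet> g n x))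
      \<le> sqrt (sqn M (\<lambda>x. f n x - f' x)) * sqrt (sqn M (g n))"
      using L2_Cauchy_Schwarz[OF L2_diff(1)[OF f(1) f(2)] g(1), of n n] L2_integrable_inner[OF f(1) g(1), of n n] L2_integrable_inner[OF f(2) g(1), of n]
      by (simp add: inner_diff_left)
    also have "\<dots> \<le> sqrt (sqn M (\<lambda>x. f n x - f' x)) * sqrt C"
      using g(2)[of n] by (intro mult_left_mono) auto
    finally show ?thesis .
  qed
  ultimately show ?thesis
    by (metis (no_types, lifting) Lim_null_comparison always_eventually)
qed

lemma L2_tendsto_bounded:
  assumes f: "\<And>n. L2 M (f n)" "L2 M f'" "(\<lambda>n. sqn M (\<lambda>x. f n x - f' x)) \<longlonglongrightarrow> 0"
  obtains C where "\<And>n. sqn M (f n) \<le> C"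
proof -
  obtain B where B: "\<And>n. norm (sqn M (\<lambda>x. f n x - f' x)) \<le> B"
    using convergent_imp_Bseq[of "\<lambda>n. sqn M (\<lambda>x. f n x - f' x)"] f(3) unfolding Bseq_def convergent_def by blast
  have "sqn M (f n) \<le> 2 * B + 2 * sqn M f'" for n
    using L2_add(2)[OF L2_diff(1)[OF f(1)[of n] f(2)] f(2)] B[of n] by simp
  then show ?thesis using that by blast
qed

lemma L2_tendsto_inner2:
  assumes f: "\<And>n. L2 M (f n)" "L2 M f'" "(\<lambda>n. sqn M (\<lambda>x. f n x - f' x)) \<longlonglongrightarrow> 0"
    and g: "\<And>n. L2 M (g n)" "L2 M g'" "(\<lambda>n. sqn M (\<lambda>x. g n x - g' x)) \<longlonglongrightarrow> 0"
  shows "(\<lambda>n. integral\<^sup>L M (\<lambda>x. f n x \<bullet> g n x)) \<longlonglongrightarrow> integral\<^sup>L M (\<lambda>x. f' x \<bullet> g' x)"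
proof -
  obtain C where C: "\<And>n. sqn M (g n) \<le> C" using L2_tendsto_bounded[OF g] by blast
  have "(\<lambda>n. integral\<^sup>L M (\<lambda>x. f' x \<bullet> g n x)) \<longlonglongrightarrow> integral\<^sup>L M (\<lambda>x. f' x \<bullet> g' x)"
    using L2_tendsto_inner[OF g f(2)] by (simp add: inner_commute)
  from tendsto_add[OF L2_tendsto_inner_bounded[where g=g, OF f g(1) C] this] show ?thesis by simp
qed

lemma L2_tendsto_sqn:
  assumes f: "\<And>n. L2 M (f n)" "L2 M f'" "(\<lambda>n. sqn M (\<lambda>x. f n x - f' x)) \<longlonglongrightarrow> 0"
  shows "(\<lambda>n. sqn M (f n)) \<longlonglongrightarrow> sqn M f'"
  using L2_tendsto_inner2[OF f f] by (simp add: sqn_def power2_norm_eq_inner)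

lemma L2_tendsto_add:
  assumes f: "\<And>n. L2 M (f n)" "L2 M f'" "(\<lambda>n. sqn M (\<lambda>x. f n x - f' x)) \<longlonglongrightarrow> 0"
    and g: "\<And>n. L2 M (g n)" "L2 M g'" "(\<lambda>n. sqn M (\<lambda>x. g n x - g' x)) \<longlonglongrightarrow> 0"
  shows "(\<lambda>n. sqn M (\<lambda>x. (f n x + g n x) - (f' x + g' x))) \<longlonglongrightarrow> 0"
proof (rule Lim_null_comparison)
  have "sqn M (\<lambda>x. (f n x + g n x) - (f' x + g' x)) \<le> 2 * sqn M (\<lambda>x. f n x - f' x) + 2 * sqn M (\<lambda>x. g n x - g' x)" for n
    using L2_add(2)[OF L2_diff(1)[OF f(1)[of n] f(2)] L2_diff(1)[OF g(1)[of n] g(2)]] by (simp add: algebra_simps)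
  then show "\<forall>\<^sub>F n in sequentially. norm (sqn M (\<lambda>x. (f n x + g n x) - (f' x + g' x)))
      \<le> 2 * sqn M (\<lambda>x. f n x - f' x) + 2 * sqn M (\<lambda>x. g n x - g' x)" by simp
  show "(\<lambda>n. 2 * sqn M (\<lambda>x. f n x - f' x) + 2 * sqn M (\<lambda>x. g n x - g' x)) \<longlonglongrightarrow> 0"
    using tendsto_add[OF tendsto_mult_left[OF f(3), of 2] tendsto_mult_left[OF g(3), of 2]] by simp
qed

lemma L2_AE_subseq:
  assumes f: "\<And>n. L2 M (f n)" "L2 M f'" "(\<lambda>n. sqn M (\<lambda>x. f n x - f' x)) \<longlonglongrightarrow> 0"
  obtains r where "strict_mono r" "AE x in M. (\<lambda>n. f (r n) x) \<longlonglongrightarrow> f' x"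
proof -
  have "(\<lambda>n. \<integral>x. norm ((norm (f n x - f' x))\<^sup>2) \<partial>M) \<longlonglongrightarrow> 0" using f(3) by (simp add: sqn_def)
  then obtain r where r: "strict_mono r" "AE x in M. (\<lambda>n. (norm (f (r n) x - f' x))\<^sup>2) \<longlonglongrightarrow> 0"
    using tendsto_L1_AE_subseq[of M "\<lambda>n x. (norm (f n x - f' x))\<^sup>2"] L2_integrable[OF L2_diff(1)[OF f(1,2)]] by blast
  have "AE x in M. (\<lambda>n. f (r n) x) \<longlonglongrightarrow> f' x"
    using r(2)
  proof eventually_elim
    case (elim x)
    then have "(\<lambda>n. sqrt ((norm (f (r n) x - f' x))\<^sup>2)) \<longlonglongrightarrow> sqrt 0" by (rule tendsto_real_sqrt)
    then show ?case by (simp add: tendsto_norm_zero_iff LIM_zero_iff)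
  qed
  then show ?thesis using that r(1) by blast
qed

lemma sqn_eq_0_AE: "L2 M f \<Longrightarrow> sqn M f = 0 \<Longrightarrow> AE x in M. f x = 0"
  using integral_nonneg_eq_0_iff_AE[OF L2_integrable, of M f] by (simp add: sqn_def)

text \<open>Riesz-Fischer: a rapidly converging subsequence has a limit almost everywhere, and
  Fatou's lemma transfers the Cauchy estimate to that limit.\<close>

lemma L2_complete:
  fixes f :: "nat \<Rightarrow> 'm \<Rightarrow> 'b::euclidean_space"
  assumes f: "\<And>n. L2 M (f n)"
    and cauchy: "\<And>e. e > 0 \<Longrightarrow> \<exists>N. \<forall>m\<ge>N. \<forall>n\<ge>N. sqn M (\<lambda>x. f m x - f n x) \<le> e"
  obtains g where "L2 M g" "(\<lambda>n. sqn M (\<lambda>x. f n x - g x)) \<longlonglongrightarrow> 0"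
proof -
  have "\<exists>N. \<forall>m\<ge>N. \<forall>n\<ge>N. sqn M (\<lambda>x. f m x - f n x) \<le> (1/4) ^ k" for k :: nat
    by (rule cauchy) simp
  then obtain N where N: "\<And>k m n. m \<ge> N k \<Longrightarrow> n \<ge> N k \<Longrightarrow> sqn M (\<lambda>x. f m x - f n x) \<le> (1/4) ^ k" by metis
  \<comment> \<open>Partial sums of \<open>Suc (N i)\<close> increase strictly and dominate each
    \<open>N k\<close>, whatever the sequence \<open>N\<close> is.\<close>
  define r where "r k = (\<Sum>i\<le>k. Suc (N i))" for k
  have rN: "N k \<le> r k" for k unfolding r_def by (induction k) auto
  have "strict_mono r" by (rule strict_monoI_Suc) (simp add: r_def)
  define u where "u k x = (norm (f (r (Suc k)) x - f (r k) x))\<^sup>2" for k x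
  have u0: "0 \<le> u k x" for k x by (simp add: u_def)
  have ui: "integrable M (u k)" for k unfolding u_def using L2_integrable[OF L2_diff(1)[OF f f]] .
  have ule: "integral\<^sup>L M (u k) \<le> (1/4) ^ k" for k
    using N[of k "r (Suc k)" "r k"] rN[of k] strict_mono_less_eq[OF \<open>strict_mono r\<close>, of k "Suc k"]
    by (auto simp: sqn_def u_def[abs_def])
  \<comment> \<open>The integral of \<open>u k\<close> is at most 4^-k, which leaves room for the
    weight 2^k. The weight is what later turns summable squares into summable increments.\<close>
  have "(\<integral>\<^sup>+x. (\<Sum>k. ennreal (2 ^ k * u k x)) \<partial>M) = (\<Sum>k. \<integral>\<^sup>+x. ennreal (2 ^ k * u k x) \<partial>M)"
    by (rule nn_integral_suminf) (use ui in auto)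
  also have "\<dots> \<le> (\<Sum>k. ennreal ((1/2) ^ k))"
  proof (intro suminf_le summableI)
    fix k :: nat
    have "(\<integral>\<^sup>+x. ennreal (2 ^ k * u k x) \<partial>M) = ennreal (\<integral>x. 2 ^ k * u k x \<partial>M)"
      by (rule nn_integral_eq_integral) (use ui u0 in auto)
    also have "\<dots> \<le> ennreal ((1/2) ^ k)"
    proof (rule ennreal_leI)
      have "(\<integral>x. 2 ^ k * u k x \<partial>M) \<le> 2 ^ k * (1/4) ^ k" using ule[of k] by simp
      also have "\<dots> = (1/2) ^ k" by (simp flip: power_mult_distrib)
      finally show "(\<integral>x. 2 ^ k * u k x \<partial>M) \<le> (1/2) ^ k" .
    qed
    finally show "(\<integral>\<^sup>+x. ennreal (2 ^ k * u k x) \<partial>M) \<le> ennreal ((1/2) ^ k)" .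
  qed
  also have "\<dots> < \<infinity>"
  proof -
    have "(\<Sum>k. ennreal ((1/2) ^ k)) = ennreal (\<Sum>k. (1/2) ^ k)"
      by (rule suminf_ennreal2) (auto intro!: summable_geometric)
    then show ?thesis by simp
  qed
  finally have "AE x in M. (\<Sum>k. ennreal (2 ^ k * u k x)) \<noteq> \<infinity>"
    by (intro nn_integral_PInf_AE) (use ui in auto)
  then have conv: "AE x in M. convergent (\<lambda>k. f (r k) x)"
  proof eventually_elim
    case (elim x)
    have "summable (\<lambda>k. 2 ^ k * u k x)"
      by (rule summable_suminf_not_top) (use elim in \<open>auto simp: u_def\<close>)
    then have "summable (\<lambda>k. 2 ^ k * u k x + (1/2) ^ k)" by (intro summable_add summable_geometric) auto
    moreover have "norm (f (r (Suc k)) x - f (r k) x) \<le> 2 ^ k * u k x + (1/2) ^ k" for k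
    proof -
      define d where "d = norm (f (r (Suc k)) x - f (r k) x)"
      have "0 \<le> d" by (simp add: d_def)
      \<comment> \<open>This square yields 2 d \<le> 2^k d^2 + 2^-k, so the increments are dominated
        by a summable series.\<close>
      have "0 \<le> (2 ^ k * d - 1)\<^sup>2 * (1/2) ^ k" by simp
      also have "\<dots> = 2 ^ k * d\<^sup>2 + (1/2) ^ k - 2 * d"
        by (simp add: power2_eq_square algebra_simps power_one_over)
      finally have "d \<le> 2 ^ k * d\<^sup>2 + (1/2) ^ k" using \<open>0 \<le> d\<close> by linarith
      then show ?thesis by (simp add: u_def d_def)
    qed
    ultimately have "summable (\<lambda>k. f (r (Suc k)) x - f (r k) x)"
      by (rule summable_comparison_test'[where N=0])
    then have "convergent (\<lambda>n. \<Sum>k<n. f (r (Suc k)) x - f (r k) x)" by (simp only: summable_iff_convergent)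
    then have "convergent (\<lambda>n. f (r n) x - f (r 0) x)"
      by (simp only: sum_lessThan_telescope[of "\<lambda>n. f (r n) x"])
    from convergent_add[OF this convergent_const[of "f (r 0) x"]] show ?case by simp
  qed
  define g where "g x = lim (\<lambda>k. f (r k) x)" for x
  have gm: "g \<in> borel_measurable M" unfolding g_def
    by (rule borel_measurable_lim_metric) (use f in auto)
  have lim: "AE x in M. (\<lambda>k. f (r k) x) \<longlonglongrightarrow> g x"
    using conv by eventually_elim (simp add: g_def convergent_LIMSEQ_iff)
  have fatou: "(\<integral>\<^sup>+x. ennreal ((norm (f m x - g x))\<^sup>2) \<partial>M) \<le> ennreal e"
    if e: "e > 0" "\<And>n. n \<ge> N0 \<Longrightarrow> sqn M (\<lambda>x. f m x - f n x) \<le> e" for m N0 e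
  proof -
    have "(\<integral>\<^sup>+x. ennreal ((norm (f m x - g x))\<^sup>2) \<partial>M) = (\<integral>\<^sup>+x. liminf (\<lambda>k. ennreal ((norm (f m x - f (r k) x))\<^sup>2)) \<partial>M)"
      using lim
    proof (intro nn_integral_cong_AE, eventually_elim)
      case (elim x)
      have "(\<lambda>k. ennreal ((norm (f m x - f (r k) x))\<^sup>2)) \<longlonglongrightarrow> ennreal ((norm (f m x - g x))\<^sup>2)"
        by (intro tendsto_ennrealI tendsto_power tendsto_norm tendsto_diff tendsto_const elim)
      then show ?case using lim_imp_Liminf[OF sequentially_bot] by metis
    qed
    also have "\<dots> \<le> liminf (\<lambda>k. \<integral>\<^sup>+x. ennreal ((norm (f m x - f (r k) x))\<^sup>2) \<partial>M)"
      by (rule nn_integral_liminf) (use f in measurable)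
    also have "\<dots> \<le> limsup (\<lambda>k. \<integral>\<^sup>+x. ennreal ((norm (f m x - f (r k) x))\<^sup>2) \<partial>M)"
      by (rule Liminf_le_Limsup) simp
    also have "\<dots> \<le> ennreal e"
    proof (rule Limsup_bounded)
      show "\<forall>\<^sub>F k in sequentially. (\<integral>\<^sup>+x. ennreal ((norm (f m x - f (r k) x))\<^sup>2) \<partial>M) \<le> ennreal e"
        unfolding eventually_sequentially
      proof (intro exI[of _ N0] allI impI)
        fix k assume "N0 \<le> k"
        then have "N0 \<le> r k" using seq_suble[OF \<open>strict_mono r\<close>, of k] by linarith
        then show "(\<integral>\<^sup>+x. ennreal ((norm (f m x - f (r k) x))\<^sup>2) \<partial>M) \<le> ennreal e"
          using e(2)[of "r k"] nn_integral_eq_integral[OF L2_integrable[OF L2_diff(1)[OF f f]], of m "r k"]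
          by (simp add: sqn_def ennreal_leI)
      qed
    qed
    finally show ?thesis .
  qed
  have main: "L2 M (\<lambda>x. f m x - g x) \<and> sqn M (\<lambda>x. f m x - g x) \<le> e"
    if e: "e > 0" "\<And>n. n \<ge> N0 \<Longrightarrow> sqn M (\<lambda>x. f m x - f n x) \<le> e" for m N0 e
  proof -
    have b: "(\<integral>\<^sup>+x. ennreal ((norm (f m x - g x))\<^sup>2) \<partial>M) \<le> ennreal e" using fatou[OF e] by blast
    then have "(\<integral>\<^sup>+x. ennreal ((norm (f m x - g x))\<^sup>2) \<partial>M) < \<infinity>"
      by (rule le_less_trans) simp
    then have i: "integrable M (\<lambda>x. (norm (f m x - g x))\<^sup>2)"
      using f gm by (intro integrableI_bounded) auto
    have "ennreal (sqn M (\<lambda>x. f m x - g x)) \<le> ennreal e"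
      using nn_integral_eq_integral[OF i] b by (simp add: sqn_def)
    moreover have "(\<lambda>x. f m x - g x) \<in> borel_measurable M"
      by (intro borel_measurable_diff gm L2_measurable f)
    ultimately show ?thesis using i e(1) by (simp add: L2_def ennreal_le_iff)
  qed
  have "L2 M g"
  proof -
    obtain N0 where "\<forall>m\<ge>N0. \<forall>n\<ge>N0. sqn M (\<lambda>x. f m x - f n x) \<le> 1" using cauchy[of 1] by auto
    then have "L2 M (\<lambda>x. f N0 x - g x)" using main[of 1 N0 N0] by simp
    from L2_diff(1)[OF f[of N0] this] show ?thesis by simp
  qed
  moreover have "(\<lambda>n. sqn M (\<lambda>x. f n x - g x)) \<longlonglongrightarrow> 0"
  proof (rule LIMSEQ_I)
    fix e :: real assume "e > 0"
    then obtain N0 where "\<forall>m\<ge>N0. \<forall>n\<ge>N0. sqn M (\<lambda>x. f m x - f n x) \<le> e/2" using cauchy[of "e/2"] by auto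
    then have "\<forall>n\<ge>N0. sqn M (\<lambda>x. f n x - g x) \<le> e/2" using main[of "e/2" N0] \<open>e > 0\<close> by simp
    then show "\<exists>no. \<forall>n\<ge>no. norm (sqn M (\<lambda>x. f n x - g x) - 0) < e" using \<open>e > 0\<close> by force
  qed
  ultimately show ?thesis using that by blast
qed

section \<open>Test functions and their gradients in L2\<close>

text \<open>Value and gradient in one vector: the H^1 norm becomes the L2 norm of a single function,
  and all L2 lemmas apply to it directly.\<close>

definition test_pair :: "('a::euclidean_space \<Rightarrow> real) \<Rightarrow> 'a \<Rightarrow> real \<times> 'a" where
  "test_pair \<psi> x = (\<psi> x, grad \<psi> x)"

lemma Ck_on_subset: "Ck_on k S f \<Longrightarrow> T \<subseteq> S \<Longrightarrow> Ck_on k T f"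
  by (induction k arbitrary: f) (auto intro: continuous_on_subset differentiable_on_subset)

lemma fst_test_pair [simp]: "fst (test_pair \<psi> x) = \<psi> x"
  and snd_test_pair [simp]: "snd (test_pair \<psi> x) = grad \<psi> x"
  by (simp_all add: test_pair_def)

lemma grad_inner_Basis: "i \<in> Basis \<Longrightarrow> grad f x \<bullet> i = pderiv_dir f i x"
  by (simp add: grad_def inner_sum_left inner_Basis if_distrib cong: if_cong)

lemma grad_inner: "grad f x \<bullet> v = (\<Sum>i\<in>Basis. pderiv_dir f i x * (v \<bullet> i))"
  by (simp add: grad_def inner_sum_left inner_commute[of v])

lemma norm_grad: "(norm (grad f x))\<^sup>2 = (\<Sum>i\<in>Basis. (pderiv_dir f i x)\<^sup>2)"
proof -
  have "(norm (grad f x))\<^sup>2 = (\<Sum>i\<in>Basis. pderiv_dir f i x * (grad f x \<bullet> i))"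
    unfolding power2_norm_eq_inner by (rule grad_inner)
  then show ?thesis by (simp add: grad_inner_Basis power2_eq_square)
qed

lemma grad_add: "f differentiable (at x) \<Longrightarrow> g differentiable (at x) \<Longrightarrow> grad (\<lambda>x. f x + g x) x = grad f x + grad g x"
  by (simp add: grad_def pderiv_dir_add scaleR_add_left sum.distrib)

lemma grad_cmult: "f differentiable (at x) \<Longrightarrow> grad (\<lambda>x. c * f x) x = c *\<^sub>R grad f x"
  by (simp add: grad_def pderiv_dir_mult scaleR_sum_right)

lemma test_pair_add: "test_fun \<Omega> f \<Longrightarrow> test_fun \<Omega> g \<Longrightarrow>
    test_pair (\<lambda>x. f x + g x) = (\<lambda>x. test_pair f x + test_pair g x)"
  by (auto simp: test_pair_def grad_add[OF test_fun_differentiable test_fun_differentiable])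

lemma test_pair_cmult: "test_fun \<Omega> f \<Longrightarrow> test_pair (\<lambda>x. c * f x) = (\<lambda>x. c *\<^sub>R test_pair f x)"
  by (auto simp: test_pair_def grad_cmult[OF test_fun_differentiable])

lemma test_pair_diff:
  assumes "test_fun \<Omega> f" "test_fun \<Omega> g"
  shows "test_pair (\<lambda>x. f x - g x) = (\<lambda>x. test_pair f x - test_pair g x)"
  using test_pair_add[OF assms(1) test_fun_cmult[OF assms(2), of "-1"]] test_pair_cmult[OF assms(2), of "-1"] by simp

lemma continuous_grad: "test_fun \<Omega> f \<Longrightarrow> continuous_on S (grad f)"
  unfolding grad_def by (intro continuous_intros test_fun_continuous test_fun_pderiv_dir)

lemma continuous_test_pair: "test_fun \<Omega> f \<Longrightarrow> continuous_on S (test_pair f)"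
  unfolding test_pair_def by (intro continuous_intros test_fun_continuous continuous_grad)

lemma test_pair_supportE:
  assumes "test_fun \<Omega> f"
  obtains C where "compact C" "C \<subseteq> \<Omega>" "\<And>x. x \<notin> C \<Longrightarrow> f x = 0"
    "\<And>x v. x \<notin> C \<Longrightarrow> pderiv_dir f v x = 0" "\<And>x. x \<notin> C \<Longrightarrow> grad f x = 0" "\<And>x. x \<notin> C \<Longrightarrow> test_pair f x = 0"
proof -
  obtain C where C: "compact C" "C \<subseteq> \<Omega>" "\<And>x. x \<notin> C \<Longrightarrow> f x = 0" by (rule test_fun_supportE[OF assms]) auto
  have "pderiv_dir f v x = 0" if "x \<notin> C" for x v
    using pderiv_dir_cong[of "-C" x f "\<lambda>_. 0"] that C compact_imp_closed[OF C(1)] by auto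
  then show ?thesis using that[OF C] C(3) by (simp add: test_pair_def grad_def zero_prod_def)
qed

section \<open>L2 on a bounded open set and the space H^1_0 as a closure of test pairs\<close>

locale bounded_domain =
  fixes \<Omega> :: "'a::euclidean_space set"
  assumes open_dom: "open \<Omega>" and bounded_dom: "bounded \<Omega>"
begin

abbreviation "M \<equiv> lebesgue_on \<Omega>"

lemma dom_sets [simp, measurable]: "\<Omega> \<in> sets lebesgue"
  using borel_open[OF open_dom] by (simp add: sets_completionI_sets)

lemma space_M: "space M = \<Omega>"
  by simp

lemma finite_measure_M: "finite_measure M"
  by (rule finite_measure_lebesgue_on) (use bounded_dom open_dom in \<open>simp add: bounded_set_imp_lmeasurable\<close>)

lemma continuous_imp_measurable_M:
  "continuous_on \<Omega> (f :: 'a \<Rightarrow> 'b::euclidean_space) \<Longrightarrow> f \<in> borel_measurable M"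
  by (rule continuous_imp_measurable_on_sets_lebesgue) auto

lemma L2_const: "L2 M (\<lambda>x. c)"
  using finite_measure.integrable_const[OF finite_measure_M] by (simp add: L2_def)

lemma sqn_const: "sqn M (\<lambda>x. c) = (norm c)\<^sup>2 * measure lebesgue \<Omega>"
  by (simp add: sqn_def measure_restrict_space)

lemma L2_imp_integrable:
  fixes f :: "'a \<Rightarrow> 'b::euclidean_space"
  assumes "L2 M f" shows "integrable M f"
  using L2_integrable_mult_norm[OF assms L2_const[of "1::real"]] assms
  by (simp add: integrable_norm_iff L2_measurable)

lemma L2_compact_support:
  fixes f :: "'a \<Rightarrow> 'b::euclidean_space"
  assumes "compact C" "C \<subseteq> \<Omega>" "continuous_on \<Omega> f" "\<And>x. x \<in> \<Omega> - C \<Longrightarrow> f x = 0"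
  shows "L2 M f"
proof -
  have "continuous_on \<Omega> (\<lambda>x. (norm (f x))\<^sup>2)" by (intro continuous_intros assms)
  from integrable_compact_support[OF open_dom assms(1,2) this] assms(3,4) show ?thesis
    by (simp add: L2_def continuous_imp_measurable_M)
qed

lemma L2_test_pair:
  assumes "test_fun \<Omega> f" shows "L2 M (test_pair f)"
proof -
  obtain C where "compact C" "C \<subseteq> \<Omega>" "\<And>x. x \<notin> C \<Longrightarrow> test_pair f x = 0"
    by (rule test_pair_supportE[OF assms]) auto
  then show ?thesis using continuous_test_pair[OF assms] by (intro L2_compact_support) auto
qed

lemma L2_fst:
  fixes Z :: "'a \<Rightarrow> real \<times> 'a"
  assumes "L2 M Z"
  shows "L2 M (\<lambda>x. fst (Z x))" "sqn M (\<lambda>x. fst (Z x)) \<le> sqn M Z"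
proof -
  have "continuous_on UNIV (fst :: real \<times> 'a \<Rightarrow> _)" by (intro continuous_intros)
  from borel_measurable_continuous_on[OF this L2_measurable[OF assms]]
  have m: "(\<lambda>x. fst (Z x)) \<in> borel_measurable M" .
  have ae: "AE x in M. norm (fst (Z x)) \<le> norm (Z x)" by (intro AE_I2) (metis norm_fst_le prod.collapse)
  show "L2 M (\<lambda>x. fst (Z x))" "sqn M (\<lambda>x. fst (Z x)) \<le> sqn M Z" by (rule L2_bound[OF assms m ae])+
qed

lemma L2_snd:
  fixes Z :: "'a \<Rightarrow> real \<times> 'a"
  assumes "L2 M Z"
  shows "L2 M (\<lambda>x. snd (Z x))" "sqn M (\<lambda>x. snd (Z x)) \<le> sqn M Z"
proof -
  have "continuous_on UNIV (snd :: real \<times> 'a \<Rightarrow> _)" by (intro continuous_intros)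
  from borel_measurable_continuous_on[OF this L2_measurable[OF assms]]
  have m: "(\<lambda>x. snd (Z x)) \<in> borel_measurable M" .
  have ae: "AE x in M. norm (snd (Z x)) \<le> norm (Z x)" by (intro AE_I2) (metis norm_snd_le prod.collapse)
  show "L2 M (\<lambda>x. snd (Z x))" "sqn M (\<lambda>x. snd (Z x)) \<le> sqn M Z" by (rule L2_bound[OF assms m ae])+
qed

lemma L2_Pair:
  assumes "L2 M u" "L2 M g"
  shows "L2 M (\<lambda>x. (u x, g x))" "sqn M (\<lambda>x. (u x, g x)) = sqn M u + sqn M g"
proof -
  have n: "(norm (u x, g x))\<^sup>2 = (norm (u x))\<^sup>2 + (norm (g x))\<^sup>2" for x by (simp add: norm_Pair)
  show "L2 M (\<lambda>x. (u x, g x))" "sqn M (\<lambda>x. (u x, g x)) = sqn M u + sqn M g"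
    using assms unfolding L2_def sqn_def n by auto
qed

lemma L2_test: "test_fun \<Omega> f \<Longrightarrow> L2 M f"
  using L2_fst(1)[OF L2_test_pair] by simp

lemma L2_grad: "test_fun \<Omega> f \<Longrightarrow> L2 M (grad f)"
  using L2_snd(1)[OF L2_test_pair] by simp

text \<open>The graph of the gradient over H^1_0, as the L2 closure of the test pairs. The gradient
  is part of the data, so it never has to be chosen again.\<close>

definition H10_pair :: "('a \<Rightarrow> real \<times> 'a) \<Rightarrow> bool" where
  "H10_pair Z \<longleftrightarrow> L2 M Z \<and> (\<exists>\<psi>. (\<forall>k::nat. test_fun \<Omega> (\<psi> k)) \<and> (\<lambda>k. sqn M (\<lambda>x. test_pair (\<psi> k) x - Z x)) \<longlonglongrightarrow> 0)"

lemma integrable_on_compact_subset: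
  fixes f :: "'a \<Rightarrow> 'b::euclidean_space"
  assumes "integrable M f" "compact K" "K \<subseteq> \<Omega>"
  shows "integrable (lebesgue_on K) f"
proof -
  have K: "K \<in> sets lebesgue" using assms(2) by (simp add: compact_imp_closed borel_closed)
  have "integrable lebesgue (\<lambda>x. indicator \<Omega> x *\<^sub>R f x)"
    using assms(1) by (simp add: integrable_restrict_space)
  then have "integrable lebesgue (\<lambda>x. indicator K x *\<^sub>R (indicator \<Omega> x *\<^sub>R f x))"
    by (rule integrable_mult_indicator[OF K])
  moreover have "(\<lambda>x. indicator K x *\<^sub>R (indicator \<Omega> x *\<^sub>R f x)) = (\<lambda>x. indicator K x *\<^sub>R f x)"
    using assms(3) by (force simp: indicator_def)
  ultimately have "integrable lebesgue (\<lambda>x. indicator K x *\<^sub>R f x)" by (simp only:)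
  then show ?thesis using K by (simp add: integrable_restrict_space)
qed

lemma weak_grad_test_fun:
  assumes "test_fun \<Omega> f" "test_fun \<Omega> \<psi>" "i \<in> Basis"
  shows "integral\<^sup>L M (\<lambda>x. f x * pderiv_dir \<psi> i x) = - integral\<^sup>L M (\<lambda>x. (grad f x \<bullet> i) * \<psi> x)"
proof -
  have "Ck_on 1 \<Omega> f"
    by (rule Ck_on_subset[OF smooth_onD[OF test_fun_smooth[OF assms(1)]]]) simp
  then show ?thesis
    using integral_by_parts(3)[OF open_dom _ assms(2), of f i] assms(3) by (simp add: grad_inner_Basis)
qed

text \<open>For fixed \<psi> and \<open>i\<close> the defining identity says that the pair is
  orthogonal to (\<partial>_i \<psi>, \<psi> i). Test pairs have this property by integration by
  parts, and orthogonality survives L2 limits.\<close>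

lemma weak_grad_H10_pair:
  assumes "H10_pair Z"
  shows "weak_grad \<Omega> (\<lambda>x. fst (Z x)) (\<lambda>x. snd (Z x))"
  unfolding weak_grad_def
proof (intro conjI allI impI ballI)
  obtain \<xi> where Z: "L2 M Z" and \<xi>: "\<And>k::nat. test_fun \<Omega> (\<xi> k)" "(\<lambda>k. sqn M (\<lambda>x. test_pair (\<xi> k) x - Z x)) \<longlonglongrightarrow> 0"
    using assms unfolding H10_pair_def by blast
  show "integrable (lebesgue_on K) (\<lambda>x. fst (Z x))" "integrable (lebesgue_on K) (\<lambda>x. snd (Z x))" if "compact K \<and> K \<subseteq> \<Omega>" for K
    using integrable_on_compact_subset[OF L2_imp_integrable[OF L2_fst(1)[OF Z]]]
      integrable_on_compact_subset[OF L2_imp_integrable[OF L2_snd(1)[OF Z]]] that by auto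
  fix \<psi> and i :: 'a assume \<psi>: "test_fun \<Omega> \<psi>" and i: "i \<in> Basis"
  define W where "W x = (pderiv_dir \<psi> i x, \<psi> x *\<^sub>R i)" for x
  have "L2 M (\<lambda>x. \<psi> x *\<^sub>R i)"
    using L2_test[OF \<psi>] i by (auto simp: L2_def power_mult_distrib)
  then have W: "L2 M W" unfolding W_def
    by (intro L2_Pair L2_test test_fun_pderiv_dir \<psi>)
  have "(\<lambda>k. integral\<^sup>L M (\<lambda>x. test_pair (\<xi> k) x \<bullet> W x)) \<longlonglongrightarrow> integral\<^sup>L M (\<lambda>x. Z x \<bullet> W x)"
    by (rule L2_tendsto_inner[OF L2_test_pair[OF \<xi>(1)] Z \<xi>(2) W])
  moreover have "integral\<^sup>L M (\<lambda>x. test_pair (\<xi> k) x \<bullet> W x) = 0" for k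
  proof -
    have "integrable M (\<lambda>x. \<xi> k x * pderiv_dir \<psi> i x)"
      using L2_integrable_mult[OF L2_test[OF \<xi>(1)] L2_test[OF test_fun_pderiv_dir[OF \<psi>]]] .
    moreover have "integrable M (\<lambda>x. (grad (\<xi> k) x \<bullet> i) * \<psi> x)"
      using L2_integrable_mult[OF L2_test[OF test_fun_pderiv_dir[OF \<xi>(1)]] L2_test[OF \<psi>]] i
      by (simp add: grad_inner_Basis)
    ultimately show ?thesis
      using weak_grad_test_fun[OF \<xi>(1) \<psi> i] by (simp add: W_def inner_prod_def mult.commute)
  qed
  ultimately have 0: "integral\<^sup>L M (\<lambda>x. Z x \<bullet> W x) = 0" by (simp add: LIMSEQ_const_iff)
  have "integrable M (\<lambda>x. fst (Z x) * pderiv_dir \<psi> i x)"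
    by (intro L2_integrable_mult L2_fst Z L2_test test_fun_pderiv_dir \<psi>)
  moreover have "integrable M (\<lambda>x. (snd (Z x) \<bullet> i) * \<psi> x)"
    using L2_integrable_inner[OF L2_snd(1)[OF Z] \<open>L2 M (\<lambda>x. \<psi> x *\<^sub>R i)\<close>] by (simp add: mult.commute)
  ultimately show "integral\<^sup>L M (\<lambda>x. fst (Z x) * pderiv_dir \<psi> i x) = - integral\<^sup>L M (\<lambda>x. (snd (Z x) \<bullet> i) * \<psi> x)"
    using 0 by (simp add: W_def inner_prod_def mult.commute)
qed

lemma L2_on_iff: "L2_on \<Omega> u \<longleftrightarrow> L2 M u" and L2_vec_on_iff: "L2_vec_on \<Omega> g \<longleftrightarrow> L2 M g"
  by (simp_all add: L2_on_def L2_vec_on_def L2_def)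

text \<open>The weak gradient demanded by \<open>H1_0\<close> comes for free from
  \<open>weak_grad_H10_pair\<close>; the rest is the Pythagorean splitting of \<open>sqn\<close> on
  pairs.\<close>

lemma H1_0_iff: "H1_0 \<Omega> u \<longleftrightarrow> (\<exists>g. H10_pair (\<lambda>x. (u x, g x)))"
proof -
  have sq: "sqn M (\<lambda>x. test_pair \<psi> x - (u x, g x))
      = integral\<^sup>L M (\<lambda>x. (u x - \<psi> x)\<^sup>2) + integral\<^sup>L M (\<lambda>x. (norm (g x - grad \<psi> x))\<^sup>2)"
    if "L2 M u" "L2 M g" "test_fun \<Omega> \<psi>" for g \<psi>
    using L2_Pair(2)[OF L2_diff(1)[OF that(1) L2_test[OF that(3)]] L2_diff(1)[OF that(2) L2_grad[OF that(3)]]]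
    by (simp add: sqn_commute[of M "test_pair \<psi>"]) (simp add: sqn_def test_pair_def)
  show ?thesis
  proof
    assume "H1_0 \<Omega> u"
    then obtain g and \<psi> :: "nat \<Rightarrow> 'a \<Rightarrow> real" where L: "L2 M u" "L2 M g" and \<psi>: "\<And>k. test_fun \<Omega> (\<psi> k)" and lim:
      "(\<lambda>k. integral\<^sup>L M (\<lambda>x. (u x - \<psi> k x)\<^sup>2) + integral\<^sup>L M (\<lambda>x. (norm (g x - grad (\<psi> k) x))\<^sup>2)) \<longlonglongrightarrow> 0"
      unfolding H1_0_def L2_on_iff L2_vec_on_iff by blast
    have "H10_pair (\<lambda>x. (u x, g x))" unfolding H10_pair_def
      using L2_Pair(1)[OF L] \<psi> lim by (intro conjI exI[of _ \<psi>]) (simp_all add: sq[OF L \<psi>])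
    then show "\<exists>g. H10_pair (\<lambda>x. (u x, g x))" by blast
  next
    assume "\<exists>g. H10_pair (\<lambda>x. (u x, g x))"
    then obtain g and \<psi> :: "nat \<Rightarrow> 'a \<Rightarrow> real" where L: "L2 M (\<lambda>x. (u x, g x))" and \<psi>: "\<And>k. test_fun \<Omega> (\<psi> k)"
      and lim: "(\<lambda>k. sqn M (\<lambda>x. test_pair (\<psi> k) x - (u x, g x))) \<longlonglongrightarrow> 0" and H: "H10_pair (\<lambda>x. (u x, g x))"
      unfolding H10_pair_def by blast
    have L': "L2 M u" "L2 M g" using L2_fst(1)[OF L] L2_snd(1)[OF L] by auto
    have "weak_grad \<Omega> u g" using weak_grad_H10_pair[OF H] by simp
    then show "H1_0 \<Omega> u" unfolding H1_0_def L2_on_iff L2_vec_on_iff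
      using L' \<psi> lim by (intro conjI exI[of _ g] exI[of _ \<psi>]) (simp_all add: sq[OF L' \<psi>])
  qed
qed

lemma H10_pair_diff:
  assumes "H10_pair Z" "H10_pair W" shows "H10_pair (\<lambda>x. Z x - W x)"
proof -
  obtain \<xi> where Z: "L2 M Z" and \<xi>: "\<And>k::nat. test_fun \<Omega> (\<xi> k)" "(\<lambda>k. sqn M (\<lambda>x. test_pair (\<xi> k) x - Z x)) \<longlonglongrightarrow> 0"
    using assms(1) unfolding H10_pair_def by blast
  obtain \<psi> where W: "L2 M W" and \<psi>: "\<And>k::nat. test_fun \<Omega> (\<psi> k)" "(\<lambda>k. sqn M (\<lambda>x. test_pair (\<psi> k) x - W x)) \<longlonglongrightarrow> 0"
    using assms(2) unfolding H10_pair_def by blast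
  have "(\<lambda>k. sqn M (\<lambda>x. (test_pair (\<xi> k) x + - test_pair (\<psi> k) x) - (Z x + - W x))) \<longlonglongrightarrow> 0"
  proof (rule L2_tendsto_add[OF L2_test_pair[OF \<xi>(1)] Z \<xi>(2) L2_uminus[OF L2_test_pair[OF \<psi>(1)]] L2_uminus[OF W]])
    show "(\<lambda>k. sqn M (\<lambda>x. - test_pair (\<psi> k) x - - W x)) \<longlonglongrightarrow> 0"
      using \<psi>(2) by (simp add: sqn_commute[of M "test_pair _"])
  qed
  then show ?thesis unfolding H10_pair_def
    using L2_diff(1)[OF Z W] test_fun_diff[OF \<xi>(1) \<psi>(1)] test_pair_diff[OF \<xi>(1) \<psi>(1)]
    by (intro conjI exI[of _ "\<lambda>k x. \<xi> k x - \<psi> k x"]) auto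
qed

lemma weak_grad_diff:
  assumes "weak_grad \<Omega> u g" "weak_grad \<Omega> v h" "L2 M u" "L2 M g" "L2 M v" "L2 M h"
  shows "weak_grad \<Omega> (\<lambda>x. u x - v x) (\<lambda>x. g x - h x)"
  unfolding weak_grad_def
proof (intro conjI allI impI ballI)
  show "integrable (lebesgue_on K) (\<lambda>x. u x - v x)" "integrable (lebesgue_on K) (\<lambda>x. g x - h x)" if "compact K \<and> K \<subseteq> \<Omega>" for K
    using assms(1,2) that unfolding weak_grad_def by auto
  fix \<psi> and i :: 'a assume \<psi>: "test_fun \<Omega> \<psi>" and i: "i \<in> Basis"
  note L = L2_integrable_mult[OF assms(3) L2_test[OF test_fun_pderiv_dir[OF \<psi>]], of i] L2_integrable_mult[OF assms(5) L2_test[OF test_fun_pderiv_dir[OF \<psi>]], of i]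
  have G: "integrable M (\<lambda>x. (g x \<bullet> i) * \<psi> x)" if "L2 M g" for g
  proof -
    have "L2 M (\<lambda>x. \<psi> x *\<^sub>R i)" using L2_test[OF \<psi>] i by (auto simp: L2_def power_mult_distrib)
    from L2_integrable_inner[OF that this] show ?thesis by (simp add: mult.commute)
  qed
  show "integral\<^sup>L M (\<lambda>x. (u x - v x) * pderiv_dir \<psi> i x) = - integral\<^sup>L M (\<lambda>x. ((g x - h x) \<bullet> i) * \<psi> x)"
    using assms(1,2) \<psi> i L G[OF assms(4)] G[OF assms(6)] unfolding weak_grad_def
    by (simp add: left_diff_distrib inner_diff_left)
qed

end

section \<open>Coercivity of the weighted quadratic form\<close>

text \<open>\<open>m\<close> stands for G''(0) and may have either sign; \<open>lap\<close> is the
  condition on \<Delta>(sqrt a) with this value inserted.\<close>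

locale weighted_domain = bounded_domain \<Omega> for \<Omega> :: "'a::euclidean_space set" +
  fixes a :: "'a \<Rightarrow> real" and m :: real
  assumes nonempty: "\<Omega> \<noteq> {}" and a_C2: "Ck_on 2 \<Omega> a"
    and a_cont: "continuous_on (closure \<Omega>) a" and a_pos: "\<forall>x\<in>closure \<Omega>. a x > 0"
    and lap: "\<forall>x\<in>\<Omega>. laplacian (\<lambda>y. sqrt (a y)) x / sqrt (a x) \<ge> - m"
begin

lemma a_bounds: obtains \<alpha> A where "0 < \<alpha>" "\<And>x. x \<in> \<Omega> \<Longrightarrow> \<alpha> \<le> a x" "\<And>x. x \<in> \<Omega> \<Longrightarrow> a x \<le> A"
proof -
  have c: "compact (closure \<Omega>)" "closure \<Omega> \<noteq> {}" using bounded_dom nonempty by auto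
  obtain x where "x \<in> closure \<Omega>" "\<forall>y\<in>closure \<Omega>. a x \<le> a y" using continuous_attains_inf[OF c a_cont] by blast
  moreover obtain y where "\<forall>z\<in>closure \<Omega>. a z \<le> a y" using continuous_attains_sup[OF c a_cont] by blast
  ultimately show ?thesis using that[of "a x" "a y"] a_pos closure_subset[of \<Omega>] by blast
qed

lemma a_pos_dom: "x \<in> \<Omega> \<Longrightarrow> 0 < a x"
  using a_pos closure_subset by blast

lemma a_measurable [measurable]: "a \<in> borel_measurable M"
  using continuous_imp_measurable_M continuous_on_subset[OF a_cont closure_subset] by blast

lemma a_AE_bounded: obtains A where "0 \<le> A" "AE x in M. \<bar>a x\<bar> \<le> A"
proof -
  obtain \<alpha> A where A: "0 < \<alpha>" "\<And>x. x \<in> \<Omega> \<Longrightarrow> \<alpha> \<le> a x" "\<And>x. x \<in> \<Omega> \<Longrightarrow> a x \<le> A" using a_bounds by blast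
  show ?thesis
  proof (rule that[of "max A 0"])
    show "AE x in M. \<bar>a x\<bar> \<le> max A 0"
    proof (rule AE_I2)
      fix x assume "x \<in> space M"
      then have "0 < a x" "a x \<le> A" using A(3) a_pos_dom by (auto simp: space_M)
      then show "\<bar>a x\<bar> \<le> max A 0" by simp
    qed
  qed simp
qed

lemma L2_a_mult:
  fixes f :: "'a \<Rightarrow> 'b::euclidean_space"
  assumes "L2 M f" shows "L2 M (\<lambda>x. a x *\<^sub>R f x)"
proof -
  obtain A where "AE x in M. \<bar>a x\<bar> \<le> A" using a_AE_bounded by blast
  then show ?thesis using L2_bounded_scaleR(1)[OF assms a_measurable] by blast
qed

lemma L2_a_mult_real: "L2 M f \<Longrightarrow> L2 M (\<lambda>x. a x * f x)" for f :: "'a \<Rightarrow> real"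
  using L2_a_mult[of f] by simp

text \<open>The coefficient operator of the quadratic form: \<open>bform Z W\<close> is the L2
  product of \<open>weight Z\<close> and \<open>W\<close>. Boundedness and limits of the form thus
  reduce to those of the L2 product.\<close>

definition weight :: "('a \<Rightarrow> real \<times> 'a) \<Rightarrow> 'a \<Rightarrow> real \<times> 'a" where
  "weight Z x = a x *\<^sub>R (m * fst (Z x), snd (Z x))"

definition bform :: "('a \<Rightarrow> real \<times> 'a) \<Rightarrow> ('a \<Rightarrow> real \<times> 'a) \<Rightarrow> real" where
  "bform Z W = integral\<^sup>L M (\<lambda>x. a x * (snd (Z x) \<bullet> snd (W x)) + a x * (m * fst (Z x) * fst (W x)))"

lemma bform_eq_inner: "bform Z W = integral\<^sup>L M (\<lambda>x. weight Z x \<bullet> W x)"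
  by (simp add: bform_def weight_def inner_prod_def algebra_simps)

lemma norm_Pair_scale_le: "norm (m * s, v) \<le> (1 + \<bar>m\<bar>) * norm (s, v)" for v :: 'a
proof -
  have "(norm (m * s, v))\<^sup>2 = m\<^sup>2 * s\<^sup>2 + (norm v)\<^sup>2" by (simp add: norm_Pair power_mult_distrib)
  also have "\<dots> \<le> (1 + \<bar>m\<bar>)\<^sup>2 * s\<^sup>2 + (1 + \<bar>m\<bar>)\<^sup>2 * (norm v)\<^sup>2"
  proof (intro add_mono mult_right_mono)
    have "\<bar>m\<bar>\<^sup>2 \<le> (1 + \<bar>m\<bar>)\<^sup>2" by (intro power_mono) auto
    then show "m\<^sup>2 \<le> (1 + \<bar>m\<bar>)\<^sup>2" by simp
    have "1\<^sup>2 \<le> (1 + \<bar>m\<bar>)\<^sup>2" by (intro power_mono) auto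
    then show "(norm v)\<^sup>2 \<le> (1 + \<bar>m\<bar>)\<^sup>2 * (norm v)\<^sup>2"
      using mult_right_mono[of 1 "(1 + \<bar>m\<bar>)\<^sup>2" "(norm v)\<^sup>2"] by simp
  qed auto
  also have "\<dots> = ((1 + \<bar>m\<bar>) * norm (s, v))\<^sup>2"
    by (simp add: norm_Pair power_mult_distrib distrib_left)
  finally show ?thesis by (rule power2_le_imp_le) auto
qed

lemma L2_weight:
  obtains C where "0 \<le> C" "\<And>Z. L2 M Z \<Longrightarrow> L2 M (weight Z)" "\<And>Z. L2 M Z \<Longrightarrow> sqn M (weight Z) \<le> C * sqn M Z"
proof -
  obtain A where A: "0 \<le> A" "AE x in M. \<bar>a x\<bar> \<le> A" using a_AE_bounded by blast
  have *: "L2 M (weight Z) \<and> sqn M (weight Z) \<le> (A * (1 + \<bar>m\<bar>))\<^sup>2 * sqn M Z" if Z: "L2 M Z" for Z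
  proof -
    have L: "L2 M (\<lambda>x. (m * fst (Z x), snd (Z x)))"
      using L2_scaleR[OF L2_fst(1)[OF Z], of m] L2_snd(1)[OF Z] by (intro L2_Pair) auto
    have "L2 M (weight Z)" unfolding weight_def by (rule L2_a_mult[OF L])
    moreover have "AE x in M. norm (weight Z x) \<le> norm ((A * (1 + \<bar>m\<bar>)) *\<^sub>R Z x)"
      using A(2)
    proof eventually_elim
      case (elim x)
      have "norm (weight Z x) = \<bar>a x\<bar> * norm (m * fst (Z x), snd (Z x))" by (simp only: weight_def norm_scaleR)
      also have "\<dots> \<le> A * ((1 + \<bar>m\<bar>) * norm (Z x))"
        using elim norm_Pair_scale_le[of "fst (Z x)" "snd (Z x)"] A(1) by (intro mult_mono) auto
      finally show ?case using A(1) by simp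
    qed
    ultimately show ?thesis
      using L2_bound(2)[OF L2_scaleR[OF Z] L2_measurable] by (simp only: sqn_scaleR simp_thms)
  qed
  show ?thesis by (rule that[of "(A * (1 + \<bar>m\<bar>))\<^sup>2"]) (use * in auto)
qed

lemma L2_weightI: "L2 M Z \<Longrightarrow> L2 M (weight Z)"
  using L2_weight by metis

lemma weight_tendsto:
  assumes "\<And>n. L2 M (Z n)" "L2 M Z'" "(\<lambda>n. sqn M (\<lambda>x. Z n x - Z' x)) \<longlonglongrightarrow> 0"
  shows "(\<lambda>n. sqn M (\<lambda>x. weight (Z n) x - weight Z' x)) \<longlonglongrightarrow> 0"
proof -
  obtain C where C: "\<And>Z. L2 M Z \<Longrightarrow> sqn M (weight Z) \<le> C * sqn M Z"
    by (rule L2_weight) (rule that)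
  have eq: "weight (Z n) x - weight Z' x = weight (\<lambda>x. Z n x - Z' x) x" for n x
    by (simp add: weight_def algebra_simps)
  have "sqn M (\<lambda>x. weight (Z n) x - weight Z' x) \<le> C * sqn M (\<lambda>x. Z n x - Z' x)" for n
    unfolding eq by (rule C[OF L2_diff(1)[OF assms(1,2)]])
  then have le: "\<forall>n. norm (sqn M (\<lambda>x. weight (Z n) x - weight Z' x)) \<le> C * sqn M (\<lambda>x. Z n x - Z' x)" by simp
  have "(\<lambda>n. C * sqn M (\<lambda>x. Z n x - Z' x)) \<longlonglongrightarrow> 0"
    using tendsto_mult_left[OF assms(3), of C] by simp
  with always_eventually[OF le] show ?thesis by (rule Lim_null_comparison)
qed

lemma bform_tendsto:
  assumes "\<And>n. L2 M (Z n)" "L2 M Z'" "(\<lambda>n. sqn M (\<lambda>x. Z n x - Z' x)) \<longlonglongrightarrow> 0"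
    and "\<And>n. L2 M (W n)" "L2 M W'" "(\<lambda>n. sqn M (\<lambda>x. W n x - W' x)) \<longlonglongrightarrow> 0"
  shows "(\<lambda>n. bform (Z n) (W n)) \<longlonglongrightarrow> bform Z' W'"
  unfolding bform_eq_inner
  by (rule L2_tendsto_inner2[OF L2_weightI[OF assms(1)] L2_weightI[OF assms(2)] weight_tendsto[OF assms(1-3)] assms(4-6)])

lemma bform_bound:
  obtains C where "0 \<le> C" "\<And>Z W. L2 M Z \<Longrightarrow> L2 M W \<Longrightarrow> \<bar>bform Z W\<bar> \<le> C * sqrt (sqn M Z) * sqrt (sqn M W)"
proof -
  obtain C where C: "0 \<le> C" "\<And>Z. L2 M Z \<Longrightarrow> sqn M (weight Z) \<le> C * sqn M Z"
    by (rule L2_weight) (rule that)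
  have "\<bar>bform Z W\<bar> \<le> sqrt C * sqrt (sqn M Z) * sqrt (sqn M W)" if "L2 M Z" "L2 M W" for Z W
  proof -
    have "\<bar>bform Z W\<bar> \<le> sqrt (sqn M (weight Z)) * sqrt (sqn M W)"
      unfolding bform_eq_inner by (rule L2_Cauchy_Schwarz[OF L2_weightI[OF that(1)] that(2)])
    also have "\<dots> \<le> sqrt (C * sqn M Z) * sqrt (sqn M W)"
      using C(2)[OF that(1)] by (intro mult_right_mono) auto
    finally show ?thesis by (simp add: real_sqrt_mult)
  qed
  then show ?thesis using that[of "sqrt C"] C(1) by simp
qed

lemma bform_diff_left:
  assumes "L2 M Z" "L2 M Z'" "L2 M W"
  shows "bform (\<lambda>x. Z x - Z' x) W = bform Z W - bform Z' W"
proof -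
  have eq: "weight (\<lambda>x. Z x - Z' x) x = weight Z x - weight Z' x" for x
    by (simp add: weight_def algebra_simps)
  show ?thesis unfolding bform_eq_inner eq inner_diff_left
    by (intro Bochner_Integration.integral_diff L2_integrable_inner L2_weightI assms)
qed

abbreviation "w \<equiv> \<lambda>y. sqrt (a y)"

lemma w_C2: "Ck_on 2 \<Omega> w"
  by (rule Ck_on_sqrt[OF open_dom a_C2 a_pos_dom])

lemma w_pderiv_C1: "Ck_on 1 \<Omega> (pderiv_dir w v)"
  using w_C2 by (simp add: numeral_2_eq_2)

lemma w_differentiable: "x \<in> \<Omega> \<Longrightarrow> w differentiable (at x)"
  using Ck_on_differentiable[OF open_dom, of 1 w x] w_C2 by (simp add: numeral_2_eq_2)

lemma a_C1: "Ck_on 1 \<Omega> a" and w_C1: "Ck_on 1 \<Omega> w"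
  using Ck_on_le[OF a_C2, of 1] Ck_on_le[OF w_C2, of 1] by auto

lemma pderiv_dir_a: "x \<in> \<Omega> \<Longrightarrow> pderiv_dir a v x = 2 * w x * pderiv_dir w v x"
proof -
  assume x: "x \<in> \<Omega>"
  have "pderiv_dir a v x = pderiv_dir (\<lambda>y. w y * w y) v x"
    by (rule pderiv_dir_cong[OF open_dom x]) (use a_pos_dom in \<open>simp add: less_imp_le\<close>)
  then show ?thesis using pderiv_dir_mult[OF w_differentiable[OF x] w_differentiable[OF x]] by simp
qed

text \<open>The substitution \<open>v = \<surd>a \<psi>\<close> turns the weighted energy into \<open>\<integral> |\<nabla>v|\<^sup>2 + (\<Delta>\<surd>a/\<surd>a + m) v\<^sup>2\<close>.\<close>

lemma bform_ge_grad:
  assumes "test_fun \<Omega> \<psi>"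
  shows "integral\<^sup>L M (\<lambda>x. \<Sum>i\<in>Basis. (w x * pderiv_dir \<psi> i x + \<psi> x * pderiv_dir w i x)\<^sup>2)
    \<le> bform (test_pair \<psi>) (test_pair \<psi>)"
proof -
  obtain C where C: "compact C" "C \<subseteq> \<Omega>" "\<And>x. x \<notin> C \<Longrightarrow> \<psi> x = 0" "\<And>x v. x \<notin> C \<Longrightarrow> pderiv_dir \<psi> v x = 0"
    by (rule test_pair_supportE[OF assms]) auto
  note int = integrable_compact_support[OF open_dom C(1,2)]
  note cont = Ck_on_continuous[OF w_C1] Ck_on_continuous[OF w_pderiv_C1] Ck_on_continuous[OF a_C1]
    test_fun_continuous[OF assms] test_fun_continuous[OF test_fun_pderiv_dir[OF assms]]
  have cont2: "continuous_on \<Omega> (pderiv_dir (pderiv_dir w i) v)" for i v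
    using w_pderiv_C1 by simp
  \<comment> \<open>\<open>F i\<close> is half of \<partial>_i a. The integral of \<partial>_i (F i
    \<psi>^2) vanishes, which is \<open>key\<close>. Subtracting this null term from the integral of
    |grad (w \<psi>)|^2 cancels the mixed terms and leaves a |grad \<psi>|^2 - w \<psi>^2
    \<Delta>w.\<close>
  define F where "F i x = w x * pderiv_dir w i x" for i x
  have F1: "Ck_on 1 \<Omega> (F i)" for i
    unfolding F_def by (intro Ck_on_mult open_dom w_C1 w_pderiv_C1)
  have dF: "pderiv_dir (F i) i x = w x * pderiv_dir (pderiv_dir w i) i x + (pderiv_dir w i x)\<^sup>2" if "x \<in> \<Omega>" for i x
    unfolding F_def power2_eq_square
    by (rule pderiv_dir_mult[OF w_differentiable[OF that] Ck_on_differentiable[OF open_dom _ that]])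
      (use w_pderiv_C1 in \<open>simp only: One_nat_def\<close>)
  have d\<psi>: "pderiv_dir (\<lambda>x. \<psi> x * \<psi> x) i x = 2 * \<psi> x * pderiv_dir \<psi> i x" for i x
    using pderiv_dir_mult[OF test_fun_differentiable[OF assms] test_fun_differentiable[OF assms]] by simp
  have key: "integral\<^sup>L M (\<lambda>x. (w x * pderiv_dir (pderiv_dir w i) i x + (pderiv_dir w i x)\<^sup>2) * (\<psi> x * \<psi> x)
      + F i x * (2 * \<psi> x * pderiv_dir \<psi> i x)) = 0" for i
  proof -
    have "integral\<^sup>L M (\<lambda>x. pderiv_dir (F i) i x * (\<psi> x * \<psi> x)) = - integral\<^sup>L M (\<lambda>x. F i x * (2 * \<psi> x * pderiv_dir \<psi> i x))"
      using integral_by_parts(3)[OF open_dom F1 test_fun_mult[OF assms assms], of i i] by (simp add: d\<psi>)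
    moreover have "integral\<^sup>L M (\<lambda>x. pderiv_dir (F i) i x * (\<psi> x * \<psi> x))
      = integral\<^sup>L M (\<lambda>x. (w x * pderiv_dir (pderiv_dir w i) i x + (pderiv_dir w i x)\<^sup>2) * (\<psi> x * \<psi> x))"
      by (intro Bochner_Integration.integral_cong) (auto simp: dF)
    moreover have "integrable M (\<lambda>x. F i x * (2 * \<psi> x * pderiv_dir \<psi> i x))"
      by (rule int) (use C in \<open>auto simp: F_def intro!: continuous_intros cont\<close>)
    moreover have "integrable M (\<lambda>x. (w x * pderiv_dir (pderiv_dir w i) i x + (pderiv_dir w i x)\<^sup>2) * (\<psi> x * \<psi> x))"
      by (rule int) (use C in \<open>auto intro!: continuous_intros cont cont2\<close>)
    ultimately show ?thesis by simp
  qed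
  have i1: "integrable M (\<lambda>x. (w x * pderiv_dir (pderiv_dir w i) i x + (pderiv_dir w i x)\<^sup>2) * (\<psi> x * \<psi> x)
      + F i x * (2 * \<psi> x * pderiv_dir \<psi> i x))" for i
    by (rule int) (use C in \<open>auto simp: F_def intro!: continuous_intros cont cont2\<close>)
  have i2: "integrable M (\<lambda>x. \<Sum>i\<in>Basis. (w x * pderiv_dir \<psi> i x + \<psi> x * pderiv_dir w i x)\<^sup>2)"
    by (rule int) (use C in \<open>auto intro!: continuous_intros cont\<close>)
  have i3: "integrable M (\<lambda>x. a x * (grad \<psi> x \<bullet> grad \<psi> x) + a x * (m * \<psi> x * \<psi> x))"
    by (rule int) (use C in \<open>auto simp: grad_def intro!: continuous_intros cont\<close>)
  have "integral\<^sup>L M (\<lambda>x. \<Sum>i\<in>Basis. (w x * pderiv_dir \<psi> i x + \<psi> x * pderiv_dir w i x)\<^sup>2)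
     = integral\<^sup>L M (\<lambda>x. (\<Sum>i\<in>Basis. (w x * pderiv_dir \<psi> i x + \<psi> x * pderiv_dir w i x)\<^sup>2)
       - (\<Sum>i\<in>Basis. (w x * pderiv_dir (pderiv_dir w i) i x + (pderiv_dir w i x)\<^sup>2) * (\<psi> x * \<psi> x)
      + F i x * (2 * \<psi> x * pderiv_dir \<psi> i x)))"
    using i1 i2 key by (simp add: Bochner_Integration.integral_sum Bochner_Integration.integrable_sum)
  also have "\<dots> \<le> integral\<^sup>L M (\<lambda>x. a x * (grad \<psi> x \<bullet> grad \<psi> x) + a x * (m * \<psi> x * \<psi> x))"
  proof (intro integral_mono i3 Bochner_Integration.integrable_diff i2 Bochner_Integration.integrable_sum i1)
    fix x assume "x \<in> space M"
    then have x: "x \<in> \<Omega>" by simp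
    have w2: "w x * w x = a x" using a_pos_dom[OF x] by simp
    have wp: "w x > 0" using a_pos_dom[OF x] by simp
    have "(\<Sum>i\<in>Basis. (w x * pderiv_dir \<psi> i x + \<psi> x * pderiv_dir w i x)\<^sup>2)
       - (\<Sum>i\<in>Basis. (w x * pderiv_dir (pderiv_dir w i) i x + (pderiv_dir w i x)\<^sup>2) * (\<psi> x * \<psi> x)
          + F i x * (2 * \<psi> x * pderiv_dir \<psi> i x))
      = (\<Sum>i\<in>Basis. a x * (pderiv_dir \<psi> i x)\<^sup>2 - w x * (\<psi> x * \<psi> x) * pderiv_dir (pderiv_dir w i) i x)"
      unfolding sum_subtractf[symmetric]
    proof (intro sum.cong refl)
      fix i :: 'a
      have "(w x * pderiv_dir \<psi> i x + \<psi> x * pderiv_dir w i x)\<^sup>2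
          - ((w x * pderiv_dir (pderiv_dir w i) i x + (pderiv_dir w i x)\<^sup>2) * (\<psi> x * \<psi> x) + F i x * (2 * \<psi> x * pderiv_dir \<psi> i x))
        = w x * w x * (pderiv_dir \<psi> i x)\<^sup>2 - w x * (\<psi> x * \<psi> x) * pderiv_dir (pderiv_dir w i) i x"
        unfolding F_def power2_eq_square by algebra
      then show "(w x * pderiv_dir \<psi> i x + \<psi> x * pderiv_dir w i x)\<^sup>2
          - ((w x * pderiv_dir (pderiv_dir w i) i x + (pderiv_dir w i x)\<^sup>2) * (\<psi> x * \<psi> x) + F i x * (2 * \<psi> x * pderiv_dir \<psi> i x))
        = a x * (pderiv_dir \<psi> i x)\<^sup>2 - w x * (\<psi> x * \<psi> x) * pderiv_dir (pderiv_dir w i) i x"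
        unfolding w2 .
    qed
    also have "\<dots> = a x * (grad \<psi> x \<bullet> grad \<psi> x) - w x * (\<psi> x * \<psi> x) * laplacian w x"
      by (simp add: sum_subtractf sum_distrib_left laplacian_def norm_grad flip: power2_norm_eq_inner)
    also have "\<dots> \<le> a x * (grad \<psi> x \<bullet> grad \<psi> x) + a x * (m * \<psi> x * \<psi> x)"
    proof -
      \<comment> \<open>Here \<open>lap\<close> enters. Multiplied by the nonnegative w \<psi>^2, it
        bounds - w \<psi>^2 \<Delta>w by m w^2 \<psi>^2 = m a \<psi>^2.\<close>
      have "- m * w x \<le> laplacian w x"
        using lap x pos_le_divide_eq[OF wp, of "- m" "laplacian w x"] by blast
      then have "w x * (\<psi> x * \<psi> x) * (- m * w x) \<le> w x * (\<psi> x * \<psi> x) * laplacian w x"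
        using wp by (intro mult_left_mono) auto
      also have "w x * (\<psi> x * \<psi> x) * (- m * w x) = (w x * w x) * (- (m * \<psi> x * \<psi> x))" by algebra
      finally show ?thesis unfolding w2 by simp
    qed
    finally show "(\<Sum>i\<in>Basis. (w x * pderiv_dir \<psi> i x + \<psi> x * pderiv_dir w i x)\<^sup>2)
       - (\<Sum>i\<in>Basis. (w x * pderiv_dir (pderiv_dir w i) i x + (pderiv_dir w i x)\<^sup>2) * (\<psi> x * \<psi> x)
          + F i x * (2 * \<psi> x * pderiv_dir \<psi> i x)) \<le> a x * (grad \<psi> x \<bullet> grad \<psi> x) + a x * (m * \<psi> x * \<psi> x)" .
  qed
  finally show ?thesis by (simp add: bform_def)
qed

text \<open>Poincare's inequality for \<open>\<surd>a \<psi>\<close>: integrate \<open>a \<psi>\<^sup>2 = a \<psi>\<^sup>2 \<partial>\<^sub>e(x \<bullet> e)\<close> by parts.\<close>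

lemma bform_Poincare:
  obtains P where "0 < P" "\<And>\<psi>. test_fun \<Omega> \<psi> \<Longrightarrow>
    integral\<^sup>L M (\<lambda>x. a x * (\<psi> x * \<psi> x)) \<le> P * bform (test_pair \<psi>) (test_pair \<psi>)"
proof -
  obtain R where R: "0 < R" "\<And>x. x \<in> \<Omega> \<Longrightarrow> norm x \<le> R" using bounded_dom bounded_pos by metis
  obtain e :: 'a where e: "e \<in> Basis" using nonempty_Basis by blast
  have "integral\<^sup>L M (\<lambda>x. a x * (\<psi> x * \<psi> x)) \<le> (4 * R\<^sup>2) * bform (test_pair \<psi>) (test_pair \<psi>)"
    if T: "test_fun \<Omega> \<psi>" for \<psi>
  proof -
    obtain C where C: "compact C" "C \<subseteq> \<Omega>" "\<And>x. x \<notin> C \<Longrightarrow> \<psi> x = 0" "\<And>x v. x \<notin> C \<Longrightarrow> pderiv_dir \<psi> v x = 0"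
      by (rule test_pair_supportE[OF T]) auto
    note int = integrable_compact_support[OF open_dom C(1,2)]
    note cont = Ck_on_continuous[OF w_C1] Ck_on_continuous[OF w_pderiv_C1] Ck_on_continuous[OF a_C1]
      test_fun_continuous[OF T] test_fun_continuous[OF test_fun_pderiv_dir[OF T]]
    \<comment> \<open>\<open>D i\<close> is the \<open>i\<close>-th partial derivative of w \<psi>,
      the function to which Poincare's inequality is applied.\<close>
    define D where "D i x = w x * pderiv_dir \<psi> i x + \<psi> x * pderiv_dir w i x" for i x
    \<comment> \<open>The derivative of \<open>F\<close> along \<open>e\<close> is a plus a term
      with the derivative of w. After integration by parts that term combines with the one
      containing the derivative of \<psi> into -2 (x \<bullet> e) (w \<psi>) D_e.\<close>
    define F where "F x = a x * (x \<bullet> e)" for x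
    have F1: "Ck_on 1 \<Omega> F" unfolding F_def by (intro Ck_on_mult open_dom a_C1 Ck_on_inner)
    have dF: "pderiv_dir F e x = a x + 2 * w x * pderiv_dir w e x * (x \<bullet> e)" if "x \<in> \<Omega>" for x
    proof -
      have "a differentiable (at x)" using Ck_on_differentiable[OF open_dom, of 0 a x] a_C1 that by simp
      moreover have "(\<lambda>x. x \<bullet> e) differentiable (at x)"
        using Ck_on_differentiable[OF open_UNIV Ck_on_inner[of "Suc 0"]] by blast
      ultimately show ?thesis unfolding F_def
        using that e by (simp add: pderiv_dir_mult pderiv_dir_inner pderiv_dir_a)
    qed
    have d\<psi>: "pderiv_dir (\<lambda>x. \<psi> x * \<psi> x) e x = 2 * \<psi> x * pderiv_dir \<psi> e x" for x
      using pderiv_dir_mult[OF test_fun_differentiable[OF T] test_fun_differentiable[OF T]] by simp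
    have i0: "integrable M (\<lambda>x. a x * (\<psi> x * \<psi> x))"
      by (rule int) (use C in \<open>auto intro!: continuous_intros cont\<close>)
    have i1: "integrable M (\<lambda>x. -2 * (x \<bullet> e) * (w x * \<psi> x) * D e x)"
      by (rule int) (use C in \<open>auto simp: D_def intro!: continuous_intros cont\<close>)
    have i2: "integrable M (\<lambda>x. \<Sum>i\<in>Basis. (D i x)\<^sup>2)"
      by (rule int) (use C in \<open>auto simp: D_def intro!: continuous_intros cont\<close>)
    have i3: "integrable M (\<lambda>x. (2 * w x * pderiv_dir w e x * (x \<bullet> e)) * (\<psi> x * \<psi> x))"
      by (rule int) (use C in \<open>auto intro!: continuous_intros cont\<close>)
    have i4: "integrable M (\<lambda>x. F x * (2 * \<psi> x * pderiv_dir \<psi> e x))"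
      by (rule int) (use C in \<open>auto simp: F_def intro!: continuous_intros cont\<close>)
    have "integral\<^sup>L M (\<lambda>x. pderiv_dir F e x * (\<psi> x * \<psi> x)) = - integral\<^sup>L M (\<lambda>x. F x * (2 * \<psi> x * pderiv_dir \<psi> e x))"
      using integral_by_parts(3)[OF open_dom F1 test_fun_mult[OF T T], of e] by (simp add: d\<psi>)
    moreover have "integral\<^sup>L M (\<lambda>x. pderiv_dir F e x * (\<psi> x * \<psi> x))
      = integral\<^sup>L M (\<lambda>x. a x * (\<psi> x * \<psi> x) + (2 * w x * pderiv_dir w e x * (x \<bullet> e)) * (\<psi> x * \<psi> x))"
      by (intro Bochner_Integration.integral_cong) (auto simp: dF algebra_simps)
    ultimately have "integral\<^sup>L M (\<lambda>x. a x * (\<psi> x * \<psi> x))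
      = integral\<^sup>L M (\<lambda>x. - (F x * (2 * \<psi> x * pderiv_dir \<psi> e x)) - (2 * w x * pderiv_dir w e x * (x \<bullet> e)) * (\<psi> x * \<psi> x))"
      using i0 i3 i4 by simp
    also have "\<dots> = integral\<^sup>L M (\<lambda>x. -2 * (x \<bullet> e) * (w x * \<psi> x) * D e x)"
    proof (intro Bochner_Integration.integral_cong refl)
      fix x assume "x \<in> space M"
      then have w2: "w x * w x = a x" using a_pos_dom[of x] by simp
      have "-2 * (x \<bullet> e) * (w x * \<psi> x) * D e x
        = - ((w x * w x) * (x \<bullet> e) * (2 * \<psi> x * pderiv_dir \<psi> e x)) - (2 * w x * pderiv_dir w e x * (x \<bullet> e)) * (\<psi> x * \<psi> x)"
        unfolding D_def by algebra
      then show "- (F x * (2 * \<psi> x * pderiv_dir \<psi> e x)) - (2 * w x * pderiv_dir w e x * (x \<bullet> e)) * (\<psi> x * \<psi> x)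
        = -2 * (x \<bullet> e) * (w x * \<psi> x) * D e x"
        unfolding F_def w2 by simp
    qed
    also have "\<dots> \<le> integral\<^sup>L M (\<lambda>x. 1/2 * (a x * (\<psi> x * \<psi> x)) + 2 * R\<^sup>2 * (\<Sum>i\<in>Basis. (D i x)\<^sup>2))"
    proof (intro integral_mono i1 Bochner_Integration.integrable_add integrable_mult_right i0 i2)
      fix x assume "x \<in> space M"
      then have x: "x \<in> \<Omega>" by simp
      define s t where "s = w x * \<psi> x" and "t = (x \<bullet> e) * D e x"
      \<comment> \<open>Young's inequality, weighted so that the term in s^2 = a \<psi>^2 has
        coefficient 1/2 and can be absorbed on the left. Doubling the remaining 2 R^2 gives the
        constant 4 R^2.\<close>
      have "0 \<le> (s + 2 * t)\<^sup>2" by simp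
      then have "-2 * s * t \<le> 1/2 * s\<^sup>2 + 2 * t\<^sup>2" by (simp add: power2_eq_square algebra_simps)
      moreover have "t\<^sup>2 \<le> R\<^sup>2 * (\<Sum>i\<in>Basis. (D i x)\<^sup>2)"
      proof -
        have "\<bar>x \<bullet> e\<bar> \<le> R" using Basis_le_norm[OF e, of x] R(2)[OF x] by linarith
        then have "(x \<bullet> e)\<^sup>2 \<le> R\<^sup>2" using power_mono[of "\<bar>x \<bullet> e\<bar>" R 2] by simp
        moreover have "(D e x)\<^sup>2 \<le> (\<Sum>i\<in>Basis. (D i x)\<^sup>2)" by (rule member_le_sum[OF e]) auto
        ultimately show ?thesis unfolding t_def power_mult_distrib by (intro mult_mono) auto
      qed
      moreover have "s\<^sup>2 = a x * (\<psi> x * \<psi> x)" unfolding s_def power_mult_distrib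
        using a_pos_dom[OF x] by (simp add: power2_eq_square)
      ultimately show "-2 * (x \<bullet> e) * (w x * \<psi> x) * D e x \<le> 1/2 * (a x * (\<psi> x * \<psi> x)) + 2 * R\<^sup>2 * (\<Sum>i\<in>Basis. (D i x)\<^sup>2)"
        unfolding s_def t_def by (simp add: mult.assoc mult.left_commute)
    qed
    also have "\<dots> = 1/2 * integral\<^sup>L M (\<lambda>x. a x * (\<psi> x * \<psi> x)) + 2 * R\<^sup>2 * integral\<^sup>L M (\<lambda>x. \<Sum>i\<in>Basis. (D i x)\<^sup>2)"
      using i0 i2 by simp
    finally have "integral\<^sup>L M (\<lambda>x. a x * (\<psi> x * \<psi> x)) \<le> 4 * R\<^sup>2 * integral\<^sup>L M (\<lambda>x. \<Sum>i\<in>Basis. (D i x)\<^sup>2)"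
      by simp
    also have "\<dots> \<le> 4 * R\<^sup>2 * bform (test_pair \<psi>) (test_pair \<psi>)"
      using bform_ge_grad[OF T] unfolding D_def by (intro mult_left_mono) auto
    finally show ?thesis .
  qed
  then show ?thesis using that[of "4 * R\<^sup>2"] R(1) by simp
qed

text \<open>Poincare's inequality lets the form control the integral I of a \<psi>^2. The full
  weighted H^1 norm is the form plus (1 - m) I, hence at most 1 + (1 + |m|) P times the form,
  whatever the sign of m; the lower bound of \<open>a\<close> removes the weight.\<close>

lemma bform_coercive:
  obtains c where "0 < c" "\<And>\<psi>. test_fun \<Omega> \<psi> \<Longrightarrow> c * sqn M (test_pair \<psi>) \<le> bform (test_pair \<psi>) (test_pair \<psi>)"
proof -
  obtain P where P: "0 < P" "\<And>\<psi>. test_fun \<Omega> \<psi> \<Longrightarrow>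
    integral\<^sup>L M (\<lambda>x. a x * (\<psi> x * \<psi> x)) \<le> P * bform (test_pair \<psi>) (test_pair \<psi>)" using bform_Poincare by blast
  obtain \<alpha> A where A: "0 < \<alpha>" "\<And>x. x \<in> \<Omega> \<Longrightarrow> \<alpha> \<le> a x" "\<And>x. x \<in> \<Omega> \<Longrightarrow> a x \<le> A" using a_bounds by blast
  define K where "K = 1 + (1 + \<bar>m\<bar>) * P"
  have K: "0 < K" using P(1) by (auto simp: K_def intro!: add_pos_nonneg)
  have "\<alpha> * sqn M (test_pair \<psi>) \<le> K * bform (test_pair \<psi>) (test_pair \<psi>)" if t: "test_fun \<Omega> \<psi>" for \<psi>
  proof -
    let ?B = "bform (test_pair \<psi>) (test_pair \<psi>)"
    define I where "I = integral\<^sup>L M (\<lambda>x. a x * (\<psi> x * \<psi> x))"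
    have i1: "integrable M (\<lambda>x. a x * (\<psi> x * \<psi> x))"
      using L2_integrable_mult[OF L2_a_mult_real[OF L2_test[OF t]] L2_test[OF t]] by (simp add: mult.assoc)
    have i2: "integrable M (\<lambda>x. a x * (grad \<psi> x \<bullet> grad \<psi> x))"
      using L2_integrable_inner[OF L2_a_mult[OF L2_grad[OF t]] L2_grad[OF t]] by simp
    have B: "?B = integral\<^sup>L M (\<lambda>x. a x * (grad \<psi> x \<bullet> grad \<psi> x)) + m * I"
    proof -
      have "?B = integral\<^sup>L M (\<lambda>x. a x * (grad \<psi> x \<bullet> grad \<psi> x) + m * (a x * (\<psi> x * \<psi> x)))"
        unfolding bform_def by (intro Bochner_Integration.integral_cong) auto
      then show ?thesis using i1 i2 by (simp add: I_def)
    qed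
    have "0 \<le> I" unfolding I_def
      by (intro integral_nonneg_AE AE_I2) (simp add: less_imp_le[OF a_pos_dom])
    have "\<alpha> * sqn M (test_pair \<psi>) \<le> integral\<^sup>L M (\<lambda>x. a x * (grad \<psi> x \<bullet> grad \<psi> x) + a x * (\<psi> x * \<psi> x))"
      unfolding sqn_def integral_mult_right_zero[symmetric]
    proof (intro integral_mono integrable_mult_right L2_integrable L2_test_pair t Bochner_Integration.integrable_add i1 i2)
      fix x assume "x \<in> space M"
      then have "\<alpha> * (norm (test_pair \<psi> x))\<^sup>2 \<le> a x * (norm (test_pair \<psi> x))\<^sup>2"
        using A(2) by (intro mult_right_mono) auto
      then show "\<alpha> * (norm (test_pair \<psi> x))\<^sup>2 \<le> a x * (grad \<psi> x \<bullet> grad \<psi> x) + a x * (\<psi> x * \<psi> x)"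
        by (simp add: power2_norm_eq_inner inner_prod_def test_pair_def algebra_simps)
    qed
    also have "\<dots> = ?B - m * I + I" using i1 i2 by (simp add: B I_def)
    also have "\<dots> \<le> ?B + (1 + \<bar>m\<bar>) * I"
    proof -
      have "- m * I \<le> \<bar>m\<bar> * I" using \<open>0 \<le> I\<close> by (intro mult_right_mono) auto
      then show ?thesis by (simp add: algebra_simps)
    qed
    also have "\<dots> \<le> ?B + (1 + \<bar>m\<bar>) * (P * ?B)"
      using P(2)[OF t] by (intro add_left_mono mult_left_mono) (auto simp: I_def)
    also have "\<dots> = K * ?B" by (simp add: K_def algebra_simps)
    finally show ?thesis .
  qed
  then have "\<alpha> / K * sqn M (test_pair \<psi>) \<le> bform (test_pair \<psi>) (test_pair \<psi>)" if "test_fun \<Omega> \<psi>" for \<psi>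
    using that K by (simp add: field_simps)
  then show ?thesis using that[of "\<alpha> / K"] A(1) K by simp
qed

lemma bform_coercive_H10:
  obtains c where "0 < c" "\<And>Z. H10_pair Z \<Longrightarrow> c * sqn M Z \<le> bform Z Z"
proof -
  obtain c where c: "0 < c" "\<And>\<psi>. test_fun \<Omega> \<psi> \<Longrightarrow> c * sqn M (test_pair \<psi>) \<le> bform (test_pair \<psi>) (test_pair \<psi>)"
    using bform_coercive by blast
  have "c * sqn M Z \<le> bform Z Z" if "H10_pair Z" for Z
  proof -
    obtain \<xi> where Z: "L2 M Z" and \<xi>: "\<And>k::nat. test_fun \<Omega> (\<xi> k)" "(\<lambda>k. sqn M (\<lambda>x. test_pair (\<xi> k) x - Z x)) \<longlonglongrightarrow> 0"
      using \<open>H10_pair Z\<close> unfolding H10_pair_def by blast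
    note conv = L2_test_pair[OF \<xi>(1)] Z \<xi>(2)
    show ?thesis
    proof (rule LIMSEQ_le)
      show "(\<lambda>k. c * sqn M (test_pair (\<xi> k))) \<longlonglongrightarrow> c * sqn M Z"
        by (intro tendsto_mult_left L2_tendsto_sqn conv)
      show "(\<lambda>k. bform (test_pair (\<xi> k)) (test_pair (\<xi> k))) \<longlonglongrightarrow> bform Z Z"
        by (rule bform_tendsto[OF conv conv])
    qed (use c(2)[OF \<xi>(1)] in auto)
  qed
  then show ?thesis using that c(1) by blast
qed

end

section \<open>Weak limits\<close>

context weighted_domain
begin

text \<open>Here \<open>q\<close> is m a \<xi> - div (a grad \<xi>), a continuous function of
  compact support because \<open>a\<close> is C1 and \<xi> is smooth. Against \<psi> the form then
  sees values only, no gradient.\<close>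

lemma bform_test_pair_eq:
  assumes "test_fun \<Omega> \<xi>"
  obtains q where "L2 M q" "\<And>\<psi>. test_fun \<Omega> \<psi> \<Longrightarrow> bform (test_pair \<xi>) (test_pair \<psi>) = integral\<^sup>L M (\<lambda>x. \<psi> x \<bullet> q x)"
proof -
  obtain C where C: "compact C" "C \<subseteq> \<Omega>" "\<And>x. x \<notin> C \<Longrightarrow> \<xi> x = 0" "\<And>x v. x \<notin> C \<Longrightarrow> pderiv_dir \<xi> v x = 0"
    using test_pair_supportE[OF assms] by metis
  define F where "F i x = a x * pderiv_dir \<xi> i x" for i x
  have F1: "Ck_on 1 \<Omega> (F i)" for i
    unfolding F_def
    by (intro Ck_on_mult open_dom a_C1 Ck_on_subset[OF smooth_onD[OF smooth_on_pderiv_dir[OF test_fun_smooth[OF assms]]]]) simp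
  have F0: "pderiv_dir (F i) v x = 0" if "x \<notin> C" for i v x
  proof -
    have "pderiv_dir (F i) v x = pderiv_dir (\<lambda>_. 0) v x"
      by (rule pderiv_dir_cong[of "- C"]) (use that C compact_imp_closed[OF C(1)] in \<open>auto simp: F_def\<close>)
    then show ?thesis by simp
  qed
  define q where "q x = m * (a x * \<xi> x) - (\<Sum>i\<in>Basis. pderiv_dir (F i) i x)" for x
  have "L2 M q"
  proof (rule L2_compact_support[OF C(1,2)])
    show "continuous_on \<Omega> q" unfolding q_def using F1
      by (intro continuous_intros Ck_on_continuous[OF a_C1] test_fun_continuous[OF assms]) auto
  qed (use C(3) F0 in \<open>auto simp: q_def\<close>)
  moreover have "bform (test_pair \<xi>) (test_pair \<psi>) = integral\<^sup>L M (\<lambda>x. \<psi> x \<bullet> q x)" if \<psi>: "test_fun \<Omega> \<psi>" for \<psi>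
  proof -
    have i1: "integrable M (\<lambda>x. F i x * pderiv_dir \<psi> i x)" and i2: "integrable M (\<lambda>x. pderiv_dir (F i) i x * \<psi> x)"
      and p: "integral\<^sup>L M (\<lambda>x. F i x * pderiv_dir \<psi> i x) = - integral\<^sup>L M (\<lambda>x. pderiv_dir (F i) i x * \<psi> x)" for i
      using integral_by_parts[OF open_dom F1 \<psi>, of i i] by auto
    have i3: "integrable M (\<lambda>x. m * (a x * \<xi> x) * \<psi> x)"
      using L2_integrable_mult[OF L2_a_mult_real[OF L2_test[OF assms]] L2_test[OF \<psi>]] by (simp add: mult.assoc)
    have g: "grad \<xi> x \<bullet> grad \<psi> x = (\<Sum>i\<in>Basis. pderiv_dir \<xi> i x * pderiv_dir \<psi> i x)" for x
      unfolding grad_inner[of \<xi>] by (simp add: grad_inner_Basis)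
    have "bform (test_pair \<xi>) (test_pair \<psi>)
      = integral\<^sup>L M (\<lambda>x. (\<Sum>i\<in>Basis. F i x * pderiv_dir \<psi> i x) + m * (a x * \<xi> x) * \<psi> x)"
      unfolding bform_def
      by (intro Bochner_Integration.integral_cong) (auto simp: g F_def sum_distrib_left algebra_simps)
    also have "\<dots> = (\<Sum>i\<in>Basis. - integral\<^sup>L M (\<lambda>x. pderiv_dir (F i) i x * \<psi> x)) + integral\<^sup>L M (\<lambda>x. m * (a x * \<xi> x) * \<psi> x)"
      using i1 i3 by (simp add: p[symmetric])
    also have "\<dots> = integral\<^sup>L M (\<lambda>x. m * (a x * \<xi> x) * \<psi> x - (\<Sum>i\<in>Basis. pderiv_dir (F i) i x * \<psi> x))"
      using i2 i3 by (simp add: sum_negf)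
    also have "\<dots> = integral\<^sup>L M (\<lambda>x. \<psi> x \<bullet> q x)"
      by (intro Bochner_Integration.integral_cong) (auto simp: q_def sum_distrib_left algebra_simps)
    finally show ?thesis .
  qed
  ultimately show ?thesis by (rule that)
qed

text \<open>Against a test function all derivatives can be moved away from \<open>v n\<close>, so that convergence in \<open>L\<^sup>2\<close>
  suffices; the general case follows by density.\<close>

lemma bform_weak_limit:
  assumes Z: "H10_pair Z" and w: "\<And>n::nat. test_fun \<Omega> (v n)"
    and lim: "(\<lambda>n. sqn M (\<lambda>x. v n x - fst (Z x))) \<longlonglongrightarrow> 0" and bd: "\<And>n. sqn M (test_pair (v n)) \<le> K"
  shows "(\<lambda>n. bform Z (test_pair (v n))) \<longlonglongrightarrow> bform Z Z"
proof (rule LIMSEQ_I)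
  fix e :: real assume e: "e > 0"
  obtain \<xi> where L: "L2 M Z" and \<xi>: "\<And>k::nat. test_fun \<Omega> (\<xi> k)" "(\<lambda>k. sqn M (\<lambda>x. test_pair (\<xi> k) x - Z x)) \<longlonglongrightarrow> 0"
    using Z unfolding H10_pair_def by blast
  obtain C where C: "0 \<le> C" "\<And>Z W. L2 M Z \<Longrightarrow> L2 M W \<Longrightarrow> \<bar>bform Z W\<bar> \<le> C * sqrt (sqn M Z) * sqrt (sqn M W)"
    by (rule bform_bound) (rule that)
  \<comment> \<open>\<open>b\<close> times the distance of \<open>X\<close> and \<open>Z\<close>
    bounds the total cost of replacing \<open>Z\<close> by \<open>X\<close> in the first argument,
    once against \<open>test_pair (v n)\<close> (factor \<open>sqrt K\<close>) and once against
    \<open>Z\<close> itself.\<close>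
  define b where "b = C * (sqrt K + sqrt (sqn M Z))"
  have "(\<lambda>k. b * sqrt (sqn M (\<lambda>x. test_pair (\<xi> k) x - Z x))) \<longlonglongrightarrow> b * sqrt 0"
    by (intro tendsto_mult_left tendsto_real_sqrt \<xi>)
  then have "\<exists>k. \<bar>b * sqrt (sqn M (\<lambda>x. test_pair (\<xi> k) x - Z x))\<bar> < e / 2"
    using LIMSEQ_D[of _ 0 "e/2"] e by fastforce
  then obtain k where k: "b * sqrt (sqn M (\<lambda>x. test_pair (\<xi> k) x - Z x)) < e / 2" using abs_ge_self le_less_trans by blast
  obtain q where q: "L2 M q"
      "\<And>\<psi>. test_fun \<Omega> \<psi> \<Longrightarrow> bform (test_pair (\<xi> k)) (test_pair \<psi>) = integral\<^sup>L M (\<lambda>x. \<psi> x \<bullet> q x)"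
    by (rule bform_test_pair_eq[OF \<xi>(1)[of k]]) (rule that)
  define X where "X = test_pair (\<xi> k)"
  have X: "L2 M X" unfolding X_def by (rule L2_test_pair[OF \<xi>(1)])
  note q = q[folded X_def]
  \<comment> \<open>The representation by \<open>q\<close> is known for test functions in the second
    argument. By density it extends to \<open>Z\<close>, so that L2 convergence of
    \<open>v n\<close> identifies the limit below as \<open>bform X Z\<close>.\<close>
  have "bform X Z = integral\<^sup>L M (\<lambda>x. fst (Z x) \<bullet> q x)"
  proof (rule LIMSEQ_unique)
    show "(\<lambda>j. bform X (test_pair (\<xi> j))) \<longlonglongrightarrow> bform X Z"
      by (rule bform_tendsto[OF X X _ L2_test_pair[OF \<xi>(1)] L \<xi>(2)]) (simp add: sqn_def)
    have "(\<lambda>j. sqn M (\<lambda>x. \<xi> j x - fst (Z x))) \<longlonglongrightarrow> 0"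
    proof (rule Lim_null_comparison[OF always_eventually \<xi>(2)], rule allI)
      show "norm (sqn M (\<lambda>x. \<xi> j x - fst (Z x))) \<le> sqn M (\<lambda>x. test_pair (\<xi> j) x - Z x)" for j
        using L2_fst(2)[OF L2_diff(1)[OF L2_test_pair[OF \<xi>(1)] L], of j] by simp
    qed
    then show "(\<lambda>j. bform X (test_pair (\<xi> j))) \<longlonglongrightarrow> integral\<^sup>L M (\<lambda>x. fst (Z x) \<bullet> q x)"
      unfolding q(2)[OF \<xi>(1)] by (rule L2_tendsto_inner[OF L2_test[OF \<xi>(1)] L2_fst(1)[OF L] _ q(1)])
  qed
  moreover have "(\<lambda>n. bform X (test_pair (v n))) \<longlonglongrightarrow> integral\<^sup>L M (\<lambda>x. fst (Z x) \<bullet> q x)"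
    unfolding q(2)[OF w] by (rule L2_tendsto_inner[OF L2_test[OF w] L2_fst(1)[OF L] lim q(1)])
  ultimately have "(\<lambda>n. bform X (test_pair (v n))) \<longlonglongrightarrow> bform X Z" by simp
  then obtain N where N: "\<And>n. n \<ge> N \<Longrightarrow> \<bar>bform X (test_pair (v n)) - bform X Z\<bar> < e / 2"
    using LIMSEQ_D[of _ "bform X Z" "e/2"] e by fastforce
  show "\<exists>no. \<forall>n\<ge>no. norm (bform Z (test_pair (v n)) - bform Z Z) < e"
  proof (intro exI allI impI)
    fix n assume "n \<ge> N"
    let ?W = "test_pair (v n)" and ?d = "sqrt (sqn M (\<lambda>x. X x - Z x))"
    have W: "L2 M ?W" by (rule L2_test_pair[OF w])
    have "bform Z ?W - bform Z Z = (bform X ?W - bform X Z) - bform (\<lambda>x. X x - Z x) ?W + bform (\<lambda>x. X x - Z x) Z"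
      by (simp add: bform_diff_left[OF X L W] bform_diff_left[OF X L L])
    moreover have "\<bar>bform (\<lambda>x. X x - Z x) ?W\<bar> \<le> C * ?d * sqrt K"
      using C(2)[OF L2_diff(1)[OF X L] W] mult_left_mono[of "sqrt (sqn M ?W)" "sqrt K" "C * ?d"] bd[of n] C(1) by simp
    moreover have "\<bar>bform (\<lambda>x. X x - Z x) Z\<bar> \<le> C * ?d * sqrt (sqn M Z)"
      by (rule C(2)[OF L2_diff(1)[OF X L] L])
    moreover have "C * ?d * sqrt K + C * ?d * sqrt (sqn M Z) < e / 2"
      using k unfolding b_def X_def by (simp add: algebra_simps)
    ultimately show "norm (bform Z ?W - bform Z Z) < e" using N[OF \<open>n \<ge> N\<close>] unfolding real_norm_def by linarith
  qed
qed

end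

text \<open>A smooth, degree-one substitute for \<open>sgn s * min \<bar>s\<bar> \<bar>r\<bar>\<close>: it has the sign of \<open>s\<close>, it vanishes where
  \<open>r\<close> does, and its gradient is bounded uniformly in \<open>\<epsilon>\<close>.\<close>

definition smin :: "real \<Rightarrow> real \<Rightarrow> real \<Rightarrow> real" where
  "smin \<epsilon> s r = 2 * s * r\<^sup>2 / (\<epsilon>\<^sup>2 + s\<^sup>2 + r\<^sup>2)"

lemma smin_denom_pos: "0 < \<epsilon> \<Longrightarrow> 0 < \<epsilon>\<^sup>2 + s\<^sup>2 + (r::real)\<^sup>2"
  by (simp add: add_pos_nonneg)

lemma abs_smin_le:
  assumes "0 < \<epsilon>" shows "\<bar>smin \<epsilon> s r\<bar> \<le> \<bar>r\<bar>"
proof -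
  let ?D = "\<epsilon>\<^sup>2 + s\<^sup>2 + r\<^sup>2"
  have D: "0 < ?D" by (rule smin_denom_pos[OF assms])
  have "2 * \<bar>s\<bar> * \<bar>r\<bar> \<le> \<bar>s\<bar>\<^sup>2 + \<bar>r\<bar>\<^sup>2" by (rule sum_squares_bound)
  also have "\<dots> \<le> ?D" by simp
  finally have "\<bar>r\<bar> * (2 * \<bar>s\<bar> * \<bar>r\<bar>) \<le> \<bar>r\<bar> * ?D" by (intro mult_left_mono) auto
  moreover have "\<bar>smin \<epsilon> s r\<bar> = \<bar>r\<bar> * (2 * \<bar>s\<bar> * \<bar>r\<bar>) / ?D"
    using D by (simp add: smin_def abs_mult power2_eq_square)
  ultimately show ?thesis using D by (simp add: pos_divide_le_eq)
qed

lemma smin_mult_nonneg: "0 \<le> p * s \<Longrightarrow> 0 \<le> p * smin \<epsilon> s r"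
proof -
  assume "0 \<le> p * s"
  moreover have "p * smin \<epsilon> s r = (p * s) * (2 * r\<^sup>2 / (\<epsilon>\<^sup>2 + s\<^sup>2 + r\<^sup>2))" by (simp add: smin_def)
  ultimately show ?thesis by simp
qed

text \<open>Exactly, smin - r = - r ((s - r)^2 + \<epsilon>^2) / D with D the denominator. Hence
  \<open>smin\<close> follows the common limit when s and r converge to it and \<epsilon> tends to
  0.\<close>

lemma smin_near:
  assumes "0 < \<epsilon>" shows "\<bar>smin \<epsilon> s r - r\<bar> \<le> 2 * \<bar>s - r\<bar> + \<epsilon>"
proof -
  let ?D = "\<epsilon>\<^sup>2 + s\<^sup>2 + r\<^sup>2"
  have D: "0 < ?D" by (rule smin_denom_pos[OF assms])
  have "smin \<epsilon> s r - r = - (r * ((s - r)\<^sup>2 + \<epsilon>\<^sup>2)) / ?D"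
    using D by (simp add: smin_def field_simps power2_eq_square)
  then have "\<bar>smin \<epsilon> s r - r\<bar> = \<bar>r\<bar> * (\<bar>s - r\<bar>\<^sup>2 + \<epsilon>\<^sup>2) / ?D"
    using D by (simp add: abs_mult)
  moreover have "\<bar>r\<bar> * (\<bar>s - r\<bar>\<^sup>2 + \<epsilon>\<^sup>2) \<le> (2 * \<bar>s - r\<bar> + \<epsilon>) * ?D"
  proof -
    have "\<bar>r\<bar> * \<bar>s - r\<bar> \<le> 2 * ?D"
    proof -
      have "\<bar>r\<bar> * \<bar>s - r\<bar> \<le> \<bar>r\<bar> * (\<bar>s\<bar> + \<bar>r\<bar>)" by (intro mult_left_mono abs_triangle_ineq4) auto
      also have "\<dots> = \<bar>s\<bar> * \<bar>r\<bar> + r\<^sup>2" by (simp add: power2_eq_square algebra_simps)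
      also have "\<dots> \<le> 2 * ?D"
      proof -
        have "2 * (\<bar>s\<bar> * \<bar>r\<bar>) \<le> s\<^sup>2 + r\<^sup>2" using sum_squares_bound[of "\<bar>s\<bar>" "\<bar>r\<bar>"] by simp
        with zero_le_power2[of \<epsilon>] zero_le_power2[of s] zero_le_power2[of r] show ?thesis
          unfolding distrib_left by linarith
      qed
      finally show ?thesis .
    qed
    then have 1: "\<bar>s - r\<bar> * (\<bar>r\<bar> * \<bar>s - r\<bar>) \<le> \<bar>s - r\<bar> * (2 * ?D)" by (intro mult_left_mono) auto
    have "0 \<le> \<bar>r\<bar> * \<epsilon>" using assms by simp
    moreover have "2 * (\<bar>r\<bar> * \<epsilon>) \<le> r\<^sup>2 + \<epsilon>\<^sup>2" using sum_squares_bound[of "\<bar>r\<bar>" \<epsilon>] by simp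
    ultimately have "\<bar>r\<bar> * \<epsilon> \<le> ?D" using zero_le_power2[of s] by linarith
    then have 2: "\<epsilon> * (\<bar>r\<bar> * \<epsilon>) \<le> \<epsilon> * ?D" using assms by (intro mult_left_mono) auto
    from 1 2 show ?thesis by (simp add: power2_eq_square algebra_simps)
  qed
  ultimately show ?thesis using D by (simp add: pos_divide_le_eq)
qed

text \<open>The denominator is positive, so smoothness is preserved, and the factor r^2 keeps the
  support inside that of \<open>g\<close>. The gradient bound is free of \<epsilon> because both
  partial derivatives of \<open>smin\<close> are bounded by 2.\<close>

lemma smin_test_fun:
  assumes e: "0 < \<epsilon>" and f: "test_fun \<Omega> f" and g: "test_fun \<Omega> g"
  shows "test_fun \<Omega> (\<lambda>x. smin \<epsilon> (f x) (g x))"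
    and "norm (grad (\<lambda>x. smin \<epsilon> (f x) (g x)) x) \<le> 2 * norm (grad f x) + 2 * norm (grad g x)"
proof -
  note sm = test_fun_smooth[OF f] test_fun_smooth[OF g]
  let ?D = "\<lambda>x. \<epsilon>\<^sup>2 + (f x)\<^sup>2 + (g x)\<^sup>2"
  have "smooth_on UNIV (\<lambda>x. 2 * f x * (g x * g x) * inverse (\<epsilon>\<^sup>2 + f x * f x + g x * g x))"
  proof (intro smooth_on_mult smooth_on_inverse smooth_on_add smooth_on_const sm open_UNIV)
    show "0 < \<epsilon>\<^sup>2 + f x * f x + g x * g x" for x
      using smin_denom_pos[OF e, of "f x" "g x"] by (simp add: power2_eq_square)
  qed
  then have "smooth_on UNIV (\<lambda>x. smin \<epsilon> (f x) (g x))"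
    by (simp add: smin_def power2_eq_square divide_inverse)
  then show "test_fun \<Omega> (\<lambda>x. smin \<epsilon> (f x) (g x))"
    by (rule test_fun_weaken_support[OF g]) (simp add: smin_def)
  \<comment> \<open>\<open>A\<close> and \<open>B\<close> are the partial derivatives of
    \<open>smin\<close> in \<open>s\<close> and in \<open>r\<close>, evaluated at (f x, g
    x).\<close>
  define A where "A = 2 * (g x)\<^sup>2 * (\<epsilon>\<^sup>2 + (g x)\<^sup>2 - (f x)\<^sup>2) / (?D x)\<^sup>2"
  define B where "B = 4 * f x * g x * (\<epsilon>\<^sup>2 + (f x)\<^sup>2) / (?D x)\<^sup>2"
  have D: "0 < ?D x" by (rule smin_denom_pos[OF e])
  have "pderiv_dir (\<lambda>x. smin \<epsilon> (f x) (g x)) v x = A * pderiv_dir f v x + B * pderiv_dir g v x" for v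
  proof (rule pderiv_dir_eqI)
    note df = has_derivative_pderiv_dir[OF test_fun_differentiable[OF f, of x]]
    note dg = has_derivative_pderiv_dir[OF test_fun_differentiable[OF g, of x]]
    have dN: "((\<lambda>x. 2 * f x * (g x)\<^sup>2) has_derivative (\<lambda>v. 2 * pderiv_dir f v x * (g x)\<^sup>2 + 4 * f x * g x * pderiv_dir g v x)) (at x)"
      by (auto intro!: derivative_eq_intros df dg simp: algebra_simps)
    have dD: "(?D has_derivative (\<lambda>v. 2 * f x * pderiv_dir f v x + 2 * g x * pderiv_dir g v x)) (at x)"
      by (auto intro!: derivative_eq_intros df dg simp: algebra_simps)
    have "((\<lambda>x. smin \<epsilon> (f x) (g x)) has_derivative (\<lambda>v. ((2 * pderiv_dir f v x * (g x)\<^sup>2 + 4 * f x * g x * pderiv_dir g v x) * ?D x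
      - 2 * f x * (g x)\<^sup>2 * (2 * f x * pderiv_dir f v x + 2 * g x * pderiv_dir g v x)) / (?D x * ?D x))) (at x)"
      unfolding smin_def by (rule has_derivative_divide'[OF dN dD]) (use D in simp)
    moreover have "((2 * p * (g x)\<^sup>2 + 4 * f x * g x * q) * ?D x - 2 * f x * (g x)\<^sup>2 * (2 * f x * p + 2 * g x * q)) / (?D x * ?D x)
      = A * p + B * q" for p q
      unfolding A_def B_def power2_eq_square[of "?D x"] add_divide_distrib[symmetric] times_divide_eq_left
      by (rule arg_cong[of _ _ "\<lambda>t. t / (?D x * ?D x)"]) algebra
    ultimately show "((\<lambda>x. smin \<epsilon> (f x) (g x)) has_derivative (\<lambda>v. A * pderiv_dir f v x + B * pderiv_dir g v x)) (at x)" by simp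
  qed
  then have "grad (\<lambda>x. smin \<epsilon> (f x) (g x)) x = A *\<^sub>R grad f x + B *\<^sub>R grad g x"
    by (simp add: grad_def scaleR_add_left sum.distrib scaleR_sum_right)
  moreover have "\<bar>A\<bar> \<le> 2"
  proof -
    have "\<bar>2 * (g x)\<^sup>2 * (\<epsilon>\<^sup>2 + (g x)\<^sup>2 - (f x)\<^sup>2)\<bar> = 2 * ((g x)\<^sup>2 * \<bar>\<epsilon>\<^sup>2 + (g x)\<^sup>2 - (f x)\<^sup>2\<bar>)" by (simp add: abs_mult)
    also have "\<dots> \<le> 2 * (?D x * ?D x)"
      by (intro mult_left_mono mult_mono) (auto simp: abs_le_iff)
    finally show ?thesis unfolding A_def abs_divide using D by (simp add: pos_divide_le_eq power2_eq_square)
  qed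
  moreover have "\<bar>B\<bar> \<le> 2"
  proof -
    have "\<bar>4 * f x * g x * (\<epsilon>\<^sup>2 + (f x)\<^sup>2)\<bar> = 2 * ((2 * \<bar>f x\<bar> * \<bar>g x\<bar>) * (\<epsilon>\<^sup>2 + (f x)\<^sup>2))"
      by (simp add: abs_mult)
    also have "\<dots> \<le> 2 * (?D x * ?D x)"
    proof (intro mult_left_mono mult_mono)
      have "2 * \<bar>f x\<bar> * \<bar>g x\<bar> \<le> \<bar>f x\<bar>\<^sup>2 + \<bar>g x\<bar>\<^sup>2" by (rule sum_squares_bound)
      also have "\<dots> \<le> ?D x" by simp
      finally show "2 * \<bar>f x\<bar> * \<bar>g x\<bar> \<le> ?D x" .
    qed auto
    finally show ?thesis unfolding B_def abs_divide using D by (simp add: pos_divide_le_eq power2_eq_square)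
  qed
  ultimately show "norm (grad (\<lambda>x. smin \<epsilon> (f x) (g x)) x) \<le> 2 * norm (grad f x) + 2 * norm (grad g x)"
    by (auto intro!: order_trans[OF norm_triangle_ineq] add_mono mult_right_mono)
qed

lemma smin_tendsto:
  assumes "0 < \<epsilon>" "(s \<longlongrightarrow> s') F" shows "((\<lambda>n. smin \<epsilon> (s n) r) \<longlongrightarrow> smin \<epsilon> s' r) F"
  unfolding smin_def
  by (intro tendsto_intros assms) (use smin_denom_pos[OF assms(1)] in \<open>simp add: less_imp_neq[symmetric]\<close>)

section \<open>Uniqueness\<close>

context weighted_domain
begin

text \<open>In the spirit of Brezis and Browder: the sign of the lower order term survives testing with
  \<open>smin (\<psi> j) (\<psi> n)\<close>, which is a test function, is bounded by \<open>\<bar>\<psi> n\<bar>\<close> as \<open>j\<close> tends to infinity,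
  and converges weakly to the solution itself.\<close>

lemma uniqueness_H10:
  assumes Z: "H10_pair Z" and pm: "p \<in> borel_measurable M"
    and sign: "\<And>x. x \<in> \<Omega> \<Longrightarrow> 0 \<le> p x * fst (Z x)"
    and int: "\<And>\<psi>. test_fun \<Omega> \<psi> \<Longrightarrow> integrable M (\<lambda>x. a x * p x * \<psi> x)"
    and eq: "\<And>\<psi>. test_fun \<Omega> \<psi> \<Longrightarrow> bform Z (test_pair \<psi>) + integral\<^sup>L M (\<lambda>x. a x * p x * \<psi> x) = 0"
  shows "AE x in M. fst (Z x) = 0"
proof -
  obtain \<xi> where L: "L2 M Z" and \<xi>: "\<And>k::nat. test_fun \<Omega> (\<xi> k)" "(\<lambda>k. sqn M (\<lambda>x. test_pair (\<xi> k) x - Z x)) \<longlonglongrightarrow> 0"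
    using Z unfolding H10_pair_def by blast
  note conv = L2_test_pair[OF \<xi>(1)] L \<xi>(2)
  define z where "z x = fst (Z x)" for x
  have zL: "L2 M z" unfolding z_def by (rule L2_fst(1)[OF L])
  have z_le: "sqn M (\<lambda>x. \<xi> k x - z x) \<le> sqn M (\<lambda>x. test_pair (\<xi> k) x - Z x)" for k
    using L2_fst(2)[OF L2_diff(1)[OF L2_test_pair[OF \<xi>(1)] L], of k] by (simp add: z_def)
  have z_lim: "(\<lambda>k. sqn M (\<lambda>x. \<xi> k x - z x)) \<longlonglongrightarrow> 0"
    by (rule Lim_null_comparison[OF always_eventually \<xi>(2)]) (use z_le in auto)
  obtain B where B: "\<And>n. sqn M (test_pair (\<xi> n)) \<le> B" using L2_tendsto_bounded[OF conv] by blast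
  obtain r where r: "strict_mono r" "AE x in M. (\<lambda>k. test_pair (\<xi> (r k)) x) \<longlonglongrightarrow> Z x"
    using L2_AE_subseq[OF conv] by blast
  have rz: "AE x in M. (\<lambda>k. \<xi> (r k) x) \<longlonglongrightarrow> z x"
    using r(2) by eventually_elim (use tendsto_fst in \<open>fastforce simp: z_def\<close>)
  define \<epsilon> where "\<epsilon> n = inverse (real (Suc n))" for n
  have \<epsilon>: "0 < \<epsilon> n" for n by (simp add: \<epsilon>_def)
  have \<epsilon>0: "\<epsilon> \<longlonglongrightarrow> 0" unfolding \<epsilon>_def by (rule LIMSEQ_inverse_real_of_nat)
  \<comment> \<open>The two indices have different tasks: \<open>\<xi> n\<close> caps the size by a
    fixed test function, while \<open>\<xi> j\<close> supplies the sign and converges to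
    \<open>z\<close> first.\<close>
  define v where "v n j x = smin (\<epsilon> n) (\<xi> j x) (\<xi> n x)" for n j x
  have v: "test_fun \<Omega> (v n j)" for n j
    unfolding v_def by (rule smin_test_fun(1)[OF \<epsilon> \<xi>(1) \<xi>(1)])
  \<comment> \<open>For fixed \<open>n\<close>, along the almost everywhere convergent subsequence
    the lower order integral tends to that of a p smin(z, \<xi> n), which is nonnegative because
    \<open>p\<close> has the sign of \<open>z\<close>. Domination by |a p \<xi> n| is available
    because \<open>\<xi> n\<close> is a test function. For large \<open>j\<close> the integral
    exceeds - \<epsilon> n, and \<open>eq\<close> turns this into an upper bound for the
    form.\<close>
  have "\<exists>j\<ge>n. bform Z (test_pair (v n j)) \<le> \<epsilon> n" for n
  proof -
    let ?f = "\<lambda>x. a x * p x * smin (\<epsilon> n) (z x) (\<xi> n x)"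
    have "(\<lambda>k. integral\<^sup>L M (\<lambda>x. a x * p x * v n (r k) x)) \<longlonglongrightarrow> integral\<^sup>L M ?f"
    proof (rule integral_dominated_convergence)
      show "?f \<in> borel_measurable M"
        unfolding smin_def
        by (intro borel_measurable_times borel_measurable_divide borel_measurable_add borel_measurable_power
          borel_measurable_const a_measurable pm L2_measurable[OF zL] L2_measurable[OF L2_test[OF \<xi>(1)]])
      show "integrable M (\<lambda>x. \<bar>a x * p x * \<xi> n x\<bar>)" using int[OF \<xi>(1)] by (rule integrable_abs)
      show "AE x in M. (\<lambda>k. a x * p x * v n (r k) x) \<longlonglongrightarrow> ?f x"
        using rz by eventually_elim (auto simp: v_def intro!: tendsto_mult_left smin_tendsto[OF \<epsilon>])
      show "AE x in M. norm (a x * p x * v n (r k) x) \<le> \<bar>a x * p x * \<xi> n x\<bar>" for k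
        using abs_smin_le[OF \<epsilon>] by (intro AE_I2) (auto simp: v_def abs_mult intro!: mult_left_mono)
    qed (use int[OF v] in auto)
    moreover have "0 \<le> integral\<^sup>L M ?f"
    proof (intro integral_nonneg_AE AE_I2)
      fix x assume "x \<in> space M"
      then have "0 \<le> a x" "0 \<le> p x * smin (\<epsilon> n) (z x) (\<xi> n x)"
        using a_pos_dom[of x] smin_mult_nonneg[OF sign[of x]] by (auto simp: z_def)
      then show "0 \<le> ?f x" by (simp add: mult.assoc)
    qed
    ultimately have "\<forall>\<^sub>F k in sequentially. - \<epsilon> n < integral\<^sup>L M (\<lambda>x. a x * p x * v n (r k) x)"
      using \<epsilon>[of n] by (intro order_tendstoD(1)) auto
    then obtain k where "k \<ge> n" "- \<epsilon> n < integral\<^sup>L M (\<lambda>x. a x * p x * v n (r k) x)"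
      using eventually_conj[OF _ eventually_ge_at_top[of n]] eventually_happens'[OF sequentially_bot] by blast
    moreover have "r k \<ge> k" by (rule seq_suble[OF r(1)])
    ultimately show ?thesis using eq[OF v, of n "r k"] by (intro exI[of _ "r k"]) auto
  qed
  then obtain j where j: "\<And>n. j n \<ge> n" "\<And>n. bform Z (test_pair (v n (j n))) \<le> \<epsilon> n" by metis
  have j_lim: "filterlim j at_top sequentially"
    by (rule filterlim_at_top_mono[OF filterlim_ident]) (use j in auto)
  have "(\<lambda>n. bform Z (test_pair (v n (j n)))) \<longlonglongrightarrow> bform Z Z"
  proof (rule bform_weak_limit[OF Z v])
    fix n
    \<comment> \<open>A pointwise majorant of the test pair, from \<open>abs_smin_le\<close> and the
      gradient bound of \<open>smin\<close>. Squaring a sum of three terms costs the coefficients 4,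
      16 and 8, whence 28.\<close>
    let ?W = "\<lambda>x. (norm (\<xi> n x) + 2 * norm (grad (\<xi> (j n)) x)) + 2 * norm (grad (\<xi> n) x)"
    note L1 = L2_norm(1)[OF L2_test[OF \<xi>(1)[of n]]] and L2' = L2_scaleR[OF L2_norm(1)[OF L2_grad[OF \<xi>(1)]], of 2]
    have le: "sqn M (\<xi> k) \<le> B" "sqn M (grad (\<xi> k)) \<le> B" for k
      using L2_fst(2)[OF L2_test_pair[OF \<xi>(1)], of k] L2_snd(2)[OF L2_test_pair[OF \<xi>(1)], of k] B[of k] by auto
    have W: "L2 M ?W" using L2_add(1)[OF L2_add(1)[OF L1 L2'] L2'] by simp
    have "sqn M ?W \<le> 2 * (2 * sqn M (\<lambda>x. norm (\<xi> n x)) + 2 * sqn M (\<lambda>x. 2 *\<^sub>R norm (grad (\<xi> (j n)) x))) + 2 * sqn M (\<lambda>x. 2 *\<^sub>R norm (grad (\<xi> n) x))"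
      using L2_add(2)[OF L2_add(1)[OF L1 L2'] L2', of "j n" n] L2_add(2)[OF L1 L2', of "j n"] by simp
    also have "\<dots> = 4 * sqn M (\<xi> n) + 16 * sqn M (grad (\<xi> (j n))) + 8 * sqn M (grad (\<xi> n))"
      unfolding sqn_scaleR by (simp only: L2_norm(2)) simp
    also have "\<dots> \<le> 28 * B" using le[of n] le[of "j n"] by simp
    finally have W28: "sqn M ?W \<le> 28 * B" .
    have "AE x in M. norm (test_pair (v n (j n)) x) \<le> norm (?W x)"
    proof (rule AE_I2)
      fix x
      have "norm (test_pair (v n (j n)) x) \<le> norm (v n (j n) x) + norm (grad (v n (j n)) x)"
        unfolding test_pair_def by (rule norm_Pair_le)
      also have "\<dots> \<le> ?W x"
        using abs_smin_le[OF \<epsilon>, of n "\<xi> (j n) x" "\<xi> n x"] smin_test_fun(2)[OF \<epsilon> \<xi>(1) \<xi>(1), of n "j n" n x]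
        unfolding v_def[abs_def] by simp
      finally show "norm (test_pair (v n (j n)) x) \<le> norm (?W x)" by simp
    qed
    from L2_bound(2)[OF W L2_measurable[OF L2_test_pair[OF v]] this] W28
    show "sqn M (test_pair (v n (j n))) \<le> 28 * B" by linarith
  next
    define e where "e k = sqn M (\<lambda>x. \<xi> k x - z x)" for k
    \<comment> \<open>Since \<open>\<xi> n\<close> and \<open>\<xi> (j n)\<close> both approximate
      \<open>z\<close>, \<open>smin_near\<close> bounds the distance of \<open>v n (j n)\<close> to
      \<open>z\<close> by 2 |\<xi> (j n) - z| + 3 |\<xi> n - z| + \<epsilon> n; squaring this sum
      gives 16, 36 and 2.\<close>
    have bound: "norm (sqn M (\<lambda>x. v n (j n) x - z x)) \<le> 16 * e (j n) + 36 * e n + 2 * ((\<epsilon> n)\<^sup>2 * measure lebesgue \<Omega>)" for n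
    proof -
      let ?W = "\<lambda>x. (2 * norm (\<xi> (j n) x - z x) + 3 * norm (\<xi> n x - z x)) + \<epsilon> n"
      note L' = L2_norm(1)[OF L2_diff(1)[OF L2_test[OF \<xi>(1)] zL]]
      note L2' = L2_scaleR[OF L', of 2 "j n"] and L3 = L2_scaleR[OF L', of 3 n]
      have W: "L2 M ?W" using L2_add(1)[OF L2_add(1)[OF L2' L3] L2_const] by simp
      have "sqn M ?W \<le> 2 * (2 * sqn M (\<lambda>x. 2 *\<^sub>R norm (\<xi> (j n) x - z x)) + 2 * sqn M (\<lambda>x. 3 *\<^sub>R norm (\<xi> n x - z x))) + 2 * sqn M (\<lambda>x. \<epsilon> n)"
        using L2_add(2)[OF L2_add(1)[OF L2' L3] L2_const, of "\<epsilon> n"] L2_add(2)[OF L2' L3] by simp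
      also have "\<dots> = 16 * e (j n) + 36 * e n + 2 * ((\<epsilon> n)\<^sup>2 * measure lebesgue \<Omega>)"
        unfolding sqn_scaleR sqn_const by (simp only: L2_norm(2)) (simp add: e_def)
      finally have W': "sqn M ?W \<le> 16 * e (j n) + 36 * e n + 2 * ((\<epsilon> n)\<^sup>2 * measure lebesgue \<Omega>)" .
      have "AE x in M. norm (v n (j n) x - z x) \<le> norm (?W x)"
      proof (rule AE_I2)
        fix x
        show "norm (v n (j n) x - z x) \<le> norm (?W x)"
        proof -
          have "\<bar>\<xi> (j n) x - \<xi> n x\<bar> \<le> \<bar>\<xi> (j n) x - z x\<bar> + \<bar>\<xi> n x - z x\<bar>" by linarith
          moreover have "\<bar>v n (j n) x - z x\<bar> \<le> \<bar>v n (j n) x - \<xi> n x\<bar> + \<bar>\<xi> n x - z x\<bar>" by linarith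
          ultimately show ?thesis
            using smin_near[OF \<epsilon>, of n "\<xi> (j n) x" "\<xi> n x"] \<epsilon>[of n] unfolding real_norm_def v_def[of n "j n" x, symmetric]
            by (intro order_trans[OF _ abs_ge_self]) linarith
        qed
      qed
      from L2_bound(2)[OF W L2_measurable[OF L2_diff(1)[OF L2_test[OF v] zL]] this] W'
      show ?thesis by simp
    qed
    have "e \<longlonglongrightarrow> 0" using z_lim by (simp add: e_def[abs_def])
    moreover from this have "(\<lambda>n. e (j n)) \<longlonglongrightarrow> 0" using j_lim by (rule filterlim_compose)
    ultimately have "(\<lambda>n. 16 * e (j n) + 36 * e n + 2 * ((\<epsilon> n)\<^sup>2 * measure lebesgue \<Omega>)) \<longlonglongrightarrow> 16 * 0 + 36 * 0 + 2 * (0\<^sup>2 * measure lebesgue \<Omega>)"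
      by (intro tendsto_intros \<epsilon>0)
    then have "(\<lambda>n. 16 * e (j n) + 36 * e n + 2 * ((\<epsilon> n)\<^sup>2 * measure lebesgue \<Omega>)) \<longlonglongrightarrow> 0" by simp
    then show "(\<lambda>n. sqn M (\<lambda>x. v n (j n) x - fst (Z x))) \<longlonglongrightarrow> 0"
      unfolding z_def[symmetric] by (rule Lim_null_comparison[OF always_eventually, rotated]) (use bound in auto)
  qed
  \<comment> \<open>The upper bounds \<epsilon> n pass to the weak limit. Coercivity then leaves
    only \<open>Z = 0\<close>.\<close>
  then have "bform Z Z \<le> 0"
    by (rule LIMSEQ_le[OF _ \<epsilon>0]) (use j(2) in auto)
  moreover obtain c where "0 < c" "c * sqn M Z \<le> bform Z Z" using bform_coercive_H10 Z by metis
  ultimately have "c * sqn M Z \<le> c * 0" by simp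
  then have "sqn M Z \<le> 0" using \<open>0 < c\<close> by (simp only: mult_le_cancel_left_pos)
  then have "sqn M Z = 0" using sqn_nonneg[of M Z] by linarith
  then have "AE x in M. Z x = 0" by (rule sqn_eq_0_AE[OF L])
  then show ?thesis by eventually_elim simp
qed

text \<open>By Stone and Weierstrass, the weight is a uniform limit of polynomials on the support of \<open>\<psi>\<close>.\<close>

lemma weak_grad_zero_weighted:
  assumes g: "weak_grad \<Omega> u g" "weak_grad \<Omega> u h" "L2 M g" "L2 M h" and \<psi>: "test_fun \<Omega> \<psi>"
  shows "integral\<^sup>L M (\<lambda>x. a x * (g x \<bullet> grad \<psi> x)) = integral\<^sup>L M (\<lambda>x. a x * (h x \<bullet> grad \<psi> x))"
proof -
  define d where "d x = g x - h x" for x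
  have dL: "L2 M d" unfolding d_def by (rule L2_diff(1)[OF g(3,4)])
  have int: "integrable M (\<lambda>x. (f x \<bullet> i) * \<eta> x)" if "L2 M f" "L2 M \<eta>" "i \<in> Basis" for f \<eta> and i :: 'a
  proof -
    have "L2 M (\<lambda>x. \<eta> x *\<^sub>R i)" using that(2,3) by (auto simp: L2_def power_mult_distrib)
    from L2_integrable_inner[OF that(1) this] show ?thesis by (simp add: mult.commute)
  qed
  have d0: "integral\<^sup>L M (\<lambda>x. (d x \<bullet> i) * \<eta> x) = 0" if "test_fun \<Omega> \<eta>" "i \<in> Basis" for \<eta> i
  proof -
    have "integral\<^sup>L M (\<lambda>x. (g x \<bullet> i) * \<eta> x) = integral\<^sup>L M (\<lambda>x. (h x \<bullet> i) * \<eta> x)"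
    proof -
      have "integral\<^sup>L M (\<lambda>x. u x * pderiv_dir \<eta> i x) = - integral\<^sup>L M (\<lambda>x. (g x \<bullet> i) * \<eta> x)"
        using g(1) that unfolding weak_grad_def by blast
      moreover have "integral\<^sup>L M (\<lambda>x. u x * pderiv_dir \<eta> i x) = - integral\<^sup>L M (\<lambda>x. (h x \<bullet> i) * \<eta> x)"
        using g(2) that unfolding weak_grad_def by blast
      ultimately show ?thesis by simp
    qed
    then show ?thesis
      using int[OF g(3) L2_test[OF that(1)] that(2)] int[OF g(4) L2_test[OF that(1)] that(2)]
      by (simp add: d_def inner_diff_left left_diff_distrib)
  qed
  obtain C where C: "compact C" "C \<subseteq> \<Omega>" "\<And>x v. x \<notin> C \<Longrightarrow> pderiv_dir \<psi> v x = 0"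
    using test_pair_supportE[OF \<psi>] by metis
  have a0: "integral\<^sup>L M (\<lambda>x. (d x \<bullet> i) * (a x * pderiv_dir \<psi> i x)) = 0" if i: "i \<in> Basis" for i
  proof -
    define P where "P = pderiv_dir \<psi> i"
    have P: "test_fun \<Omega> P" unfolding P_def by (rule test_fun_pderiv_dir[OF \<psi>])
    define I where "I = integral\<^sup>L M (\<lambda>x. \<bar>(d x \<bullet> i) * P x\<bar>)"
    have iI: "integrable M (\<lambda>x. \<bar>(d x \<bullet> i) * P x\<bar>)" by (intro integrable_abs int dL L2_test P i)
    have "0 \<le> I" by (simp add: I_def)
    have aP: "L2 M (\<lambda>x. a x * P x)" by (rule L2_a_mult_real[OF L2_test[OF P]])
    have "\<bar>integral\<^sup>L M (\<lambda>x. (d x \<bullet> i) * (a x * P x))\<bar> \<le> e" if "e > 0" for e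
    proof -
      \<comment> \<open>\<open>I + 1\<close> rather than \<open>I\<close>, since \<open>I\<close>
        may be zero.\<close>
      define e' where "e' = e / (I + 1)"
      have e': "0 < e'" using that \<open>0 \<le> I\<close> by (simp add: e'_def)
      have "continuous_on C a" using C(2) a_cont closure_subset continuous_on_subset by metis
      then obtain p where p: "real_polynomial_function p" "\<And>x. x \<in> C \<Longrightarrow> \<bar>a x - p x\<bar> < e'"
        using Stone_Weierstrass_real_polynomial_function[OF C(1) _ e'] by blast
      have pP: "test_fun \<Omega> (\<lambda>x. p x * P x)"
        by (rule test_fun_mult_smooth[OF P smooth_real_polynomial_function[OF p(1)]])
      \<comment> \<open>With \<open>p\<close> in place of \<open>a\<close> the integral vanishes by
        \<open>d0\<close>, since \<open>p * P\<close> is a test function; subtracting it leaves only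
        the error a - p on the support of \<open>P\<close>.\<close>
      have "integral\<^sup>L M (\<lambda>x. (d x \<bullet> i) * (a x * P x)) = integral\<^sup>L M (\<lambda>x. (d x \<bullet> i) * (a x * P x) - (d x \<bullet> i) * (p x * P x))"
        using int[OF dL aP i] int[OF dL L2_test[OF pP] i] d0[OF pP i] by simp
      also have "\<bar>\<dots>\<bar> \<le> integral\<^sup>L M (\<lambda>x. e' * \<bar>(d x \<bullet> i) * P x\<bar>)"
      proof (rule integral_abs_bound_integral)
        show "integrable M (\<lambda>x. (d x \<bullet> i) * (a x * P x) - (d x \<bullet> i) * (p x * P x))"
          by (intro Bochner_Integration.integrable_diff int dL aP L2_test[OF pP] i)
        show "integrable M (\<lambda>x. e' * \<bar>(d x \<bullet> i) * P x\<bar>)" using iI by simp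
        fix x
        have "\<bar>(d x \<bullet> i) * (a x * P x) - (d x \<bullet> i) * (p x * P x)\<bar> = \<bar>a x - p x\<bar> * \<bar>(d x \<bullet> i) * P x\<bar>"
          unfolding abs_mult[symmetric] by (simp add: algebra_simps)
        also have "\<dots> \<le> e' * \<bar>(d x \<bullet> i) * P x\<bar>"
        proof (cases "x \<in> C")
          case True
          then show ?thesis using p(2)[of x] by (intro mult_right_mono) auto
        qed (simp add: P_def C(3))
        finally show "\<bar>(d x \<bullet> i) * (a x * P x) - (d x \<bullet> i) * (p x * P x)\<bar> \<le> e' * \<bar>(d x \<bullet> i) * P x\<bar>" .
      qed
      also have "\<dots> = e' * I" by (simp add: I_def)
      also have "\<dots> \<le> e' * (I + 1)" using e' by (intro mult_left_mono) auto
      also have "\<dots> = e" using \<open>0 \<le> I\<close> by (simp add: e'_def)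
      finally show ?thesis .
    qed
    then have "\<bar>integral\<^sup>L M (\<lambda>x. (d x \<bullet> i) * (a x * P x))\<bar> \<le> 0" by (rule field_le_epsilon) simp
    then show ?thesis by (simp add: P_def)
  qed
  have aL: "L2 M (\<lambda>x. a x * pderiv_dir \<psi> i x)" for i
    by (rule L2_a_mult_real[OF L2_test[OF test_fun_pderiv_dir[OF \<psi>]]])
  have "integral\<^sup>L M (\<lambda>x. a x * (d x \<bullet> grad \<psi> x)) = integral\<^sup>L M (\<lambda>x. \<Sum>i\<in>Basis. (d x \<bullet> i) * (a x * pderiv_dir \<psi> i x))"
    by (intro Bochner_Integration.integral_cong) (auto simp: inner_commute[of "d _"] grad_inner sum_distrib_left algebra_simps)
  also have "\<dots> = 0"
    using int[OF dL aL] a0 by (simp add: Bochner_Integration.integral_sum)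
  finally have "integral\<^sup>L M (\<lambda>x. a x * (d x \<bullet> grad \<psi> x)) = 0" .
  moreover have "integrable M (\<lambda>x. a x * (f x \<bullet> grad \<psi> x))" if "L2 M f" for f
    using L2_integrable_inner[OF L2_a_mult[OF that] L2_grad[OF \<psi>]] by simp
  ultimately show ?thesis
    using g(3,4) by (simp add: d_def inner_diff_left right_diff_distrib)
qed

end

section \<open>Existence for a Lipschitz nonlinearity\<close>

text \<open>The two quadratic bounds express m \<le> G'' \<le> L, with \<open>g\<close> as the
  derivative of \<open>G\<close>, without mentioning second derivatives: the truncated nonlinearity
  to which this is applied may have corners at \<plusminus>K.\<close>

locale weighted_energy = weighted_domain \<Omega> a m for \<Omega> :: "'a::euclidean_space set" and a m +
  fixes G g :: "real \<Rightarrow> real" and L :: real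
  assumes G_lower: "G (s + r) \<ge> G s + g s * r + m / 2 * r\<^sup>2"
    and G_upper: "G (s + r) \<le> G s + g s * r + L / 2 * r\<^sup>2"
    and G_cont: "continuous_on UNIV G" and L_nonneg: "0 \<le> L"
    and g_lipschitz: "\<bar>g s - g t\<bar> \<le> L * \<bar>s - t\<bar>"
begin

definition density :: "('a \<Rightarrow> real \<times> 'a) \<Rightarrow> 'a \<Rightarrow> real" where
  "density U x = a x * ((norm (snd (U x)))\<^sup>2 / 2 + G (fst (U x)))"

definition energy :: "('a \<Rightarrow> real \<times> 'a) \<Rightarrow> real" where
  "energy U = integral\<^sup>L M (density U)"

text \<open>The L2 representative of the first variation: the derivative of \<open>energy\<close> at
  \<open>U\<close> in direction \<open>V\<close> is the L2 product of \<open>dgrad U\<close> and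
  \<open>V\<close>.\<close>

definition dgrad :: "('a \<Rightarrow> real \<times> 'a) \<Rightarrow> 'a \<Rightarrow> real \<times> 'a" where
  "dgrad U x = a x *\<^sub>R (g (fst (U x)), snd (U x))"

lemma g_cont: "continuous_on UNIV g"
  unfolding continuous_on_eq_continuous_at[OF open_UNIV]
proof
  fix s
  show "isCont g s" unfolding isCont_def
  proof (rule LIM_zero_cancel, rule Lim_null_comparison[OF always_eventually])
    show "\<forall>t. norm (g t - g s) \<le> L * \<bar>t - s\<bar>" using g_lipschitz by simp
    have "((\<lambda>t. L * \<bar>t - s\<bar>) \<longlongrightarrow> L * \<bar>s - s\<bar>) (at s)" by (intro tendsto_intros)
    then show "((\<lambda>t. L * \<bar>t - s\<bar>) \<longlongrightarrow> 0) (at s)" by simp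
  qed
qed

lemma L2_g_compose:
  assumes "L2 M u"
  shows "L2 M (\<lambda>x. g (u x))"
proof (rule L2_bound(1))
  show "L2 M (\<lambda>x. \<bar>g 0\<bar> + L *\<^sub>R norm (u x))"
    by (rule L2_add(1)[OF L2_const L2_scaleR[OF L2_norm(1)[OF assms]]])
  show "(\<lambda>x. g (u x)) \<in> borel_measurable M"
    by (rule borel_measurable_continuous_on[OF g_cont L2_measurable[OF assms]])
  show "AE x in M. norm (g (u x)) \<le> norm (\<bar>g 0\<bar> + L *\<^sub>R norm (u x))"
  proof (rule AE_I2)
    fix x
    have "\<bar>g (u x)\<bar> \<le> \<bar>g 0\<bar> + L * \<bar>u x\<bar>" using g_lipschitz[of "u x" 0] by simp
    then show "norm (g (u x)) \<le> norm (\<bar>g 0\<bar> + L *\<^sub>R norm (u x))" by simp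
  qed
qed

lemma L2_dgrad:
  assumes "L2 M U" shows "L2 M (dgrad U)"
  unfolding dgrad_def
  by (rule L2_a_mult[OF L2_Pair(1)[OF L2_g_compose[OF L2_fst(1)[OF assms]] L2_snd(1)[OF assms]]])

text \<open>The Lipschitz bound on \<open>g\<close> makes \<open>dgrad\<close> a Lipschitz map of L2
  with constant A (L + 1), \<open>A\<close> being an upper bound of the weight.\<close>

lemma dgrad_tendsto:
  assumes "\<And>n::nat. L2 M (U n)" "L2 M U'" "(\<lambda>n. sqn M (\<lambda>x. U n x - U' x)) \<longlonglongrightarrow> 0"
  shows "(\<lambda>n. sqn M (\<lambda>x. dgrad (U n) x - dgrad U' x)) \<longlonglongrightarrow> 0"
proof -
  obtain A where A: "0 \<le> A" "AE x in M. \<bar>a x\<bar> \<le> A" using a_AE_bounded by blast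
  have le: "sqn M (\<lambda>x. dgrad (U n) x - dgrad U' x) \<le> (A * (L + 1))\<^sup>2 * sqn M (\<lambda>x. U n x - U' x)" for n
  proof -
    have "AE x in M. norm (dgrad (U n) x - dgrad U' x) \<le> norm ((A * (L + 1)) *\<^sub>R (U n x - U' x))"
      using A(2)
    proof eventually_elim
      case (elim x)
      let ?d = "U n x - U' x"
      have "norm (dgrad (U n) x - dgrad U' x) = \<bar>a x\<bar> * norm (g (fst (U n x)) - g (fst (U' x)), snd ?d)"
        by (simp only: dgrad_def scaleR_diff_right[symmetric] norm_scaleR diff_Pair snd_diff)
      also have "\<dots> \<le> A * ((L + 1) * norm ?d)"
      proof (intro mult_mono elim A)
        have "norm (g (fst (U n x)) - g (fst (U' x)), snd ?d) \<le> norm (g (fst (U n x)) - g (fst (U' x))) + norm (snd ?d)"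
          by (rule norm_Pair_le)
        also have "\<dots> \<le> L * norm (fst ?d) + norm (snd ?d)" using g_lipschitz by simp
        also have "\<dots> \<le> L * norm ?d + norm ?d"
          using norm_fst_le[of "fst ?d" "snd ?d"] norm_snd_le[of "snd ?d" "fst ?d"] L_nonneg
          by (intro add_mono mult_left_mono) (simp_all del: fst_diff snd_diff)
        finally show "norm (g (fst (U n x)) - g (fst (U' x)), snd ?d) \<le> (L + 1) * norm ?d" by (simp add: algebra_simps)
      qed auto
      finally show ?case using A(1) L_nonneg by (simp add: mult.assoc)
    qed
    from L2_bound(2)[OF L2_scaleR[OF L2_diff(1)[OF assms(1,2)]] L2_measurable[OF L2_diff(1)[OF L2_dgrad[OF assms(1)] L2_dgrad[OF assms(2)]]] this]
    show ?thesis by (simp only: sqn_scaleR)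
  qed
  have "(\<lambda>n. (A * (L + 1))\<^sup>2 * sqn M (\<lambda>x. U n x - U' x)) \<longlonglongrightarrow> 0"
    using tendsto_mult_left[OF assms(3), of "(A * (L + 1))\<^sup>2"] by simp
  then show ?thesis by (rule Lim_null_comparison[OF always_eventually, rotated]) (use le in auto)
qed

text \<open>The two quadratic bounds at base point 0 give \<open>G\<close> at most quadratic growth,
  which is integrable over a set of finite measure along an L2 function.\<close>

lemma integrable_density:
  assumes U: "L2 M U" shows "integrable M (density U)"
proof -
  define K where "K = \<bar>G 0\<bar> + \<bar>g 0\<bar> + \<bar>m\<bar> + L + 1"
  have G_le: "\<bar>G s\<bar> \<le> K * (1 + s\<^sup>2)" for s
  proof -
    have "2 * \<bar>s\<bar> \<le> 1 + s\<^sup>2" using sum_squares_bound[of "\<bar>s\<bar>" 1] by simp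
    then have "\<bar>g 0\<bar> * \<bar>s\<bar> \<le> \<bar>g 0\<bar> * (1 + s\<^sup>2)" by (intro mult_left_mono) auto
    then have gs: "\<bar>g 0 * s\<bar> \<le> \<bar>g 0\<bar> * (1 + s\<^sup>2)" by (simp add: abs_mult)
    have ms: "\<bar>m / 2 * s\<^sup>2\<bar> \<le> \<bar>m\<bar> * (1 + s\<^sup>2)" and Ls: "L / 2 * s\<^sup>2 \<le> L * (1 + s\<^sup>2)"
      using L_nonneg by (simp_all add: abs_mult field_simps)
    have G0: "\<bar>G 0\<bar> \<le> \<bar>G 0\<bar> * (1 + s\<^sup>2)" and "0 \<le> \<bar>m\<bar> * (1 + s\<^sup>2)" "0 \<le> L * (1 + s\<^sup>2)" "0 \<le> 1 + s\<^sup>2"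
      using L_nonneg by (simp_all add: algebra_simps)
    moreover have "K * (1 + s\<^sup>2) = \<bar>G 0\<bar> * (1 + s\<^sup>2) + \<bar>g 0\<bar> * (1 + s\<^sup>2) + \<bar>m\<bar> * (1 + s\<^sup>2) + L * (1 + s\<^sup>2) + (1 + s\<^sup>2)"
      by (simp add: K_def algebra_simps)
    ultimately show ?thesis using G_lower[of 0 s] G_upper[of 0 s] gs ms Ls by (simp only: add_0) linarith
  qed
  obtain A where A: "0 \<le> A" "AE x in M. \<bar>a x\<bar> \<le> A" using a_AE_bounded by blast
  have i: "integrable M (\<lambda>x. A * ((norm (snd (U x)))\<^sup>2 + K * (1 + (norm (fst (U x)))\<^sup>2)))"
    using L2_integrable[OF L2_snd(1)[OF U]] L2_integrable[OF L2_fst(1)[OF U]] finite_measure.integrable_const[OF finite_measure_M, of 1]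
    by (intro integrable_mult_right Bochner_Integration.integrable_add) auto
  show ?thesis
  proof (rule Bochner_Integration.integrable_bound[OF i])
    have "(\<lambda>x. G (fst (U x))) \<in> borel_measurable M"
      by (rule borel_measurable_continuous_on[OF G_cont L2_measurable[OF L2_fst(1)[OF U]]])
    then show "density U \<in> borel_measurable M"
      unfolding density_def[abs_def] using L2_measurable[OF L2_snd(1)[OF U]] a_measurable by measurable
    show "AE x in M. norm (density U x) \<le> norm (A * ((norm (snd (U x)))\<^sup>2 + K * (1 + (norm (fst (U x)))\<^sup>2)))"
      using A(2)
    proof eventually_elim
      case (elim x)
      have "0 \<le> K" using L_nonneg by (simp add: K_def)
      have "norm (density U x) = \<bar>a x\<bar> * \<bar>(norm (snd (U x)))\<^sup>2 / 2 + G (fst (U x))\<bar>" by (simp add: density_def abs_mult)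
      also have "\<dots> \<le> A * ((norm (snd (U x)))\<^sup>2 + K * (1 + (norm (fst (U x)))\<^sup>2))"
      proof (intro mult_mono elim A)
        show "\<bar>(norm (snd (U x)))\<^sup>2 / 2 + G (fst (U x))\<bar> \<le> (norm (snd (U x)))\<^sup>2 + K * (1 + (norm (fst (U x)))\<^sup>2)"
          using G_le[of "fst (U x)"] zero_le_power2[of "norm (snd (U x))"] unfolding real_norm_def power2_abs by linarith
      qed auto
      finally show ?case by simp
    qed
  qed
qed

text \<open>The gradient part of the energy is exactly quadratic and the potential part obeys
  \<open>G_lower\<close> and \<open>G_upper\<close>. The lower remainder is exactly half the
  quadratic form, so coercivity applies to it; for the upper remainder a crude constant
  suffices.\<close>

lemma energy_bounds:
  obtains C where "0 \<le> C"
    "\<And>U V. L2 M U \<Longrightarrow> L2 M V \<Longrightarrow> energy (\<lambda>x. U x + V x) \<ge> energy U + integral\<^sup>L M (\<lambda>x. dgrad U x \<bullet> V x) + bform V V / 2"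
    "\<And>U V. L2 M U \<Longrightarrow> L2 M V \<Longrightarrow> energy (\<lambda>x. U x + V x) \<le> energy U + integral\<^sup>L M (\<lambda>x. dgrad U x \<bullet> V x) + C * sqn M V"
proof -
  obtain A where A: "0 \<le> A" "AE x in M. \<bar>a x\<bar> \<le> A" using a_AE_bounded by blast
  have sq: "(norm (p + q))\<^sup>2 / 2 = (norm p)\<^sup>2 / 2 + p \<bullet> q + (norm q)\<^sup>2 / 2" for p q :: 'a
    unfolding power2_norm_eq_inner by (simp add: inner_simps inner_commute field_simps)
  have lo: "energy (\<lambda>x. U x + V x) \<ge> energy U + integral\<^sup>L M (\<lambda>x. dgrad U x \<bullet> V x) + bform V V / 2"
    if U: "L2 M U" and V: "L2 M V" for U V
  proof -
    note i = integrable_density[OF U] L2_integrable_inner[OF L2_dgrad[OF U] V] L2_integrable_inner[OF L2_weightI[OF V] V]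
    have "energy U + integral\<^sup>L M (\<lambda>x. dgrad U x \<bullet> V x) + bform V V / 2
      = integral\<^sup>L M (\<lambda>x. density U x + dgrad U x \<bullet> V x + (weight V x \<bullet> V x) / 2)"
      using i by (simp add: energy_def bform_eq_inner)
    also have "\<dots> \<le> energy (\<lambda>x. U x + V x)" unfolding energy_def
    proof (intro integral_mono integrable_density L2_add(1) U V Bochner_Integration.integrable_add integrable_divide i)
      fix x assume "x \<in> space M"
      then have "0 \<le> a x" using a_pos_dom[of x] by simp
      then have "a x * (G (fst (U x)) + g (fst (U x)) * fst (V x) + m / 2 * (fst (V x))\<^sup>2) \<le> a x * G (fst (U x) + fst (V x))"
        by (intro mult_left_mono G_lower)
      then show "density U x + dgrad U x \<bullet> V x + (weight V x \<bullet> V x) / 2 \<le> density (\<lambda>x. U x + V x) x"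
        unfolding density_def dgrad_def weight_def snd_add fst_add sq
        by (simp add: inner_prod_def dot_square_norm power2_eq_square add_divide_distrib algebra_simps)
    qed
    finally show ?thesis .
  qed
  have up: "energy (\<lambda>x. U x + V x) \<le> energy U + integral\<^sup>L M (\<lambda>x. dgrad U x \<bullet> V x) + A * (L + 1) * sqn M V"
    if U: "L2 M U" and V: "L2 M V" for U V
  proof -
    note i = integrable_density[OF U] L2_integrable_inner[OF L2_dgrad[OF U] V] L2_integrable[OF V]
    have "energy (\<lambda>x. U x + V x) \<le> integral\<^sup>L M (\<lambda>x. density U x + dgrad U x \<bullet> V x + A * (L + 1) * (norm (V x))\<^sup>2)"
      unfolding energy_def
    proof (intro integral_mono_AE integrable_density L2_add(1) U V Bochner_Integration.integrable_add integrable_mult_right i)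
      show "AE x in M. density (\<lambda>x. U x + V x) x \<le> density U x + dgrad U x \<bullet> V x + A * (L + 1) * (norm (V x))\<^sup>2"
        using A(2) AE_space
      proof eventually_elim
        case (elim x)
        then have "0 \<le> a x" using a_pos_dom[of x] by simp
        then have 1: "a x * G (fst (U x) + fst (V x)) \<le> a x * (G (fst (U x)) + g (fst (U x)) * fst (V x) + L / 2 * (fst (V x))\<^sup>2)"
          by (intro mult_left_mono G_upper)
        have "a x * ((norm (snd (V x)))\<^sup>2 / 2 + L / 2 * (fst (V x))\<^sup>2) \<le> A * ((L + 1) * (norm (V x))\<^sup>2)"
        proof (intro mult_mono A)
          show "a x \<le> A" using elim by simp
          have n: "(norm (V x))\<^sup>2 = (fst (V x))\<^sup>2 + (norm (snd (V x)))\<^sup>2"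
            by (simp add: norm_prod_def)
          show "(norm (snd (V x)))\<^sup>2 / 2 + L / 2 * (fst (V x))\<^sup>2 \<le> (L + 1) * (norm (V x))\<^sup>2"
          proof -
            have "(L + 1) * (p + q) = L * p + L * q + p + q" for p q by (simp add: algebra_simps)
            moreover have "q / 2 + L / 2 * p \<le> L * p + L * q + p + q" if "0 \<le> p" "0 \<le> q" for p q :: real
              using that mult_nonneg_nonneg[OF L_nonneg that(1)] mult_nonneg_nonneg[OF L_nonneg that(2)] by simp
            ultimately show ?thesis unfolding n by simp
          qed
        qed (use L_nonneg in auto)
        with 1 show ?case
          unfolding density_def dgrad_def snd_add fst_add sq
          by (simp add: inner_prod_def algebra_simps)
      qed
    qed
    also have "\<dots> = energy U + integral\<^sup>L M (\<lambda>x. dgrad U x \<bullet> V x) + A * (L + 1) * sqn M V"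
      using i by (simp add: energy_def sqn_def)
    finally show ?thesis .
  qed
  show ?thesis by (rule that[of "A * (L + 1)"]) (use A(1) L_nonneg lo up in auto)
qed

text \<open>Strong convexity makes minimizing sequences converge, so no weak compactness is needed, and the
  Euler-Lagrange equation is obtained along the sequence.\<close>

lemma euler_lagrange_solution:
  assumes U0: "L2 M U0"
  obtains Z where "H10_pair Z" "\<And>\<eta>. test_fun \<Omega> \<eta> \<Longrightarrow> integral\<^sup>L M (\<lambda>x. dgrad (\<lambda>x. U0 x + Z x) x \<bullet> test_pair \<eta> x) = 0"
proof -
  obtain C where C: "0 \<le> C"
    "\<And>U V. L2 M U \<Longrightarrow> L2 M V \<Longrightarrow> energy (\<lambda>x. U x + V x) \<ge> energy U + integral\<^sup>L M (\<lambda>x. dgrad U x \<bullet> V x) + bform V V / 2"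
    "\<And>U V. L2 M U \<Longrightarrow> L2 M V \<Longrightarrow> energy (\<lambda>x. U x + V x) \<le> energy U + integral\<^sup>L M (\<lambda>x. dgrad U x \<bullet> V x) + C * sqn M V"
    by (rule energy_bounds) (rule that)
  obtain c where c: "0 < c" "\<And>\<psi>. test_fun \<Omega> \<psi> \<Longrightarrow> c * sqn M (test_pair \<psi>) \<le> bform (test_pair \<psi>) (test_pair \<psi>)"
    by (rule bform_coercive) (rule that)
  define J where "J \<psi> = energy (\<lambda>x. U0 x + test_pair \<psi> x)" for \<psi>
  have LU: "L2 M (\<lambda>x. U0 x + test_pair \<psi> x)" if "test_fun \<Omega> \<psi>" for \<psi>
    by (rule L2_add(1)[OF U0 L2_test_pair[OF that]])
  define I where "I = Inf (J ` {\<psi>. test_fun \<Omega> \<psi>})"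
  have bdd: "bdd_below (J ` {\<psi>. test_fun \<Omega> \<psi>})"
  proof (rule bdd_belowI2)
    fix \<psi> assume "\<psi> \<in> {\<psi>. test_fun \<Omega> \<psi>}"
    then have t: "test_fun \<Omega> \<psi>" by simp
    define n where "n = sqrt (sqn M (dgrad U0))"
    define s where "s = sqrt (sqn M (test_pair \<psi>))"
    have "\<bar>integral\<^sup>L M (\<lambda>x. dgrad U0 x \<bullet> test_pair \<psi> x)\<bar> \<le> n * s"
      unfolding n_def s_def by (rule L2_Cauchy_Schwarz[OF L2_dgrad[OF U0] L2_test_pair[OF t]])
    moreover have "c * s\<^sup>2 \<le> bform (test_pair \<psi>) (test_pair \<psi>)" using c(2)[OF t] by (simp add: s_def)
    moreover have "energy U0 + integral\<^sup>L M (\<lambda>x. dgrad U0 x \<bullet> test_pair \<psi> x) + bform (test_pair \<psi>) (test_pair \<psi>) / 2 \<le> J \<psi>"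
      unfolding J_def by (rule C(2)[OF U0 L2_test_pair[OF t]])
    \<comment> \<open>Young's inequality with the coercivity constant as weight: the linear term is
      swallowed by half of the quadratic one.\<close>
    moreover have "n * s \<le> c * s\<^sup>2 / 2 + n\<^sup>2 / (2 * c)"
    proof -
      have "0 \<le> (c * s - n)\<^sup>2 / (2 * c)" using c(1) by simp
      also have "\<dots> = c * s\<^sup>2 / 2 + n\<^sup>2 / (2 * c) - n * s" using c(1) by (simp add: field_simps power2_eq_square)
      finally show ?thesis by simp
    qed
    ultimately show "energy U0 - (sqrt (sqn M (dgrad U0)))\<^sup>2 / (2 * c) \<le> J \<psi>" unfolding n_def by linarith
  qed
  have I_le: "I \<le> J \<psi>" if "test_fun \<Omega> \<psi>" for \<psi> unfolding I_def by (rule cInf_lower[OF _ bdd]) (use that in simp)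
  have "\<exists>\<psi>. test_fun \<Omega> \<psi> \<and> J \<psi> < I + inverse (real (Suc k))" for k
  proof -
    have "J ` {\<psi>. test_fun \<Omega> \<psi>} \<noteq> {}" using test_fun_zero by blast
    moreover have "Inf (J ` {\<psi>. test_fun \<Omega> \<psi>}) < I + inverse (real (Suc k))" by (simp add: I_def)
    ultimately obtain y where "y \<in> J ` {\<psi>. test_fun \<Omega> \<psi>}" "y < I + inverse (real (Suc k))"
      using cInf_lessD by metis
    then show ?thesis by blast
  qed
  then obtain \<xi> where \<xi>: "\<And>k. test_fun \<Omega> (\<xi> k)" "\<And>k. J (\<xi> k) < I + inverse (real (Suc k))" by metis
  have cauchy: "c / 4 * sqn M (\<lambda>x. test_pair (\<xi> k) x - test_pair (\<xi> l) x) \<le> inverse (real (Suc k)) + inverse (real (Suc l))" for k l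
  proof -
    \<comment> \<open>The energy is expanded at the midpoint \<mu> in the directions \<delta> and
      -\<delta>. In the sum the first order terms cancel, and as the midpoint has energy at least
      \<open>I\<close>, the form at \<delta> is at most the sum of the two excesses over
      \<open>I\<close>. The half in \<delta> is the origin of the factor 1/4.\<close>
    define \<mu> where "\<mu> x = 1/2 * (\<xi> k x + \<xi> l x)" for x
    define \<delta> where "\<delta> x = 1/2 * (\<xi> k x - \<xi> l x)" for x
    have \<mu>: "test_fun \<Omega> \<mu>" unfolding \<mu>_def by (intro test_fun_cmult test_fun_add \<xi>)
    have \<delta>: "test_fun \<Omega> \<delta>" unfolding \<delta>_def by (intro test_fun_cmult test_fun_diff \<xi>)
    have pk: "\<xi> k = (\<lambda>x. \<mu> x + \<delta> x)" and pl: "\<xi> l = (\<lambda>x. \<mu> x - \<delta> x)"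
      by (auto simp: \<mu>_def \<delta>_def field_simps)
    note L\<mu> = LU[OF \<mu>] and L\<delta> = L2_test_pair[OF \<delta>]
    have "energy (\<lambda>x. U0 x + test_pair \<mu> x) + integral\<^sup>L M (\<lambda>x. dgrad (\<lambda>x. U0 x + test_pair \<mu> x) x \<bullet> test_pair \<delta> x) + bform (test_pair \<delta>) (test_pair \<delta>) / 2 \<le> J (\<xi> k)"
      using C(2)[OF L\<mu> L\<delta>] unfolding J_def pk test_pair_add[OF \<mu> \<delta>] by (simp add: add.assoc)
    moreover have "energy (\<lambda>x. U0 x + test_pair \<mu> x) - integral\<^sup>L M (\<lambda>x. dgrad (\<lambda>x. U0 x + test_pair \<mu> x) x \<bullet> test_pair \<delta> x) + bform (test_pair \<delta>) (test_pair \<delta>) / 2 \<le> J (\<xi> l)"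
      using C(2)[OF L\<mu> L2_uminus[OF L\<delta>]] unfolding J_def pl test_pair_diff[OF \<mu> \<delta>]
      by (simp add: add_diff_eq bform_def)
    moreover have "I \<le> energy (\<lambda>x. U0 x + test_pair \<mu> x)" using I_le[OF \<mu>] by (simp add: J_def)
    ultimately have "bform (test_pair \<delta>) (test_pair \<delta>) \<le> inverse (real (Suc k)) + inverse (real (Suc l))"
      using \<xi>(2)[of k] \<xi>(2)[of l] by linarith
    moreover have "c * sqn M (test_pair \<delta>) \<le> bform (test_pair \<delta>) (test_pair \<delta>)" by (rule c(2)[OF \<delta>])
    moreover have "sqn M (test_pair \<delta>) = 1/4 * sqn M (\<lambda>x. test_pair (\<xi> k) x - test_pair (\<xi> l) x)"
      unfolding \<delta>_def test_pair_cmult[OF test_fun_diff[OF \<xi>(1) \<xi>(1)]] sqn_scaleR test_pair_diff[OF \<xi>(1) \<xi>(1)]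
      by (simp add: power2_eq_square)
    ultimately show ?thesis by simp
  qed
  obtain Z where Z: "L2 M Z" "(\<lambda>n. sqn M (\<lambda>x. test_pair (\<xi> n) x - Z x)) \<longlonglongrightarrow> 0"
  proof (rule L2_complete[of M "\<lambda>n. test_pair (\<xi> n)", OF L2_test_pair[OF \<xi>(1)]])
    fix e :: real assume e: "0 < e"
    obtain N where N: "inverse (real (Suc N)) < c * e / 8"
      using reals_Archimedean[of "c * e / 8"] e c(1) by auto
    show "\<exists>N. \<forall>m\<ge>N. \<forall>n\<ge>N. sqn M (\<lambda>x. test_pair (\<xi> m) x - test_pair (\<xi> n) x) \<le> e"
    proof (intro exI allI impI)
      fix k l assume "N \<le> k" "N \<le> l"
      then have "inverse (real (Suc k)) \<le> inverse (real (Suc N))" "inverse (real (Suc l)) \<le> inverse (real (Suc N))"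
        by (auto intro!: le_imp_inverse_le)
      then have "c / 4 * sqn M (\<lambda>x. test_pair (\<xi> k) x - test_pair (\<xi> l) x) \<le> c / 4 * e"
        using cauchy[of k l] N by linarith
      then show "sqn M (\<lambda>x. test_pair (\<xi> k) x - test_pair (\<xi> l) x) \<le> e" using c(1) by simp
    qed
  qed
  have H: "H10_pair Z" unfolding H10_pair_def using Z \<xi>(1) by blast
  have "integral\<^sup>L M (\<lambda>x. dgrad (\<lambda>x. U0 x + Z x) x \<bullet> test_pair \<eta> x) = 0" if \<eta>: "test_fun \<Omega> \<eta>" for \<eta>
  proof -
    define U where "U k x = U0 x + test_pair (\<xi> k) x" for k x
    define D where "D = integral\<^sup>L M (\<lambda>x. dgrad (\<lambda>x. U0 x + Z x) x \<bullet> test_pair \<eta> x)"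
    have U: "L2 M (U k)" for k unfolding U_def by (rule LU[OF \<xi>(1)])
    have U': "L2 M (\<lambda>x. U0 x + Z x)" by (rule L2_add(1)[OF U0 Z(1)])
    have lim: "(\<lambda>k. integral\<^sup>L M (\<lambda>x. dgrad (U k) x \<bullet> test_pair \<eta> x)) \<longlonglongrightarrow> D"
      unfolding D_def
    proof (rule L2_tendsto_inner[OF L2_dgrad[OF U] L2_dgrad[OF U'] dgrad_tendsto[OF U U'] L2_test_pair[OF \<eta>]])
      show "(\<lambda>n. sqn M (\<lambda>x. U n x - (U0 x + Z x))) \<longlonglongrightarrow> 0" using Z(2) by (simp add: U_def)
    qed
    \<comment> \<open>The summand 1 keeps \<open>K\<close> positive even when \<eta> is zero, since
      \<open>K\<close> becomes a divisor.\<close>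
    define K where "K = C * sqn M (test_pair \<eta>) + 1"
    have K: "0 < K" using C(1) by (simp add: K_def add_nonneg_pos)
    have quad: "0 \<le> t * D + K * t\<^sup>2" for t
    proof -
      show ?thesis
      proof (rule LIMSEQ_le)
        show "(\<lambda>k. - inverse (real (Suc k))) \<longlonglongrightarrow> 0" using tendsto_minus[OF LIMSEQ_inverse_real_of_nat] by simp
        show "(\<lambda>k. t * integral\<^sup>L M (\<lambda>x. dgrad (U k) x \<bullet> test_pair \<eta> x) + K * t\<^sup>2) \<longlonglongrightarrow> t * D + K * t\<^sup>2"
          by (intro tendsto_intros lim)
        have "- inverse (real (Suc k)) \<le> t * integral\<^sup>L M (\<lambda>x. dgrad (U k) x \<bullet> test_pair \<eta> x) + K * t\<^sup>2" for k
        proof -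
          have tt: "test_fun \<Omega> (\<lambda>x. t * \<eta> x)" by (rule test_fun_cmult[OF \<eta>])
          have "I \<le> energy (\<lambda>x. U k x + t *\<^sub>R test_pair \<eta> x)"
            using I_le[OF test_fun_add[OF \<xi>(1) tt], of k]
            unfolding J_def test_pair_add[OF \<xi>(1) tt] test_pair_cmult[OF \<eta>] U_def by (simp add: add.assoc)
          also have "\<dots> \<le> energy (U k) + integral\<^sup>L M (\<lambda>x. dgrad (U k) x \<bullet> (t *\<^sub>R test_pair \<eta> x)) + C * sqn M (\<lambda>x. t *\<^sub>R test_pair \<eta> x)"
            by (rule C(3)[OF U L2_scaleR[OF L2_test_pair[OF \<eta>]]])
          also have "\<dots> = J (\<xi> k) + t * integral\<^sup>L M (\<lambda>x. dgrad (U k) x \<bullet> test_pair \<eta> x) + (K - 1) * t\<^sup>2"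
            unfolding sqn_scaleR J_def U_def[abs_def] K_def by simp
          finally show ?thesis using \<xi>(2)[of k] zero_le_power2[of t] unfolding left_diff_distrib mult_1_left by linarith
        qed
        then show "\<exists>N. \<forall>k\<ge>N. - inverse (real (Suc k)) \<le> t * integral\<^sup>L M (\<lambda>x. dgrad (U k) x \<bullet> test_pair \<eta> x) + K * t\<^sup>2" by blast
      qed
    qed
    \<comment> \<open>The minimizer of t D + K t^2, where the value is - D^2 / (4 K).\<close>
    have "0 \<le> (- D / (2 * K)) * D + K * (- D / (2 * K))\<^sup>2" by (rule quad)
    also have "\<dots> = - (D\<^sup>2 / (4 * K))" using K by (simp add: field_simps power2_eq_square)
    finally have "D\<^sup>2 / (4 * K) \<le> 0" by simp
    then have "D\<^sup>2 \<le> 0" using K by (simp add: pos_divide_le_eq)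
    then show ?thesis by (simp add: D_def)
  qed
  with H show ?thesis by (rule that)
qed

end

section \<open>Mollification\<close>

lemma pderiv_dir_eq_grad: "f differentiable (at x) \<Longrightarrow> pderiv_dir f v x = grad f x \<bullet> v"
proof -
  assume "f differentiable (at x)"
  then have lin: "linear (\<lambda>v. pderiv_dir f v x)"
    by (rule has_derivative_linear[OF has_derivative_pderiv_dir])
  have "pderiv_dir f v x = pderiv_dir f (\<Sum>i\<in>Basis. (v \<bullet> i) *\<^sub>R i) x" by (simp add: euclidean_representation)
  also have "\<dots> = (\<Sum>i\<in>Basis. (v \<bullet> i) * pderiv_dir f i x)"
    by (simp add: linear_sum[OF lin] linear_cmul[OF lin])
  finally show ?thesis by (simp add: grad_inner mult.commute)
qed

lemma test_fun_bounded:
  assumes "test_fun S f" obtains B where "0 \<le> B" "\<And>x. \<bar>f x\<bar> \<le> B"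
proof -
  obtain C where C: "compact C" "\<And>x. x \<notin> C \<Longrightarrow> f x = 0" by (rule test_fun_supportE[OF assms]) (rule that)
  have "compact (f ` C)" by (rule compact_continuous_image[OF test_fun_continuous[OF assms] C(1)])
  then obtain B where B: "\<And>x. x \<in> C \<Longrightarrow> \<bar>f x\<bar> \<le> B" using compact_imp_bounded bounded_iff by (metis imageI real_norm_def)
  show ?thesis
  proof (rule that[of "max B 0"])
    show "\<bar>f x\<bar> \<le> max B 0" for x
    proof (cases "x \<in> C")
      case True
      with B[OF this] show ?thesis by simp
    qed (simp add: C(2))
  qed simp
qed

lemma test_fun_grad_bounded:
  assumes "test_fun S f" obtains B where "0 \<le> B" "\<And>x. norm (grad f x) \<le> B"
proof -
  have "\<exists>B. 0 \<le> B \<and> (\<forall>x. \<bar>pderiv_dir f i x\<bar> \<le> B)" for i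
    using test_fun_bounded[OF test_fun_pderiv_dir[OF assms]] by metis
  then obtain B where B: "\<And>i. 0 \<le> B i" "\<And>i x. \<bar>pderiv_dir f i x\<bar> \<le> B i" by metis
  have "norm (grad f x) \<le> (\<Sum>i\<in>Basis. B i)" for x
    using norm_le_l1[of "grad f x"] sum_mono[of Basis "\<lambda>i. \<bar>grad f x \<bullet> i\<bar>" B] B(2)
    by (simp add: grad_inner_Basis)
  then show ?thesis using that[of "\<Sum>i\<in>Basis. B i"] B(1) by (simp add: sum_nonneg)
qed

lemma test_fun_lipschitz:
  assumes "test_fun S f" obtains B where "0 \<le> B" "\<And>x h. \<bar>f (x + h) - f x\<bar> \<le> B * norm h"
proof -
  obtain B where B: "0 \<le> B" "\<And>x. norm (grad f x) \<le> B" by (rule test_fun_grad_bounded[OF assms]) (rule that)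
  have "\<bar>f (x + h) - f x\<bar> \<le> B * norm h" for x h
  proof -
    obtain z where "f (x + 1 *\<^sub>R h) - f (x + 0 *\<^sub>R h) = (1 - 0) * pderiv_dir f h (x + z *\<^sub>R h)"
      using MVT2[of 0 1 "\<lambda>s. f (x + s *\<^sub>R h)" "\<lambda>s. pderiv_dir f h (x + s *\<^sub>R h)"]
        has_derivative_along_line[OF test_fun_differentiable[OF assms]] by auto
    then have "\<bar>f (x + h) - f x\<bar> = \<bar>grad f (x + z *\<^sub>R h) \<bullet> h\<bar>"
      by (simp add: pderiv_dir_eq_grad[OF test_fun_differentiable[OF assms]])
    also have "\<dots> \<le> norm (grad f (x + z *\<^sub>R h)) * norm h" by (rule Cauchy_Schwarz_ineq2)
    also have "\<dots> \<le> B * norm h" by (intro mult_right_mono B) auto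
    finally show ?thesis .
  qed
  then show ?thesis using that B(1) by blast
qed

text \<open>The gradient of a test function is globally Lipschitz, so the remainder is quadratic
  uniformly in \<open>x\<close>. This uniformity is what allows differentiation under the integral
  in \<open>conv_has_derivative\<close>.\<close>

lemma test_fun_taylor:
  assumes "test_fun S f" obtains B where "0 \<le> B" "\<And>x h. \<bar>f (x + h) - f x - pderiv_dir f h x\<bar> \<le> B * (norm h)\<^sup>2"
proof -
  have "\<exists>B. 0 \<le> B \<and> (\<forall>x h. \<bar>pderiv_dir f i (x + h) - pderiv_dir f i x\<bar> \<le> B * norm h)" for i
    using test_fun_lipschitz[OF test_fun_pderiv_dir[OF assms]] by metis
  then obtain B where B: "\<And>i. 0 \<le> B i" "\<And>i x h. \<bar>pderiv_dir f i (x + h) - pderiv_dir f i x\<bar> \<le> B i * norm h" by metis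
  define C where "C = (\<Sum>i\<in>Basis. B i)"
  have C: "0 \<le> C" unfolding C_def by (intro sum_nonneg B)
  have g: "norm (grad f (x + h) - grad f x) \<le> C * norm h" for x h
  proof -
    have "norm (grad f (x + h) - grad f x) \<le> (\<Sum>i\<in>Basis. \<bar>(grad f (x + h) - grad f x) \<bullet> i\<bar>)" by (rule norm_le_l1)
    also have "\<dots> \<le> (\<Sum>i\<in>Basis. B i * norm h)"
      by (intro sum_mono) (simp add: inner_diff_left grad_inner_Basis B(2))
    finally show ?thesis by (simp add: C_def sum_distrib_right)
  qed
  have "\<bar>f (x + h) - f x - pderiv_dir f h x\<bar> \<le> C * (norm h)\<^sup>2" for x h
  proof -
    obtain z where z: "0 < z" "z < 1" "f (x + 1 *\<^sub>R h) - f (x + 0 *\<^sub>R h) = (1 - 0) * pderiv_dir f h (x + z *\<^sub>R h)"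
      using MVT2[of 0 1 "\<lambda>s. f (x + s *\<^sub>R h)" "\<lambda>s. pderiv_dir f h (x + s *\<^sub>R h)"]
        has_derivative_along_line[OF test_fun_differentiable[OF assms]] by auto
    then have "\<bar>f (x + h) - f x - pderiv_dir f h x\<bar> = \<bar>(grad f (x + z *\<^sub>R h) - grad f x) \<bullet> h\<bar>"
      by (simp add: pderiv_dir_eq_grad[OF test_fun_differentiable[OF assms]] inner_diff_left)
    also have "\<dots> \<le> norm (grad f (x + z *\<^sub>R h) - grad f x) * norm h" by (rule Cauchy_Schwarz_ineq2)
    also have "\<dots> \<le> (C * norm (z *\<^sub>R h)) * norm h" by (intro mult_right_mono g) auto
    also have "\<dots> \<le> (C * norm h) * norm h"
      using z(1,2) C mult_right_mono[of z 1 "norm h"] by (intro mult_right_mono mult_left_mono) auto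
    finally show ?thesis by (simp add: power2_eq_square mult.assoc)
  qed
  then show ?thesis using that C by blast
qed

lemma reflect_differentiable:
  assumes "k differentiable (at (x - y))"
  shows "(\<lambda>y. k (x - y)) differentiable (at y)" "pderiv_dir (\<lambda>y. k (x - y)) v y = - pderiv_dir k v (x - y)"
proof -
  have d: "((\<lambda>y. x - y) has_derivative (\<lambda>v. - v)) (at y)" by (auto intro!: derivative_eq_intros)
  note D = has_derivative_pderiv_dir[OF assms]
  have c: "((\<lambda>y. k (x - y)) has_derivative (\<lambda>v. pderiv_dir k (- v) (x - y))) (at y)"
    by (rule has_derivative_compose[OF d D])
  then show "(\<lambda>y. k (x - y)) differentiable (at y)" by (rule differentiableI)
  show "pderiv_dir (\<lambda>y. k (x - y)) v y = - pderiv_dir k v (x - y)"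
    using pderiv_dir_eqI[OF c] linear_neg[OF has_derivative_linear[OF D], of v] by simp
qed

lemma smooth_reflect:
  assumes "smooth_on UNIV k" shows "smooth_on UNIV (\<lambda>y. k (x - y))"
proof -
  have "Ck_on n UNIV (\<lambda>y. k (x - y))" for n
    using assms
  proof (induction n arbitrary: k)
    case 0
    have "continuous_on UNIV k" using 0 by (rule smooth_continuous)
    then show ?case by (auto intro!: continuous_on_compose2[of UNIV k] continuous_intros)
  next
    case (Suc n)
    have d: "k differentiable (at z)" for z by (rule smooth_differentiable[OF Suc.prems])
    have "Ck_on n UNIV (pderiv_dir (\<lambda>y. k (x - y)) v)" for v
    proof (rule Ck_on_congI[OF open_UNIV])
      show "Ck_on n UNIV (\<lambda>y. (-1) * pderiv_dir k v (x - y))"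
        by (rule Ck_on_mult[OF open_UNIV Ck_on_const Suc.IH[OF smooth_on_pderiv_dir[OF Suc.prems]]])
    qed (simp add: reflect_differentiable(2)[OF d])
    moreover have "(\<lambda>y. k (x - y)) differentiable_on UNIV"
      using reflect_differentiable(1)[OF d] by (simp add: differentiable_on_def)
    ultimately show ?case by simp
  qed
  then show ?thesis by (simp add: smooth_on_def)
qed

text \<open>A property, not one rescaled profile: nonnegativity, mass one and support in the ball of
  radius \<delta> are all that the approximation estimates use, so they hold uniformly over all such
  kernels.\<close>

definition mollifier :: "real \<Rightarrow> ('a::euclidean_space \<Rightarrow> real) \<Rightarrow> bool" where
  "mollifier \<delta> k \<longleftrightarrow> test_fun UNIV k \<and> (\<forall>x. 0 \<le> k x) \<and> (\<forall>x. \<delta> < norm x \<longrightarrow> k x = 0) \<and> integral\<^sup>L lborel k = 1"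

lemma integrable_test_fun:
  assumes "test_fun UNIV k" shows "integrable lborel k"
proof -
  obtain C where C: "compact C" "\<And>x. x \<notin> C \<Longrightarrow> k x = 0" by (rule test_fun_supportE[OF assms]) (rule that)
  have "integrable lborel (\<lambda>x. indicator C x *\<^sub>R k x)"
    by (rule borel_integrable_compact[OF C(1) test_fun_continuous[OF assms]])
  moreover have "(\<lambda>x. indicator C x *\<^sub>R k x) = k"
  proof
    show "indicator C x *\<^sub>R k x = k x" for x using C(2) by (cases "x \<in> C") auto
  qed
  ultimately show ?thesis by simp
qed

text \<open>\<open>bump (\<delta>\<^sup>2 - (norm x)\<^sup>2)\<close> is nonzero exactly on the open
  ball. As this ball is not a null set, the integral is positive and can be normalized.\<close>

lemma mollifier_exists:
  assumes "0 < \<delta>" obtains k :: "'a::euclidean_space \<Rightarrow> real" where "mollifier \<delta> k"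
proof -
  define b :: "'a \<Rightarrow> real" where "b x = bump (\<delta>\<^sup>2 + (-1) * (norm x)\<^sup>2)" for x
  have "smooth_on UNIV (\<lambda>x::'a. (norm x)\<^sup>2)" by (simp add: smooth_on_def Ck_on_norm_power2)
  then have sm: "smooth_on UNIV b" unfolding b_def
    by (intro smooth_bump_compose smooth_on_add smooth_on_mult smooth_on_const open_UNIV)
  have b0: "b x = 0 \<longleftrightarrow> \<delta> \<le> norm x" for x
    using assms power2_le_iff_abs_le[of \<delta> "norm x"] abs_le_square_iff[of \<delta> "norm x"] by (simp add: b_def bump_eq_0_iff)
  have t: "test_fun UNIV b" by (rule test_funI[OF sm, of "cball 0 \<delta>"]) (auto simp: b0)
  define c where "c = integral\<^sup>L lborel b"
  have bn: "0 \<le> b x" for x by (simp add: b_def bump_nonneg)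
  have "c \<noteq> 0"
  proof
    assume "c = 0"
    then have "AE x in lborel. b x = 0"
      using integral_nonneg_eq_0_iff_AE[OF integrable_test_fun[OF t]] bn by (simp add: c_def)
    moreover have "{x \<in> space lborel. b x \<noteq> 0} = ball (0::'a) \<delta>" by (auto simp: b0)
    ultimately have "ball (0::'a) \<delta> \<in> null_sets lborel"
      using AE_iff_null[of lborel "\<lambda>x. b x = 0"] by simp
    then have "negligible (ball (0::'a) \<delta>)"
      by (simp add: negligible_iff_null_sets null_sets_completionI)
    moreover have "ball (0::'a) \<delta> \<noteq> {}" using assms by simp
    ultimately show False using open_not_negligible[OF open_ball] by blast
  qed
  moreover have "0 \<le> c" unfolding c_def by (rule integral_nonneg_AE) (simp add: bn)
  ultimately have c: "0 < c" by simp
  have "mollifier \<delta> (\<lambda>x. inverse c * b x)"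
    unfolding mollifier_def using test_fun_cmult[OF t, of "inverse c"] c bn b0
    by (auto simp: c_def[symmetric])
  then show ?thesis by (rule that)
qed

lemma mollifier_nn_integral:
  assumes "mollifier \<delta> k"
  shows "(\<integral>\<^sup>+x. ennreal (k x) \<partial>lborel) = 1"
    "(\<integral>\<^sup>+x. ennreal (k (x - y)) \<partial>lborel) = 1"
    "(\<integral>\<^sup>+x. ennreal (k (y - x)) \<partial>lborel) = 1"
proof -
  have k: "test_fun UNIV k" "\<And>x. 0 \<le> k x" "integral\<^sup>L lborel k = 1" using assms by (auto simp: mollifier_def)
  have km [measurable]: "k \<in> borel_measurable borel"
    by (rule borel_measurable_continuous_onI[OF test_fun_continuous[OF k(1)]])
  show 1: "(\<integral>\<^sup>+x. ennreal (k x) \<partial>lborel) = 1"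
    using nn_integral_eq_integral[OF integrable_test_fun[OF k(1)]] k by simp
  have "(\<integral>\<^sup>+x. ennreal (k x) \<partial>distr lborel borel ((+) (- y))) = (\<integral>\<^sup>+x. ennreal (k (x - y)) \<partial>lborel)"
    by (subst nn_integral_distr) auto
  then show "(\<integral>\<^sup>+x. ennreal (k (x - y)) \<partial>lborel) = 1" using 1 by (simp add: lborel_distr_plus)
  \<comment> \<open>Reflection invariance of \<open>lborel\<close>, as the affine change of
    variables with factor -1.\<close>
  have "lborel = density (distr lborel borel (\<lambda>x. y + (-1) *\<^sub>R x)) (\<lambda>_. ennreal (\<bar>-1\<bar> ^ DIM('a)))"
    using lborel_affine[of "-1" y] by simp
  then have "lborel = distr lborel borel (\<lambda>x. y - x)" by (simp add: density_1)
  then have "(\<integral>\<^sup>+x. ennreal (k x) \<partial>lborel) = (\<integral>\<^sup>+x. ennreal (k x) \<partial>distr lborel borel (\<lambda>x. y - x))" by metis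
  also have "\<dots> = (\<integral>\<^sup>+x. ennreal (k (y - x)) \<partial>lborel)"
    by (subst nn_integral_distr) auto
  finally show "(\<integral>\<^sup>+x. ennreal (k (y - x)) \<partial>lborel) = 1" using 1 by simp
qed

section \<open>Convolution over the domain\<close>

context bounded_domain
begin

text \<open>Convolution with the extension of \<open>f\<close> by zero. It is defined and smooth on
  the whole space, but near the boundary its gradient is unrelated to the weak gradient of
  \<open>f\<close>.\<close>

definition conv :: "('a \<Rightarrow> real) \<Rightarrow> ('a \<Rightarrow> 'b::euclidean_space) \<Rightarrow> 'a \<Rightarrow> 'b" where
  "conv k f x = integral\<^sup>L M (\<lambda>y. k (x - y) *\<^sub>R f y)"


lemma measurable_reflect:
  assumes "test_fun UNIV k" shows "(\<lambda>y. k (x - y)) \<in> borel_measurable M"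
proof (rule continuous_imp_measurable_M)
  show "continuous_on \<Omega> (\<lambda>y. k (x - y))"
    using smooth_continuous[OF smooth_reflect[OF test_fun_smooth[OF assms]]] continuous_on_subset by blast
qed

lemma integrable_conv:
  fixes f :: "'a \<Rightarrow> 'b::euclidean_space"
  assumes k: "test_fun UNIV k" and f: "integrable M f"
  shows "integrable M (\<lambda>y. k (x - y) *\<^sub>R f y)"
proof -
  obtain B where B: "0 \<le> B" "\<And>x. \<bar>k x\<bar> \<le> B" by (rule test_fun_bounded[OF k]) (rule that)
  have "integrable M (\<lambda>y. B *\<^sub>R f y)" using f by simp
  then show ?thesis
    by (rule Bochner_Integration.integrable_bound)
      (use B f measurable_reflect[OF k] in \<open>auto intro!: AE_I2 mult_right_mono\<close>)
qed

text \<open>Differentiation under the integral by a direct estimate: the Taylor remainder of the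
  kernel is at most B |h|^2 uniformly, so integrability of \<open>f\<close> bounds the total error
  by B I |h|^2.\<close>

lemma conv_has_derivative:
  fixes f :: "'a \<Rightarrow> real"
  assumes k: "test_fun UNIV k" and f: "integrable M f"
  shows "(conv k f has_derivative (\<lambda>v. conv (pderiv_dir k v) f x)) (at x)"
proof -
  obtain B where B: "0 \<le> B" "\<And>x h. \<bar>k (x + h) - k x - pderiv_dir k h x\<bar> \<le> B * (norm h)\<^sup>2"
    by (rule test_fun_taylor[OF k]) (rule that)
  note i = integrable_conv[OF k f] integrable_conv[OF test_fun_pderiv_dir[OF k] f]
  have lin: "linear (\<lambda>v. pderiv_dir k v z)" for z
    by (rule has_derivative_linear[OF has_derivative_pderiv_dir[OF test_fun_differentiable[OF k]]])
  have "linear (\<lambda>v. conv (pderiv_dir k v) f x)"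
  proof (rule linearI)
    show "conv (pderiv_dir k (u + v)) f x = conv (pderiv_dir k u) f x + conv (pderiv_dir k v) f x" for u v
      using i(2) by (simp add: conv_def linear_add[OF lin] distrib_right)
    show "conv (pderiv_dir k (c *\<^sub>R v)) f x = c *\<^sub>R conv (pderiv_dir k v) f x" for c v
      by (simp add: conv_def linear_cmul[OF lin] mult.assoc)
  qed
  then have bl: "bounded_linear (\<lambda>v. conv (pderiv_dir k v) f x)" by (simp add: linear_conv_bounded_linear)
  define I where "I = integral\<^sup>L M (\<lambda>y. \<bar>f y\<bar>)"
  have le: "norm (conv k f (x + h) - conv k f x - conv (pderiv_dir k h) f x) \<le> B * I * (norm h)\<^sup>2" for h
  proof -
    have "conv k f (x + h) - conv k f x - conv (pderiv_dir k h) f x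
      = integral\<^sup>L M (\<lambda>y. (k (x + h - y) *\<^sub>R f y - k (x - y) *\<^sub>R f y) - pderiv_dir k h (x - y) *\<^sub>R f y)"
      unfolding conv_def using i by (simp only: Bochner_Integration.integral_diff Bochner_Integration.integrable_diff)
    also have "\<bar>\<dots>\<bar> \<le> integral\<^sup>L M (\<lambda>y. B * (norm h)\<^sup>2 * \<bar>f y\<bar>)"
    proof (rule integral_abs_bound_integral)
      show "integrable M (\<lambda>y. (k (x + h - y) *\<^sub>R f y - k (x - y) *\<^sub>R f y) - pderiv_dir k h (x - y) *\<^sub>R f y)"
        by (intro Bochner_Integration.integrable_diff i)
      show "integrable M (\<lambda>y. B * (norm h)\<^sup>2 * \<bar>f y\<bar>)" using f by simp
      fix y
      have "\<bar>(k (x + h - y) *\<^sub>R f y - k (x - y) *\<^sub>R f y) - pderiv_dir k h (x - y) *\<^sub>R f y\<bar>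
        = \<bar>k ((x - y) + h) - k (x - y) - pderiv_dir k h (x - y)\<bar> * \<bar>f y\<bar>"
        unfolding abs_mult[symmetric] by (simp add: algebra_simps)
      also have "\<dots> \<le> B * (norm h)\<^sup>2 * \<bar>f y\<bar>" by (intro mult_right_mono B) auto
      finally show "\<bar>(k (x + h - y) *\<^sub>R f y - k (x - y) *\<^sub>R f y) - pderiv_dir k h (x - y) *\<^sub>R f y\<bar> \<le> B * (norm h)\<^sup>2 * \<bar>f y\<bar>" .
    qed
    also have "\<dots> = B * I * (norm h)\<^sup>2" by (simp add: I_def)
    finally show ?thesis by simp
  qed
  show ?thesis unfolding has_derivative_at
  proof (rule conjI[OF bl], rule Lim_null_comparison[OF always_eventually])
    show "\<forall>h. norm (norm (conv k f (x + h) - conv k f x - conv (pderiv_dir k h) f x) / norm h) \<le> B * I * norm h"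
    proof
      fix h :: 'a
      show "norm (norm (conv k f (x + h) - conv k f x - conv (pderiv_dir k h) f x) / norm h) \<le> B * I * norm h"
        using le[of h] by (cases "h = 0") (simp_all add: pos_divide_le_eq power2_eq_square mult.assoc)
    qed
    have "((\<lambda>h::'a. B * I * norm h) \<longlongrightarrow> B * I * norm (0::'a)) (at 0)" by (intro tendsto_intros)
    then show "((\<lambda>h::'a. B * I * norm h) \<longlongrightarrow> 0) (at 0)" by simp
  qed
qed

lemma smooth_conv:
  fixes f :: "'a \<Rightarrow> real"
  assumes k: "test_fun UNIV k" and f: "integrable M f"
  shows "smooth_on UNIV (conv k f)"
proof -
  have "Ck_on n UNIV (conv k f)" for n
    using k
  proof (induction n arbitrary: k)
    case 0
    show ?case using has_derivative_continuous[OF conv_has_derivative[OF 0 f]]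
      by (simp add: continuous_on_eq_continuous_at)
  next
    case (Suc n)
    have "pderiv_dir (conv k f) v = conv (pderiv_dir k v) f" for v
      using pderiv_dir_eqI[OF conv_has_derivative[OF Suc.prems f]] by blast
    moreover have "conv k f differentiable_on UNIV"
      using conv_has_derivative[OF Suc.prems f] by (auto simp: differentiable_on_def differentiable_def)
    ultimately show ?case using Suc.IH[OF test_fun_pderiv_dir[OF Suc.prems]] by simp
  qed
  then show ?thesis by (simp add: smooth_on_def)
qed

lemma continuous_conv:
  fixes F :: "'a \<Rightarrow> 'b::euclidean_space"
  assumes k: "test_fun UNIV k" and F: "integrable M F"
  shows "continuous_on S (conv k F)"
proof -
  have "conv k F x \<bullet> b = conv k (\<lambda>y. F y \<bullet> b) x" for x b
    using integral_inner_left[where c=b, OF integrable_conv[OF k F, of x]] by (simp add: conv_def)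
  then have "conv k F x = (\<Sum>b\<in>Basis. conv k (\<lambda>y. F y \<bullet> b) x *\<^sub>R b)" for x
    using euclidean_representation[of "conv k F x"] by simp
  then have "conv k F = (\<lambda>x. \<Sum>b\<in>Basis. conv k (\<lambda>y. F y \<bullet> b) x *\<^sub>R b)" by blast
  moreover have "continuous_on S (conv k (\<lambda>y. F y \<bullet> b))" for b
  proof -
    have "integrable M (\<lambda>y. F y \<bullet> b)" using F by simp
    from smooth_continuous[OF smooth_conv[OF k this]] show ?thesis by (rule continuous_on_subset) simp
  qed
  ultimately show ?thesis by (auto intro!: continuous_intros)
qed

lemma nn_integral_M_le: "(\<integral>\<^sup>+x. h x \<partial>M) \<le> (\<integral>\<^sup>+x. h x \<partial>lborel)"
proof -
  have "(\<integral>\<^sup>+x. h x \<partial>M) = (\<integral>\<^sup>+x. h x * indicator \<Omega> x \<partial>lebesgue)"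
    by (simp add: nn_integral_restrict_space)
  also have "\<dots> \<le> (\<integral>\<^sup>+x. h x \<partial>lebesgue)"
    by (intro nn_integral_mono) (auto simp: indicator_def)
  also have "\<dots> = (\<integral>\<^sup>+x. h x \<partial>lborel)" by (rule nn_integral_completion)
  finally show ?thesis .
qed

text \<open>Inequality instead of equality, because the shifted kernel may reach beyond
  \<Omega>.\<close>

lemma mollifier_integral_M_le:
  assumes "mollifier \<delta> k"
  shows "(\<integral>\<^sup>+y. ennreal (k (x - y)) \<partial>M) \<le> 1" "(\<integral>\<^sup>+x. ennreal (k (x - y)) \<partial>M) \<le> 1"
    and "integral\<^sup>L M (\<lambda>y. k (x - y)) \<le> 1"
proof -
  have k: "test_fun UNIV k" "\<And>x. 0 \<le> k x" using assms by (auto simp: mollifier_def)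
  have [measurable]: "k \<in> borel_measurable borel"
    by (rule borel_measurable_continuous_onI[OF test_fun_continuous[OF k(1)]])
  show 1: "(\<integral>\<^sup>+y. ennreal (k (x - y)) \<partial>M) \<le> 1"
    using nn_integral_M_le[of "\<lambda>y. ennreal (k (x - y))"] mollifier_nn_integral(3)[OF assms, of x] by simp
  show "(\<integral>\<^sup>+x. ennreal (k (x - y)) \<partial>M) \<le> 1"
    using nn_integral_M_le[of "\<lambda>x. ennreal (k (x - y))"] mollifier_nn_integral(2)[OF assms, of y] by simp
  have i: "integrable M (\<lambda>y. k (x - y))"
    using integrable_conv[OF k(1) L2_imp_integrable[OF L2_const[of "1::real"]]] by simp
  show "integral\<^sup>L M (\<lambda>y. k (x - y)) \<le> 1"
    using nn_integral_eq_integral[OF i] 1 k(2) by (simp flip: ennreal_1)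
qed

lemma conv_bounded:
  fixes f :: "'a \<Rightarrow> real"
  assumes k: "mollifier \<delta> k" and f: "integrable M f" "AE x in M. \<bar>f x\<bar> \<le> B" and "0 \<le> B"
  shows "\<bar>conv k f x\<bar> \<le> B"
proof -
  have k': "test_fun UNIV k" "\<And>x. 0 \<le> k x" using k by (auto simp: mollifier_def)
  have i: "integrable M (\<lambda>y. k (x - y))"
    using integrable_conv[OF k'(1) L2_imp_integrable[OF L2_const[of "1::real"]]] by simp
  have "\<bar>conv k f x\<bar> \<le> integral\<^sup>L M (\<lambda>y. \<bar>k (x - y) *\<^sub>R f y\<bar>)" unfolding conv_def by (rule integral_abs_bound)
  also have "\<dots> \<le> integral\<^sup>L M (\<lambda>y. B * k (x - y))"
  proof (rule integral_mono_AE)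
    show "AE y in M. \<bar>k (x - y) *\<^sub>R f y\<bar> \<le> B * k (x - y)"
      using f(2) by eventually_elim (use k'(2) in \<open>simp add: abs_mult mult.commute[of B] mult_left_mono\<close>)
  qed (use i integrable_conv[OF k'(1) f(1)] in auto)
  also have "\<dots> \<le> B * 1"
    using mult_left_mono[OF mollifier_integral_M_le(3)[OF k, of x] assms(4)] by simp
  finally show ?thesis by simp
qed

text \<open>Jensen's inequality: the variance of \<open>norm \<circ> F\<close> with respect to the kernel is nonnegative.\<close>

lemma norm_conv_power2_le:
  assumes k: "mollifier \<delta> k" and F: "L2 M F"
  shows "(norm (conv k F x))\<^sup>2 \<le> integral\<^sup>L M (\<lambda>y. k (x - y) * (norm (F y))\<^sup>2)"
proof -
  have k': "test_fun UNIV k" "\<And>x. 0 \<le> k x" using k by (auto simp: mollifier_def)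
  note Fi = L2_imp_integrable[OF F]
  define n where "n = integral\<^sup>L M (\<lambda>y. k (x - y) * norm (F y))"
  have i1: "integrable M (\<lambda>y. k (x - y) * norm (F y))"
    using integrable_conv[OF k'(1) integrable_norm[OF Fi]] by simp
  have i2: "integrable M (\<lambda>y. k (x - y) * (norm (F y))\<^sup>2)"
    using integrable_conv[OF k'(1) L2_integrable[OF F]] by simp
  have i0: "integrable M (\<lambda>y. k (x - y))"
    using integrable_conv[OF k'(1) L2_imp_integrable[OF L2_const[of "1::real"]]] by simp
  have "norm (conv k F x) \<le> integral\<^sup>L M (\<lambda>y. norm (k (x - y) *\<^sub>R F y))"
    unfolding conv_def by (rule integral_norm_bound)
  then have 1: "norm (conv k F x) \<le> n" using k'(2) by (simp add: n_def)
  have "0 \<le> integral\<^sup>L M (\<lambda>y. k (x - y) * (norm (F y) - n)\<^sup>2)"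
    by (intro integral_nonneg_AE AE_I2) (simp add: k'(2))
  also have "\<dots> = integral\<^sup>L M (\<lambda>y. k (x - y) * (norm (F y))\<^sup>2 - 2 * n * (k (x - y) * norm (F y)) + n\<^sup>2 * k (x - y))"
    by (intro Bochner_Integration.integral_cong) (auto simp: power2_eq_square algebra_simps)
  also have "\<dots> = integral\<^sup>L M (\<lambda>y. k (x - y) * (norm (F y))\<^sup>2) - 2 * n * n + n\<^sup>2 * integral\<^sup>L M (\<lambda>y. k (x - y))"
    using i0 i1 i2 by (simp add: n_def)
  also have "\<dots> \<le> integral\<^sup>L M (\<lambda>y. k (x - y) * (norm (F y))\<^sup>2) - n\<^sup>2"
    using mult_left_mono[OF mollifier_integral_M_le(3)[OF k, of x], of "n\<^sup>2"] by (simp add: power2_eq_square)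
  finally have "n\<^sup>2 \<le> integral\<^sup>L M (\<lambda>y. k (x - y) * (norm (F y))\<^sup>2)" by simp
  moreover have "(norm (conv k F x))\<^sup>2 \<le> n\<^sup>2" using 1 by (intro power_mono) auto
  ultimately show ?thesis by linarith
qed

text \<open>The pointwise Jensen bound is integrated in \<open>x\<close>, the integrals are
  exchanged by Tonelli, and the kernel has mass at most one in \<open>x\<close> too. The constant 1
  does not depend on \<delta>, as the density argument in \<open>conv_approx\<close>
  requires.\<close>

lemma sqn_conv_le:
  fixes F :: "'a \<Rightarrow> 'b::euclidean_space"
  assumes k: "mollifier \<delta> k" and F: "L2 M F"
  shows "L2 M (conv k F)" "sqn M (conv k F) \<le> sqn M F"
proof -
  interpret finite_measure M by (rule finite_measure_M)
  interpret P: pair_sigma_finite M M by standard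
  have k': "test_fun UNIV k" "\<And>x. 0 \<le> k x" using k by (auto simp: mollifier_def)
  have km [measurable]: "k \<in> borel_measurable borel"
    by (rule borel_measurable_continuous_onI[OF test_fun_continuous[OF k'(1)]])
  have idm [measurable]: "(\<lambda>x. x) \<in> M \<rightarrow>\<^sub>M borel" by (rule continuous_imp_measurable_M) simp
  have Fm [measurable]: "F \<in> borel_measurable M" by (rule L2_measurable[OF F])
  have cm: "conv k F \<in> borel_measurable M"
    by (rule continuous_imp_measurable_M[OF continuous_conv[OF k'(1) L2_imp_integrable[OF F]]])
  have m: "(\<lambda>p. ennreal (k (fst p - snd p) * (norm (F (snd p)))\<^sup>2)) \<in> borel_measurable (M \<Otimes>\<^sub>M M)"
  proof -
    have "(\<lambda>p. fst p) \<in> M \<Otimes>\<^sub>M M \<rightarrow>\<^sub>M borel" "(\<lambda>p. snd p) \<in> M \<Otimes>\<^sub>M M \<rightarrow>\<^sub>M borel"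
      using measurable_compose[OF measurable_fst idm] measurable_compose[OF measurable_snd idm] by auto
    then have "(\<lambda>p. k (fst p - snd p)) \<in> borel_measurable (M \<Otimes>\<^sub>M M)"
      by (intro measurable_compose[OF borel_measurable_diff km])
    moreover have "(\<lambda>p. norm (F (snd p))) \<in> borel_measurable (M \<Otimes>\<^sub>M M)"
      by measurable
    ultimately show ?thesis by measurable
  qed
  have "(\<integral>\<^sup>+x. ennreal ((norm (conv k F x))\<^sup>2) \<partial>M) \<le> (\<integral>\<^sup>+x. (\<integral>\<^sup>+y. ennreal (k (x - y) * (norm (F y))\<^sup>2) \<partial>M) \<partial>M)"
  proof (rule nn_integral_mono)
    fix x
    have "integrable M (\<lambda>y. k (x - y) * (norm (F y))\<^sup>2)"
      using integrable_conv[OF k'(1) L2_integrable[OF F]] by simp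
    then have "(\<integral>\<^sup>+y. ennreal (k (x - y) * (norm (F y))\<^sup>2) \<partial>M) = ennreal (integral\<^sup>L M (\<lambda>y. k (x - y) * (norm (F y))\<^sup>2))"
      by (rule nn_integral_eq_integral) (simp add: k'(2))
    then show "ennreal ((norm (conv k F x))\<^sup>2) \<le> (\<integral>\<^sup>+y. ennreal (k (x - y) * (norm (F y))\<^sup>2) \<partial>M)"
      using norm_conv_power2_le[OF k F, of x] by (simp add: ennreal_leI)
  qed
  also have "\<dots> = (\<integral>\<^sup>+y. (\<integral>\<^sup>+x. ennreal (k (x - y) * (norm (F y))\<^sup>2) \<partial>M) \<partial>M)"
    using P.Fubini'[of "\<lambda>x y. ennreal (k (x - y) * (norm (F y))\<^sup>2)"] m by (simp add: case_prod_beta')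
  also have "\<dots> \<le> (\<integral>\<^sup>+y. ennreal ((norm (F y))\<^sup>2) \<partial>M)"
  proof (rule nn_integral_mono)
    fix y
    have "(\<integral>\<^sup>+x. ennreal (k (x - y) * (norm (F y))\<^sup>2) \<partial>M) = (\<integral>\<^sup>+x. ennreal (k (x - y)) \<partial>M) * ennreal ((norm (F y))\<^sup>2)"
    proof -
      have "(\<lambda>x. ennreal (k (x - y))) \<in> borel_measurable M" by measurable
      then show ?thesis by (simp add: ennreal_mult k'(2) nn_integral_multc)
    qed
    also have "\<dots> \<le> 1 * ennreal ((norm (F y))\<^sup>2)" by (intro mult_right_mono mollifier_integral_M_le(2)[OF k]) auto
    finally show "(\<integral>\<^sup>+x. ennreal (k (x - y) * (norm (F y))\<^sup>2) \<partial>M) \<le> ennreal ((norm (F y))\<^sup>2)" by simp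
  qed
  also have "\<dots> = ennreal (sqn M F)"
    unfolding sqn_def by (rule nn_integral_eq_integral[OF L2_integrable[OF F]]) simp
  finally have le: "(\<integral>\<^sup>+x. ennreal ((norm (conv k F x))\<^sup>2) \<partial>M) \<le> ennreal (sqn M F)" .
  then have "(\<integral>\<^sup>+x. ennreal ((norm (conv k F x))\<^sup>2) \<partial>M) < \<infinity>" by (rule le_less_trans) simp
  then have i: "integrable M (\<lambda>x. (norm (conv k F x))\<^sup>2)"
    using cm by (intro integrableI_bounded) auto
  then show "L2 M (conv k F)" using cm by (simp add: L2_def)
  show "sqn M (conv k F) \<le> sqn M F"
    using le nn_integral_eq_integral[OF i] by (simp add: sqn_def)
qed

lemma conv_diff:
  fixes F H :: "'a \<Rightarrow> 'b::euclidean_space"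
  assumes "test_fun UNIV k" "integrable M F" "integrable M H"
  shows "conv k (\<lambda>x. F x - H x) x = conv k F x - conv k H x"
  unfolding conv_def scaleR_diff_right
  by (intro Bochner_Integration.integral_diff integrable_conv assms)

end

text \<open>For N > 0 this is the radial retraction onto the closed ball of radius N; the maximum in
  the denominator gives one continuous formula for both cases.\<close>

definition truncate :: "real \<Rightarrow> 'b::real_normed_vector \<Rightarrow> 'b" where
  "truncate N v = (N / max N (norm v)) *\<^sub>R v"

lemma norm_truncate:
  assumes "0 < N" shows "norm (truncate N v) \<le> N" "norm (truncate N v) \<le> norm v"
proof -
  have p: "0 < max N (norm v)" using assms by simp
  have n: "norm (truncate N v) = N * norm v / max N (norm v)" using assms p by (simp add: truncate_def)
  show "norm (truncate N v) \<le> N" "norm (truncate N v) \<le> norm v"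
    unfolding n pos_divide_le_eq[OF p] using assms by (simp_all add: mult_left_mono mult_right_mono mult.commute[of "norm v"])
qed

lemma truncate_eq: "0 < N \<Longrightarrow> norm v \<le> N \<Longrightarrow> truncate N v = v"
  by (simp add: truncate_def max_absorb1)

lemma continuous_truncate:
  fixes S :: "'b::real_normed_vector set"
  assumes "0 < N" shows "continuous_on S (truncate N)"
proof -
  have "max N (norm v) \<noteq> 0" for v :: 'b using assms by (auto simp: max_def)
  then show ?thesis unfolding truncate_def by (intro continuous_intros) auto
qed

lemma integral_mollifier_reflect:
  assumes k: "mollifier \<delta> k"
  shows "integrable lborel (\<lambda>y. k (x - y))" "integral\<^sup>L lborel (\<lambda>y. k (x - y)) = 1"
proof -
  have k': "test_fun UNIV k" "\<And>x. 0 \<le> k x" using k by (auto simp: mollifier_def)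
  have "continuous_on UNIV (\<lambda>y. k (x - y))"
    by (rule smooth_continuous[OF smooth_reflect[OF test_fun_smooth[OF k'(1)]]])
  then have m: "(\<lambda>y. k (x - y)) \<in> borel_measurable lborel" using borel_measurable_continuous_onI by simp
  show i: "integrable lborel (\<lambda>y. k (x - y))"
    by (rule integrableI_nonneg[OF m]) (simp_all add: k'(2) mollifier_nn_integral(3)[OF k])
  show "integral\<^sup>L lborel (\<lambda>y. k (x - y)) = 1"
    using nn_integral_eq_integral[OF i] mollifier_nn_integral(3)[OF k, of x] k'(2)
    by (simp flip: ennreal_1)
qed

section \<open>Density of continuous functions in L2 and convergence of mollifications\<close>

context bounded_domain
begin

lemma L2_dominated:
  fixes f :: "nat \<Rightarrow> 'a \<Rightarrow> 'b::euclidean_space"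
  assumes m: "\<And>n. f n \<in> borel_measurable M" "f' \<in> borel_measurable M" and h: "L2 M h"
    and lim: "AE x in M. (\<lambda>n. f n x) \<longlonglongrightarrow> f' x" and bd: "\<And>n. AE x in M. norm (f n x) \<le> norm (h x)"
  shows "(\<lambda>n. sqn M (\<lambda>x. f n x - f' x)) \<longlonglongrightarrow> 0" "L2 M f'"
proof -
  have all: "AE x in M. \<forall>n. norm (f n x) \<le> norm (h x)" using bd by (simp add: AE_all_countable)
  have bd': "AE x in M. norm (f' x) \<le> norm (h x)"
    using lim all
  proof eventually_elim
    case (elim x)
    then show ?case by (intro LIMSEQ_le_const2[OF tendsto_norm]) auto
  qed
  show "L2 M f'" by (rule L2_bound(1)[OF h m(2) bd'])
  have "(\<lambda>n. integral\<^sup>L M (\<lambda>x. (norm (f n x - f' x))\<^sup>2)) \<longlonglongrightarrow> integral\<^sup>L M (\<lambda>x. 0 :: real)"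
  proof (rule integral_dominated_convergence[where w = "\<lambda>x. 4 * (norm (h x))\<^sup>2"])
    show "AE x in M. (\<lambda>n. (norm (f n x - f' x))\<^sup>2) \<longlonglongrightarrow> 0"
      using lim
    proof eventually_elim
      case (elim x)
      have "(\<lambda>n. (norm (f n x - f' x))\<^sup>2) \<longlonglongrightarrow> (norm (f' x - f' x))\<^sup>2" by (intro tendsto_intros elim)
      then show ?case by simp
    qed
    show "AE x in M. norm ((norm (f n x - f' x))\<^sup>2) \<le> 4 * (norm (h x))\<^sup>2" for n
      using bd[of n] bd'
    proof eventually_elim
      case (elim x)
      have "norm (f n x - f' x) \<le> 2 * norm (h x)" using norm_triangle_ineq4[of "f n x" "f' x"] elim by linarith
      then have "(norm (f n x - f' x))\<^sup>2 \<le> (2 * norm (h x))\<^sup>2" by (intro power_mono) auto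
      then show ?case by (simp add: power_mult_distrib)
    qed
  qed (use m L2_integrable[OF h] in auto)
  then show "(\<lambda>n. sqn M (\<lambda>x. f n x - f' x)) \<longlonglongrightarrow> 0" by (simp add: sqn_def)
qed

lemma AE_M_I: "AE x in lebesgue. P x \<Longrightarrow> AE x in M. P x"
  by (subst AE_restrict_space_iff) (auto elim: eventually_mono)

text \<open>For n > 0 it is zero up to distance 1/n from the complement and one from distance 2/n
  on. This yields compact support inside \<Omega> and the pointwise limit one at each point of
  \<Omega>.\<close>

definition cutoff :: "nat \<Rightarrow> 'a \<Rightarrow> real" where
  "cutoff n x = max 0 (min 1 (real n * infdist x (- \<Omega>) - 1))"

text \<open>Distances to the empty set are zero by convention in \<open>infdist\<close> and
  \<open>setdist\<close>, so the distance arguments below must know that the complement is not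
  empty.\<close>

lemma complement_nonempty: "- \<Omega> \<noteq> {}"
proof
  assume "- \<Omega> = {}"
  then have "\<Omega> = UNIV" by auto
  then show False using bounded_dom not_bounded_UNIV by blast
qed

lemma cutoff_props:
  shows "continuous_on UNIV (cutoff n)" "0 \<le> cutoff n x" "cutoff n x \<le> 1"
    and "x \<in> \<Omega> \<Longrightarrow> (\<lambda>n. cutoff n x) \<longlonglongrightarrow> 1"
    and "\<exists>K. compact K \<and> K \<subseteq> \<Omega> \<and> (\<forall>x. x \<notin> K \<longrightarrow> cutoff n x = 0)"
proof -
  show "continuous_on UNIV (cutoff n)" unfolding cutoff_def by (intro continuous_intros)
  show "0 \<le> cutoff n x" "cutoff n x \<le> 1" by (auto simp: cutoff_def)
  show "(\<lambda>n. cutoff n x) \<longlonglongrightarrow> 1" if "x \<in> \<Omega>"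
  proof (rule tendsto_eventually)
    have "infdist x (- \<Omega>) \<noteq> 0"
      using in_closed_iff_infdist_zero[of "- \<Omega>" x] complement_nonempty open_dom that by auto
    then have "0 < infdist x (- \<Omega>)" using infdist_nonneg[of x "- \<Omega>"] by linarith
    then obtain N where N: "2 / infdist x (- \<Omega>) < real N" using reals_Archimedean2 by blast
    show "\<forall>\<^sub>F n in sequentially. cutoff n x = 1"
      unfolding eventually_sequentially
    proof (intro exI allI impI)
      fix n assume "N \<le> n"
      then have "2 < real n * infdist x (- \<Omega>)"
        using N \<open>0 < infdist x (- \<Omega>)\<close> by (simp add: pos_divide_less_eq)
          (meson less_le_trans mult_right_mono of_nat_mono infdist_nonneg)
      then show "cutoff n x = 1" by (simp add: cutoff_def)
    qed
  qed
  show "\<exists>K. compact K \<and> K \<subseteq> \<Omega> \<and> (\<forall>x. x \<notin> K \<longrightarrow> cutoff n x = 0)"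
  proof (intro exI conjI allI impI)
    let ?K = "{x. 1 \<le> real n * infdist x (- \<Omega>)}"
    show sub: "?K \<subseteq> \<Omega>"
    proof
      fix x assume "x \<in> ?K"
      then show "x \<in> \<Omega>" using infdist_zero[of x "- \<Omega>"] by (cases "x \<in> \<Omega>") auto
    qed
    have "closed ?K" by (intro closed_Collect_le continuous_intros)
    then show "compact ?K" using bounded_subset[OF bounded_dom sub] by (simp add: compact_eq_bounded_closed)
    show "cutoff n x = 0" if "x \<notin> ?K" for x using that by (simp add: cutoff_def)
  qed
qed

text \<open>\<open>measurable_on\<close> supplies continuous functions converging almost everywhere
  to \<open>F\<close>. They carry no bound and no support condition, so both are truncated at a
  fixed level and multiplied by \<open>cutoff\<close>; dominated convergence then applies. Each of
  the two errors is below e/4, and \<open>sqn_triangle\<close> doubles both.\<close>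

lemma L2_dense:
  fixes F :: "'a \<Rightarrow> 'b::euclidean_space"
  assumes F: "L2 M F" and e: "0 < e"
  obtains c K where "continuous_on UNIV c" "compact K" "K \<subseteq> \<Omega>" "\<And>x. x \<notin> K \<Longrightarrow> c x = 0"
    "L2 M c" "sqn M (\<lambda>x. F x - c x) \<le> e"
proof -
  have Fm: "F \<in> borel_measurable M" by (rule L2_measurable[OF F])
  then have "F measurable_on \<Omega>" using measurable_on_iff_borel_measurable[OF dom_sets] by blast
  then obtain N g where N: "negligible N" and g: "\<And>n. continuous_on UNIV (g n)"
    "\<And>x. x \<notin> N \<Longrightarrow> (\<lambda>n. g n x) \<longlonglongrightarrow> (if x \<in> \<Omega> then F x else 0)"
    unfolding measurable_on_def by blast
  have tm: "(\<lambda>x. truncate (real (Suc j)) (F x)) \<in> borel_measurable M" for j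
    by (rule borel_measurable_continuous_on[OF continuous_truncate Fm]) simp
  have "(\<lambda>j. sqn M (\<lambda>x. truncate (real (Suc j)) (F x) - F x)) \<longlonglongrightarrow> 0"
  proof (rule L2_dominated(1)[OF tm Fm F])
    show "AE x in M. (\<lambda>j. truncate (real (Suc j)) (F x)) \<longlonglongrightarrow> F x"
    proof (rule AE_I2)
      fix x
      show "(\<lambda>j. truncate (real (Suc j)) (F x)) \<longlonglongrightarrow> F x"
      proof (rule tendsto_eventually, unfold eventually_sequentially)
        obtain J where "norm (F x) < real J" using reals_Archimedean2 by blast
        then have "truncate (real (Suc j)) (F x) = F x" if "J \<le> j" for j using that by (intro truncate_eq) auto
        then show "\<exists>J. \<forall>j\<ge>J. truncate (real (Suc j)) (F x) = F x" by blast
      qed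
    qed
    show "AE x in M. norm (truncate (real (Suc j)) (F x)) \<le> norm (F x)" for j
      by (intro AE_I2 norm_truncate) simp
  qed
  then obtain j where j: "sqn M (\<lambda>x. truncate (real (Suc j)) (F x) - F x) < e / 4"
    using LIMSEQ_D[of _ 0 "e/4"] e by fastforce
  define T where "T x = truncate (real (Suc j)) (F x)" for x
  define c where "c n x = cutoff n x *\<^sub>R truncate (real (Suc j)) (g n x)" for n x
  have cc: "continuous_on UNIV (c n)" for n unfolding c_def
    by (intro continuous_intros cutoff_props continuous_on_compose2[OF continuous_truncate[of "real (Suc j)" UNIV] g(1)]) auto
  have cm: "c n \<in> borel_measurable M" for n
    by (rule continuous_imp_measurable_M[OF continuous_on_subset[OF cc]]) simp
  have cb: "AE x in M. norm (c n x) \<le> norm (real (Suc j))" for n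
  proof (rule AE_I2)
    fix x
    have "norm (c n x) = cutoff n x * norm (truncate (real (Suc j)) (g n x))" by (simp add: c_def cutoff_props)
    also have "\<dots> \<le> 1 * real (Suc j)"
      by (intro mult_mono norm_truncate cutoff_props) auto
    finally show "norm (c n x) \<le> norm (real (Suc j))" by simp
  qed
  have "(\<lambda>n. sqn M (\<lambda>x. c n x - T x)) \<longlonglongrightarrow> 0"
  proof (rule L2_dominated(1)[OF cm _ L2_const _ cb])
    show "T \<in> borel_measurable M" unfolding T_def by (rule tm)
    have "AE x in lebesgue. x \<notin> N" using N by (simp add: negligible_iff_null_sets AE_not_in)
    then have "AE x in M. x \<notin> N" by (rule AE_M_I)
    then show "AE x in M. (\<lambda>n. c n x) \<longlonglongrightarrow> T x"
      using AE_space
    proof eventually_elim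
      case (elim x)
      have "isCont (truncate (real (Suc j))) (F x)"
        using continuous_truncate[of "real (Suc j)" "UNIV :: 'b set"] by (simp add: continuous_on_eq_continuous_at)
      moreover have "(\<lambda>n. g n x) \<longlonglongrightarrow> F x" using g(2)[of x] elim by simp
      ultimately have "(\<lambda>n. truncate (real (Suc j)) (g n x)) \<longlonglongrightarrow> truncate (real (Suc j)) (F x)"
        by (rule isCont_tendsto_compose)
      from tendsto_scaleR[OF cutoff_props(4) this] show ?case using elim by (simp add: c_def T_def)
    qed
  qed
  then obtain n where n: "sqn M (\<lambda>x. c n x - T x) < e / 4"
    using LIMSEQ_D[of _ 0 "e/4"] e by fastforce
  have cL: "L2 M (c n)" by (rule L2_bound(1)[OF L2_const cm cb])
  have TL: "L2 M T" unfolding T_def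
    by (rule L2_bound(1)[OF F tm]) (intro AE_I2 norm_truncate, simp)
  have Fc: "sqn M (\<lambda>x. F x - c n x) \<le> e"
    using sqn_triangle[OF F TL cL] j n e
    unfolding T_def[symmetric] sqn_commute[of M F T] sqn_commute[of M T "c n"] by linarith
  obtain K where K: "compact K" "K \<subseteq> \<Omega>" "\<And>x. x \<notin> K \<Longrightarrow> cutoff n x = 0" using cutoff_props(5) by metis
  then have "c n x = 0" if "x \<notin> K" for x using K(3)[OF that] by (simp add: c_def)
  from that[OF cc K(1,2) this cL Fc] show ?thesis by simp
qed

lemma conv_uniform:
  fixes c :: "'a \<Rightarrow> 'b::euclidean_space"
  assumes c: "continuous_on UNIV c" and K: "compact K" "K \<subseteq> \<Omega>" "\<And>x. x \<notin> K \<Longrightarrow> c x = 0" and e: "0 < e"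
  obtains d where "0 < d" "\<And>\<delta> k x. \<delta> \<le> d \<Longrightarrow> mollifier \<delta> k \<Longrightarrow> norm (conv k c x - c x) \<le> e"
proof -
  obtain R where R: "\<And>x. x \<in> K \<Longrightarrow> norm x \<le> R" using compact_imp_bounded[OF K(1)] bounded_iff by metis
  have "uniformly_continuous_on (cball 0 (R + 1)) c"
    by (rule compact_uniformly_continuous[OF continuous_on_subset[OF c]]) auto
  then obtain d where d: "0 < d" "\<And>x y. x \<in> cball 0 (R + 1) \<Longrightarrow> y \<in> cball 0 (R + 1) \<Longrightarrow> dist y x < d \<Longrightarrow> dist (c y) (c x) < e"
    unfolding uniformly_continuous_on_def using e by metis
  \<comment> \<open>Uniform continuity is available on the ball of radius R + 1. If one of two
    points at distance at most 1 lies outside of it, both lie outside of \<open>K\<close>, where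
    \<open>c\<close> vanishes.\<close>
  have uc: "norm (c y - c x) \<le> e" if "norm (x - y) \<le> min (d / 2) 1" for x y :: 'a
  proof (cases "x \<in> cball 0 (R + 1) \<and> y \<in> cball 0 (R + 1)")
    case True
    have "dist y x < d" using that d(1) by (simp add: dist_norm norm_minus_commute)
    then show ?thesis using d(2)[of x y] True by (simp add: dist_norm less_imp_le)
  next
    case False
    have "norm x \<le> norm y + norm (x - y)" "norm y \<le> norm x + norm (x - y)"
      using norm_triangle_sub[of x y] norm_triangle_sub[of y x] by (simp_all add: norm_minus_commute)
    then have "R < norm x \<and> R < norm y" using False that by auto
    then have "x \<notin> K" "y \<notin> K" using R by force+
    then show ?thesis using K(3) e by simp
  qed
  show ?thesis
  proof (rule that[of "min (d / 2) 1"])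
    show "0 < min (d / 2) 1" using d(1) by simp
    fix \<delta> and k :: "'a \<Rightarrow> real" and x assume \<delta>: "\<delta> \<le> min (d / 2) 1" and k: "mollifier \<delta> k"
    have k': "test_fun UNIV k" "\<And>x. 0 \<le> k x" "\<And>x. \<delta> < norm x \<Longrightarrow> k x = 0" using k by (auto simp: mollifier_def)
    note kr = integral_mollifier_reflect[OF k, of x]
    have cont: "continuous_on UNIV (\<lambda>y. k (x - y) *\<^sub>R c y)"
      by (intro continuous_intros c smooth_continuous[OF smooth_reflect[OF test_fun_smooth[OF k'(1)]]])
    have "integrable lborel (\<lambda>y. indicator K y *\<^sub>R (k (x - y) *\<^sub>R c y))"
      by (rule borel_integrable_compact[OF K(1) continuous_on_subset[OF cont]]) simp
    moreover have "(\<lambda>y. indicator K y *\<^sub>R (k (x - y) *\<^sub>R c y)) = (\<lambda>y. k (x - y) *\<^sub>R c y)"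
    proof
      show "indicator K y *\<^sub>R (k (x - y) *\<^sub>R c y) = k (x - y) *\<^sub>R c y" for y
        using K(3) by (cases "y \<in> K") auto
    qed
    ultimately have i: "integrable lborel (\<lambda>y. k (x - y) *\<^sub>R c y)" by simp
    have "conv k c x = integral\<^sup>L lebesgue (\<lambda>y. indicator \<Omega> y *\<^sub>R (k (x - y) *\<^sub>R c y))"
      unfolding conv_def by (simp add: integral_restrict_space)
    also have "\<dots> = integral\<^sup>L lebesgue (\<lambda>y. k (x - y) *\<^sub>R c y)"
    proof (intro Bochner_Integration.integral_cong refl)
      show "indicator \<Omega> y *\<^sub>R (k (x - y) *\<^sub>R c y) = k (x - y) *\<^sub>R c y" for y
        using K(2,3) by (cases "y \<in> \<Omega>") auto
    qed
    also have "\<dots> = integral\<^sup>L lborel (\<lambda>y. k (x - y) *\<^sub>R c y)"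
      using i by (intro integral_completion) auto
    finally have cv: "conv k c x = integral\<^sup>L lborel (\<lambda>y. k (x - y) *\<^sub>R c y)" .
    have "conv k c x - c x = integral\<^sup>L lborel (\<lambda>y. k (x - y) *\<^sub>R c y - k (x - y) *\<^sub>R c x)"
      using i kr by (simp add: cv)
    also have "norm \<dots> \<le> integral\<^sup>L lborel (\<lambda>y. norm (k (x - y) *\<^sub>R c y - k (x - y) *\<^sub>R c x))"
      by (rule integral_norm_bound)
    also have "\<dots> \<le> integral\<^sup>L lborel (\<lambda>y. e * k (x - y))"
    proof (rule integral_mono)
      show "integrable lborel (\<lambda>y. norm (k (x - y) *\<^sub>R c y - k (x - y) *\<^sub>R c x))"
        using i kr by (intro integrable_norm Bochner_Integration.integrable_diff) auto
      fix y
      have "norm (k (x - y) *\<^sub>R c y - k (x - y) *\<^sub>R c x) = k (x - y) * norm (c y - c x)"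
        using k'(2) by (simp flip: scaleR_diff_right)
      also have "\<dots> \<le> k (x - y) * e"
      proof (cases "norm (x - y) \<le> \<delta>")
        case True
        then show ?thesis using uc[of x y] \<delta> by (intro mult_left_mono k'(2)) auto
      qed (simp add: k'(3))
      finally show "norm (k (x - y) *\<^sub>R c y - k (x - y) *\<^sub>R c x) \<le> e * k (x - y)" by (simp add: mult.commute)
    qed (use kr in auto)
    also have "\<dots> = e" using kr by simp
    finally show "norm (conv k c x - c x) \<le> e" .
  qed
qed

text \<open>A three-term estimate through a continuous function \<open>c\<close> of compact support:
  convolution is an L2 contraction, so passing from \<open>F\<close> to \<open>c\<close> costs the
  same before and after it, and for \<open>c\<close> the convergence is uniform.\<close>

lemma conv_approx:
  fixes F :: "'a \<Rightarrow> 'b::euclidean_space"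
  assumes F: "L2 M F" and e: "0 < e"
  obtains d where "0 < d" "\<And>\<delta> k. \<delta> \<le> d \<Longrightarrow> mollifier \<delta> k \<Longrightarrow> sqn M (\<lambda>x. conv k F x - F x) \<le> e"
proof -
  \<comment> \<open>Two applications of \<open>sqn_triangle\<close> weigh the three errors by 2, 4
    and 4, in total 10 times e/12.\<close>
  have e12: "0 < e / 12" using e by simp
  obtain c K where c: "continuous_on UNIV c" and K: "compact K" "K \<subseteq> \<Omega>" "\<And>x. x \<notin> K \<Longrightarrow> c x = 0"
    and cL: "L2 M c" and cF: "sqn M (\<lambda>x. F x - c x) \<le> e / 12"
    by (rule L2_dense[OF F e12]) (rule that)
  \<comment> \<open>A positive bound for the measure of \<Omega>, so that it may be a divisor in
    \<open>s\<close>; the constant function \<open>s\<close> then has squared norm at most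
    e/12.\<close>
  define V where "V = measure lebesgue \<Omega> + 1"
  have V: "0 < V" unfolding V_def by (simp add: add_nonneg_pos)
  define s where "s = sqrt (e / (12 * V))"
  have s: "0 < s" using e V by (simp add: s_def)
  obtain d where d: "0 < d" "\<And>\<delta> k x. \<delta> \<le> d \<Longrightarrow> mollifier \<delta> k \<Longrightarrow> norm (conv k c x - c x) \<le> s"
    by (rule conv_uniform[OF c K(1,2) _ s]) (erule K(3), rule that)
  show ?thesis
  proof (rule that[OF d(1)])
    fix \<delta> and k :: "'a \<Rightarrow> real" assume \<delta>: "\<delta> \<le> d" and k: "mollifier \<delta> k"
    have k': "test_fun UNIV k" using k by (simp add: mollifier_def)
    note cF' = sqn_conv_le(1)[OF k F] and cc' = sqn_conv_le(1)[OF k cL]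
    have "sqn M (\<lambda>x. conv k F x - conv k c x) \<le> e / 12"
      using sqn_conv_le(2)[OF k L2_diff(1)[OF F cL]] cF
      by (simp add: conv_diff[OF k' L2_imp_integrable[OF F] L2_imp_integrable[OF cL]] sqn_def)
    moreover have "sqn M (\<lambda>x. conv k c x - c x) \<le> e / 12"
    proof -
      have "sqn M (\<lambda>x. conv k c x - c x) \<le> sqn M (\<lambda>x. s)"
        using d(2)[OF \<delta> k] s by (intro L2_bound(2)[OF L2_const L2_measurable[OF L2_diff(1)[OF cc' cL]]] AE_I2) simp
      also have "\<dots> = s\<^sup>2 * measure lebesgue \<Omega>" by (simp add: sqn_const)
      also have "\<dots> \<le> s\<^sup>2 * V" by (intro mult_left_mono) (auto simp: V_def)
      also have "\<dots> = e / 12" using e V by (simp add: s_def)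
      finally show ?thesis .
    qed
    moreover have "sqn M (\<lambda>x. conv k F x - F x) \<le> 2 * sqn M (\<lambda>x. conv k F x - conv k c x) + 2 * sqn M (\<lambda>x. conv k c x - F x)"
      by (rule sqn_triangle[OF cF' cc' F])
    moreover have "sqn M (\<lambda>x. conv k c x - F x) \<le> 2 * sqn M (\<lambda>x. conv k c x - c x) + 2 * sqn M (\<lambda>x. c x - F x)"
      by (rule sqn_triangle[OF cc' cL F])
    ultimately show "sqn M (\<lambda>x. conv k F x - F x) \<le> e"
      using cF e unfolding sqn_commute[of M c F] by linarith
  qed
qed

text \<open>If the \<delta>-ball about \<open>x\<close> lies in \<Omega>, the reflected kernel y
  \<mapsto> k (x - y) is a test function there and may be used in the definition of the weak
  gradient. The sign from the reflection cancels the sign from integration by parts.\<close>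

lemma grad_conv:
  fixes u :: "'a \<Rightarrow> real"
  assumes k: "mollifier \<delta> k" and u: "weak_grad \<Omega> u g" "integrable M u" "integrable M g" and x: "cball x \<delta> \<subseteq> \<Omega>"
  shows "grad (conv k u) x = conv k g x"
proof (rule euclidean_eqI)
  fix i :: 'a assume i: "i \<in> Basis"
  have k': "test_fun UNIV k" "\<And>x. \<delta> < norm x \<Longrightarrow> k x = 0" using k by (auto simp: mollifier_def)
  let ?\<eta> = "\<lambda>y. k (x - y)"
  have \<eta>: "test_fun \<Omega> ?\<eta>"
  proof (rule test_funI[OF smooth_reflect[OF test_fun_smooth[OF k'(1)]] compact_cball x])
    show "?\<eta> y = 0" if "y \<notin> cball x \<delta>" for y using that k'(2)[of "x - y"] by (simp add: dist_norm)
  qed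
  have "grad (conv k u) x \<bullet> i = conv (pderiv_dir k i) u x"
    using i pderiv_dir_eqI[OF conv_has_derivative[OF k'(1) u(2)]] by (simp add: grad_inner_Basis)
  also have "\<dots> = - integral\<^sup>L M (\<lambda>y. u y * pderiv_dir ?\<eta> i y)"
    by (simp add: conv_def reflect_differentiable(2)[OF test_fun_differentiable[OF k'(1)]] mult.commute)
  also have "\<dots> = integral\<^sup>L M (\<lambda>y. (g y \<bullet> i) * ?\<eta> y)"
    using u(1) \<eta> i unfolding weak_grad_def by simp
  also have "\<dots> = conv k g x \<bullet> i"
    using integral_inner_left[where c=i, OF integrable_conv[OF k'(1) u(3), of x]] by (simp add: conv_def mult.commute)
  finally show "grad (conv k u) x \<bullet> i = conv k g x \<bullet> i" .
qed

text \<open>\<open>V\<close> is close to \<open>g\<close> on all of \<Omega> but is claimed to be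
  the gradient of \<open>s\<close> only on \<open>K\<close>: near a boundary without regularity,
  mollification does not produce the gradient. The bound \<open>B\<close> survives because the
  kernel has mass at most one.\<close>

lemma local_smooth_approx:
  fixes u :: "'a \<Rightarrow> real"
  assumes u: "weak_grad \<Omega> u g" "L2 M u" "L2 M g" and B: "AE x in M. \<bar>u x\<bar> \<le> B" "0 \<le> B"
    and K: "compact K" "K \<subseteq> \<Omega>" and e: "0 < e"
  obtains s V where "smooth_on UNIV s" "\<And>x. \<bar>s x\<bar> \<le> B" "L2 M s" "L2 M V"
    "sqn M (\<lambda>x. s x - u x) \<le> e" "sqn M (\<lambda>x. V x - g x) \<le> e" "\<And>x. x \<in> K \<Longrightarrow> grad s x = V x"
proof -
  note ui = L2_imp_integrable[OF u(2)] and gi = L2_imp_integrable[OF u(3)]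
  obtain d1 where d1: "0 < d1" "\<And>\<delta> k. \<delta> \<le> d1 \<Longrightarrow> mollifier \<delta> k \<Longrightarrow> sqn M (\<lambda>x. conv k u x - u x) \<le> e"
    by (rule conv_approx[OF u(2) e]) (rule that)
  obtain d2 where d2: "0 < d2" "\<And>\<delta> k. \<delta> \<le> d2 \<Longrightarrow> mollifier \<delta> k \<Longrightarrow> sqn M (\<lambda>x. conv k g x - g x) \<le> e"
    by (rule conv_approx[OF u(3) e]) (rule that)
  obtain d3 where d3: "0 < d3" "\<And>x. x \<in> K \<Longrightarrow> cball x d3 \<subseteq> \<Omega>"
  \<comment> \<open>The empty set is separated because \<open>setdist\<close> from it is
    zero.\<close>
  proof (cases "K = {}")
    case False
    define d where "d = setdist K (- \<Omega>)"
    have "d \<noteq> 0"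
      using setdist_eq_0_compact_closed[OF K(1), of "- \<Omega>"] open_dom False complement_nonempty K(2) by (auto simp: d_def)
    then have "0 < d" using setdist_pos_le[of K "- \<Omega>"] unfolding d_def by linarith
    have "cball x (d / 2) \<subseteq> \<Omega>" if "x \<in> K" for x
    proof
      fix y assume "y \<in> cball x (d / 2)"
      then have "dist x y < d" using \<open>0 < d\<close> by simp
      then show "y \<in> \<Omega>" using setdist_le_dist[of x K y "- \<Omega>"] that by (force simp: d_def)
    qed
    then show ?thesis using that[of "d / 2"] \<open>0 < d\<close> by simp
  qed (use that[of 1] in auto)
  define \<delta> where "\<delta> = min d1 (min d2 d3)"
  have \<delta>: "0 < \<delta>" "\<delta> \<le> d1" "\<delta> \<le> d2" "\<delta> \<le> d3" using d1(1) d2(1) d3(1) by (auto simp: \<delta>_def)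
  obtain k :: "'a \<Rightarrow> real" where k: "mollifier \<delta> k" by (rule mollifier_exists[OF \<delta>(1)])
  have k': "test_fun UNIV k" using k by (simp add: mollifier_def)
  show ?thesis
  proof (rule that[of "conv k u" "conv k g"])
    show "grad (conv k u) x = conv k g x" if "x \<in> K" for x
      by (rule grad_conv[OF k u(1) ui gi]) (use d3(2)[OF that] \<delta>(4) in auto)
  qed (use smooth_conv[OF k' ui] conv_bounded[OF k ui B] sqn_conv_le(1)[OF k u(2)] sqn_conv_le(1)[OF k u(3)]
    d1(2)[OF \<delta>(2) k] d2(2)[OF \<delta>(3) k] in auto)
qed

end

section \<open>The maximum principle\<close>

lemma bump_le_1: "bump t \<le> 1"
  by (auto simp: bump_def bump_poly_def)

text \<open>Subtracting the quadratic comparison function leaves \<open>k\<close>, whose derivative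
  h t - h s - \<mu> (t - s) is nonnegative to the right of \<open>s\<close> and nonpositive to the
  left, so \<open>k\<close> is minimal at \<open>s\<close>.\<close>

lemma has_real_derivative_quadratic_lower:
  fixes H h :: "real \<Rightarrow> real"
  assumes H: "\<And>t. (H has_real_derivative h t) (at t)"
    and h: "\<And>s t. s \<le> t \<Longrightarrow> \<mu> * (t - s) \<le> h t - h s"
  shows "H s + h s * r + \<mu> / 2 * r\<^sup>2 \<le> H (s + r)"
proof -
  define k where "k t = H t - h s * (t - s) - \<mu> / 2 * (t - s)\<^sup>2" for t
  have k: "(k has_real_derivative h t - h s - \<mu> * (t - s)) (at t)" for t
    unfolding k_def by (auto intro!: derivative_eq_intros H)
  have "k s \<le> k (s + r)"
  proof (cases "0 \<le> r")
    case True
    show ?thesis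
    proof (rule DERIV_nonneg_imp_nondecreasing[where f = k])
      show "\<exists>y. (k has_real_derivative y) (at x) \<and> 0 \<le> y" if "s \<le> x" "x \<le> s + r" for x
        using k[of x] h[OF that(1)] by (intro exI conjI) auto
    qed (use True in simp)
  next
    case False
    show ?thesis
    proof (rule DERIV_nonpos_imp_nonincreasing[where f = k])
      show "\<exists>y. (k has_real_derivative y) (at x) \<and> y \<le> 0" if "s + r \<le> x" "x \<le> s" for x
        using k[of x] h[OF that(2)] by (intro exI conjI) (auto simp: algebra_simps)
    qed (use False in simp)
  qed
  then show ?thesis by (simp add: k_def)
qed

context bounded_domain
begin

lemma weak_grad_uminus: "weak_grad \<Omega> u g \<Longrightarrow> weak_grad \<Omega> (\<lambda>x. - u x) (\<lambda>x. - g x)"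
  unfolding weak_grad_def by simp

lemma H10_pair_uminus: "H10_pair Z \<Longrightarrow> H10_pair (\<lambda>x. - Z x)"
proof -
  assume Z: "H10_pair Z"
  from H10_pair_diff[OF H10_pair_diff[OF Z Z] Z] show ?thesis by simp
qed

end

context weighted_domain
begin

text \<open>Stampacchia's truncation with \<open>bump (u - K)\<close> in place of the positive part of \<open>u - K\<close>. The
  mollified boundary datum stays below \<open>K\<close>, so that the resulting function vanishes with the approximating test
  function, and the gradient of the datum is needed only on the support of the latter.\<close>

lemma maximum_principle:
  assumes Z: "H10_pair Z" and \<phi>: "weak_grad \<Omega> \<phi> d\<phi>" "L2 M \<phi>" "L2 M d\<phi>"
    and B: "AE x in M. \<bar>\<phi> x\<bar> \<le> B" "0 \<le> B" "B < K"
    and f: "L2 M f" "\<And>x. x \<in> \<Omega> \<Longrightarrow> K < \<phi> x + fst (Z x) \<Longrightarrow> 0 < f x"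
    and eq: "\<And>\<psi>. test_fun \<Omega> \<psi> \<Longrightarrow>
      integral\<^sup>L M (\<lambda>x. a x * ((d\<phi> x + snd (Z x)) \<bullet> grad \<psi> x) + a x * f x * \<psi> x) = 0"
  shows "AE x in M. \<phi> x + fst (Z x) \<le> K"
proof -
  obtain \<xi> where L: "L2 M Z" and \<xi>: "\<And>k::nat. test_fun \<Omega> (\<xi> k)" "(\<lambda>k. sqn M (\<lambda>x. test_pair (\<xi> k) x - Z x)) \<longlonglongrightarrow> 0"
    using Z unfolding H10_pair_def by blast
  define \<epsilon> where "\<epsilon> j = inverse (real (Suc j))" for j
  have \<epsilon>: "0 < \<epsilon> j" for j by (simp add: \<epsilon>_def)
  have \<epsilon>0: "\<epsilon> \<longlonglongrightarrow> 0" unfolding \<epsilon>_def by (rule LIMSEQ_inverse_real_of_nat)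
  \<comment> \<open>The smoothed datum is chosen anew for each \<open>j\<close>, since the compact
    set on which its gradient must equal \<open>V\<close> is the support of \<open>\<xi> j\<close>
    and may grow towards the boundary.\<close>
  define P where "P j s V \<longleftrightarrow> smooth_on UNIV s \<and> (\<forall>x. \<bar>s x\<bar> \<le> B) \<and> L2 M s \<and> L2 M V \<and> sqn M (\<lambda>x. s x - \<phi> x) \<le> \<epsilon> j
      \<and> sqn M (\<lambda>x. V x - d\<phi> x) \<le> \<epsilon> j \<and> (\<forall>x. \<xi> j x \<noteq> 0 \<longrightarrow> grad s x = V x)" for j s V
  have "\<exists>s V. P j s V" for j
  proof -
    obtain C where C: "compact C" "C \<subseteq> \<Omega>" "\<And>x. x \<notin> C \<Longrightarrow> \<xi> j x = 0" by (rule test_fun_supportE[OF \<xi>(1)]) (rule that)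
    obtain s V where sV: "smooth_on UNIV s" "\<And>x. \<bar>s x\<bar> \<le> B" "L2 M s" "L2 M V"
      "sqn M (\<lambda>x. s x - \<phi> x) \<le> \<epsilon> j" "sqn M (\<lambda>x. V x - d\<phi> x) \<le> \<epsilon> j" "\<And>x. x \<in> C \<Longrightarrow> grad s x = V x"
      by (rule local_smooth_approx[OF \<phi> B(1,2) C(1,2) \<epsilon>[of j]]) (rule that)
    have "grad s x = V x" if "\<xi> j x \<noteq> 0" for x using sV(7)[of x] C(3)[of x] that by argo
    then show ?thesis unfolding P_def by (intro exI[of _ s] exI[of _ V] conjI allI impI sV(1-6))
  qed
  then obtain s V where "\<And>j. P j (s j) (V j)" by metis
  then have s: "\<And>j. smooth_on UNIV (s j)" "\<And>j x. \<bar>s j x\<bar> \<le> B" "\<And>j. L2 M (s j)" "\<And>j. L2 M (V j)"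
    "\<And>j. sqn M (\<lambda>x. s j x - \<phi> x) \<le> \<epsilon> j" "\<And>j. sqn M (\<lambda>x. V j x - d\<phi> x) \<le> \<epsilon> j"
    "\<And>j x. \<xi> j x \<noteq> 0 \<Longrightarrow> grad (s j) x = V j x"
    unfolding P_def by blast+
  have s_lim: "(\<lambda>j. sqn M (\<lambda>x. s j x - \<phi> x)) \<longlonglongrightarrow> 0"
    by (rule Lim_null_comparison[OF always_eventually \<epsilon>0]) (use s(5) in auto)
  have V_lim: "(\<lambda>j. sqn M (\<lambda>x. V j x - d\<phi> x)) \<longlonglongrightarrow> 0"
    by (rule Lim_null_comparison[OF always_eventually \<epsilon>0]) (use s(6) in auto)
  have \<xi>_le: "sqn M (\<lambda>x. \<xi> j x - fst (Z x)) \<le> sqn M (\<lambda>x. test_pair (\<xi> j) x - Z x)"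
    "sqn M (\<lambda>x. grad (\<xi> j) x - snd (Z x)) \<le> sqn M (\<lambda>x. test_pair (\<xi> j) x - Z x)" for j
    using L2_fst(2)[OF L2_diff(1)[OF L2_test_pair[OF \<xi>(1)] L], of j] L2_snd(2)[OF L2_diff(1)[OF L2_test_pair[OF \<xi>(1)] L], of j] by simp_all
  have \<xi>_lim: "(\<lambda>j. sqn M (\<lambda>x. \<xi> j x - fst (Z x))) \<longlonglongrightarrow> 0"
    by (rule Lim_null_comparison[OF always_eventually \<xi>(2)]) (use \<xi>_le(1) in auto)
  have d\<xi>_lim: "(\<lambda>j. sqn M (\<lambda>x. grad (\<xi> j) x - snd (Z x))) \<longlonglongrightarrow> 0"
    by (rule Lim_null_comparison[OF always_eventually \<xi>(2)]) (use \<xi>_le(2) in auto)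
  define u where "u x = \<phi> x + fst (Z x)" for x
  define U where "U x = d\<phi> x + snd (Z x)" for x
  have uL: "L2 M u" unfolding u_def by (rule L2_add(1)[OF \<phi>(2) L2_fst(1)[OF L]])
  have UL: "L2 M U" unfolding U_def by (rule L2_add(1)[OF \<phi>(3) L2_snd(1)[OF L]])
  define q where "q j x = s j x + \<xi> j x" for j x
  define W where "W j x = V j x + grad (\<xi> j) x" for j x
  have qL: "L2 M (q j)" for j unfolding q_def by (rule L2_add(1)[OF s(3) L2_test[OF \<xi>(1)]])
  have WL: "L2 M (W j)" for j unfolding W_def by (rule L2_add(1)[OF s(4) L2_grad[OF \<xi>(1)]])
  have q_lim: "(\<lambda>j. sqn M (\<lambda>x. q j x - u x)) \<longlonglongrightarrow> 0" unfolding q_def u_def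
    by (rule L2_tendsto_add[OF s(3) \<phi>(2) s_lim L2_test[OF \<xi>(1)] L2_fst(1)[OF L] \<xi>_lim])
  have W_lim: "(\<lambda>j. sqn M (\<lambda>x. W j x - U x)) \<longlonglongrightarrow> 0" unfolding W_def U_def
    by (rule L2_tendsto_add[OF s(4) \<phi>(3) V_lim L2_grad[OF \<xi>(1)] L2_snd(1)[OF L] d\<xi>_lim])
  obtain \<sigma> where \<sigma>: "strict_mono \<sigma>" "AE x in M. (\<lambda>j. q (\<sigma> j) x) \<longlonglongrightarrow> u x"
    by (rule L2_AE_subseq[OF qL uL q_lim]) (rule that)
  have W_lim': "(\<lambda>j. sqn M (\<lambda>x. W (\<sigma> j) x - U x)) \<longlonglongrightarrow> 0"
    using LIMSEQ_subseq_LIMSEQ[OF W_lim \<sigma>(1)] by (simp add: o_def)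
  define w where "w j x = bump (q j x + - K)" for j x
  have q_smooth: "smooth_on UNIV (\<lambda>x. q j x + - K)" for j unfolding q_def
    by (intro smooth_on_add smooth_on_const open_UNIV s(1) test_fun_smooth[OF \<xi>(1)])
  have neg: "q j x + - K < 0" if "\<xi> j x = 0" for j x
    using that s(2)[of j x] B(3) by (simp add: q_def)
  have w: "test_fun \<Omega> (w j)" for j
  proof (rule test_fun_weaken_support[OF \<xi>(1)[of j]])
    show "smooth_on UNIV (w j)" unfolding w_def by (rule smooth_bump_compose[OF q_smooth])
    show "w j x = 0" if "\<xi> j x = 0" for x unfolding w_def using neg[OF that] by (simp add: bump_eq_0_iff)
  qed
  have grad_w: "grad (w j) x = bump' (q j x + - K) *\<^sub>R W j x" for j x
  proof -
    have "grad (w j) x = bump' (q j x + - K) *\<^sub>R grad (\<lambda>x. q j x + - K) x"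
      unfolding grad_def w_def
      by (simp only: pderiv_dir_bump[OF smooth_differentiable[OF q_smooth]] scaleR_sum_right scaleR_scaleR)
    also have "grad (\<lambda>x. q j x + - K) x = grad (s j) x + grad (\<xi> j) x"
    proof -
      have d: "s j differentiable (at x)" "\<xi> j differentiable (at x)"
        using smooth_differentiable[OF s(1)] test_fun_differentiable[OF \<xi>(1)] by auto
      have "grad (\<lambda>x. (s j x + \<xi> j x) + - K) x = grad (\<lambda>x. s j x + \<xi> j x) x + grad (\<lambda>x. - K) x"
        by (rule grad_add) (use d in auto)
      moreover have "grad (\<lambda>x::'a. - K) x = 0" by (simp add: grad_def)
      ultimately show ?thesis unfolding q_def using grad_add[OF d] by simp
    qed
    also have "bump' (q j x + - K) *\<^sub>R (grad (s j) x + grad (\<xi> j) x) = bump' (q j x + - K) *\<^sub>R W j x"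
    proof (cases "\<xi> j x = 0")
      case True
      then show ?thesis using neg[OF True] by (simp add: bump'_eq_0)
    next
      case False
      then show ?thesis by (simp add: W_def s(7))
    qed
    finally show ?thesis .
  qed
  \<comment> \<open>The factor \<open>bump' (q j - K)\<close> converges only almost everywhere,
    along \<sigma>. Attached to the fixed L2 field a U it converges strongly by domination, and the
    remaining factor \<open>W j\<close> converges strongly anyway, so the limit of the product can
    be taken.\<close>
  define X where "X j x = bump' (q j x + - K) *\<^sub>R (a x *\<^sub>R U x)" for j x
  define Y where "Y x = bump' (u x + - K) *\<^sub>R (a x *\<^sub>R U x)" for x
  have aU: "L2 M (\<lambda>x. a x *\<^sub>R U x)" by (rule L2_a_mult[OF UL])
  have m: "(\<lambda>x. b (v x + - K) ) \<in> borel_measurable M" if "continuous_on UNIV b" "L2 M v" for b v :: "_ \<Rightarrow> real"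
    by (rule borel_measurable_continuous_on[OF that(1)]) (use L2_measurable[OF that(2)] in simp)
  have b4: "\<bar>bump' t\<bar> \<le> 4" for t using bump'_bounds[of t] by simp
  have XL: "L2 M (X j)" for j unfolding X_def
    by (rule L2_bounded_scaleR(1)[OF aU m[OF continuous_bump' qL]]) (use b4 in blast)
  have YL: "L2 M Y" unfolding Y_def
    by (rule L2_bounded_scaleR(1)[OF aU m[OF continuous_bump' uL]]) (use b4 in blast)
  have X_lim: "(\<lambda>j. sqn M (\<lambda>x. X (\<sigma> j) x - Y x)) \<longlonglongrightarrow> 0"
  proof (rule L2_dominated(1)[OF L2_measurable[OF XL] L2_measurable[OF YL] L2_scaleR[OF aU, of 4]])
    show "AE x in M. (\<lambda>j. X (\<sigma> j) x) \<longlonglongrightarrow> Y x"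
      using \<sigma>(2)
    proof eventually_elim
      case (elim x)
      have "isCont bump' (u x + - K)" using continuous_bump'[of UNIV] by (simp add: continuous_on_eq_continuous_at)
      then have "(\<lambda>j. bump' (q (\<sigma> j) x + - K)) \<longlonglongrightarrow> bump' (u x + - K)"
        by (rule isCont_tendsto_compose) (intro tendsto_intros elim)
      then show ?case unfolding X_def Y_def by (intro tendsto_intros)
    qed
    show "AE x in M. norm (X (\<sigma> j) x) \<le> norm (4 *\<^sub>R (a x *\<^sub>R U x))" for j
    proof (rule AE_I2)
      fix x
      show "norm (X (\<sigma> j) x) \<le> norm (4 *\<^sub>R (a x *\<^sub>R U x))"
        unfolding X_def norm_scaleR[of "bump' _"] norm_scaleR[of 4] using b4 by (intro mult_right_mono) auto
    qed
  qed
  have bL: "L2 M (\<lambda>x. bump (v x + - K))" if "L2 M v" for v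
    by (rule L2_bound(1)[OF L2_const[of "1::real"] m[OF continuous_bump that]]) (simp add: bump_le_1 bump_nonneg)
  have b_lim: "(\<lambda>j. sqn M (\<lambda>x. w (\<sigma> j) x - bump (u x + - K))) \<longlonglongrightarrow> 0"
  proof (rule L2_dominated(1)[OF L2_measurable[OF L2_test[OF w]] L2_measurable[OF bL[OF uL]] L2_const[of "1::real"]])
    show "AE x in M. (\<lambda>j. w (\<sigma> j) x) \<longlonglongrightarrow> bump (u x + - K)"
      using \<sigma>(2)
    proof eventually_elim
      case (elim x)
      have "isCont bump (u x + - K)" using continuous_bump[of UNIV] by (simp add: continuous_on_eq_continuous_at)
      then show ?case unfolding w_def
        by (rule isCont_tendsto_compose) (intro tendsto_intros elim)
    qed
  qed (simp add: w_def bump_le_1 bump_nonneg)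
  have af: "L2 M (\<lambda>x. a x * f x)" by (rule L2_a_mult_real[OF f(1)])
  have zero: "integral\<^sup>L M (\<lambda>x. X j x \<bullet> W j x) + integral\<^sup>L M (\<lambda>x. w j x \<bullet> (a x * f x)) = 0" for j
  proof -
    have "integral\<^sup>L M (\<lambda>x. X j x \<bullet> W j x + w j x \<bullet> (a x * f x)) = 0"
      using eq[OF w, of j] unfolding grad_w X_def U_def[symmetric] by (simp add: mult.commute mult.left_commute)
    then show ?thesis
      using L2_integrable_inner[OF XL WL, of j j] L2_integrable_inner[OF L2_test[OF w] af, of j] by simp
  qed
  \<comment> \<open>In the limit both integrals are nonnegative, the first because bump' \<ge> 0,
    the second because f > 0 wherever u > K. They add up to zero, and the second can vanish only if
    u \<le> K almost everywhere.\<close>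
  have "(\<lambda>j. integral\<^sup>L M (\<lambda>x. X (\<sigma> j) x \<bullet> W (\<sigma> j) x) + integral\<^sup>L M (\<lambda>x. w (\<sigma> j) x \<bullet> (a x * f x)))
    \<longlonglongrightarrow> integral\<^sup>L M (\<lambda>x. Y x \<bullet> U x) + integral\<^sup>L M (\<lambda>x. bump (u x + - K) \<bullet> (a x * f x))"
    by (rule tendsto_add[OF L2_tendsto_inner2[OF XL YL X_lim WL UL W_lim'] L2_tendsto_inner[OF L2_test[OF w] bL[OF uL] b_lim af]])
  then have "integral\<^sup>L M (\<lambda>x. Y x \<bullet> U x) + integral\<^sup>L M (\<lambda>x. bump (u x + - K) * (a x * f x)) = 0"
    unfolding zero by (simp add: LIMSEQ_const_iff)
  moreover have "0 \<le> integral\<^sup>L M (\<lambda>x. Y x \<bullet> U x)"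
    by (intro integral_nonneg_AE AE_I2) (auto simp: Y_def bump'_bounds less_imp_le[OF a_pos_dom])
  moreover have pos: "0 \<le> bump (u x + - K) * (a x * f x)" if "x \<in> \<Omega>" for x
  proof (cases "K < u x")
    case True
    then show ?thesis using f(2)[OF that] a_pos_dom[OF that] bump_nonneg by (simp add: u_def)
  next
    case False
    then have "bump (u x + - K) = 0" by (simp add: bump_eq_0_iff)
    then show ?thesis by simp
  qed
  moreover have "0 \<le> integral\<^sup>L M (\<lambda>x. bump (u x + - K) * (a x * f x))"
    by (intro integral_nonneg_AE AE_I2) (use pos in auto)
  ultimately have "integral\<^sup>L M (\<lambda>x. bump (u x + - K) * (a x * f x)) = 0" by linarith
  moreover have "integrable M (\<lambda>x. bump (u x + - K) * (a x * f x))"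
    by (rule L2_integrable_mult[OF bL[OF uL] af])
  moreover have "AE x in M. 0 \<le> bump (u x + - K) * (a x * f x)" using pos by (intro AE_I2) auto
  ultimately have "AE x in M. bump (u x + - K) * (a x * f x) = 0"
    using integral_nonneg_eq_0_iff_AE by blast
  then show ?thesis
    using AE_space
  proof eventually_elim
    case (elim x)
    then have x: "x \<in> \<Omega>" by simp
    show ?case
    proof (rule ccontr)
      assume "\<not> \<phi> x + fst (Z x) \<le> K"
      then have "K < u x" "0 < f x" using f(2)[OF x] by (auto simp: u_def)
      then show False using elim(1) a_pos_dom[OF x] by (simp add: bump_eq_0_iff)
    qed
  qed
qed

text \<open>The difference of two critical points solves the linear equation of
  \<open>uniqueness_H10\<close>, with the part of G' beyond its slope m as lower order term.
  Integrability of that term is known only against test functions, exactly as assumed there.\<close>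

lemma critical_points_AE_eq:
  assumes crit: "critical_point \<Omega> a G \<phi> u" "critical_point \<Omega> a G \<phi> v"
    and cont: "continuous_on UNIV (deriv G)"
    and mono: "\<And>s t. s \<le> t \<Longrightarrow> m * (t - s) \<le> deriv G t - deriv G s"
  shows "AE x in M. v x = u x"
proof -
  have *: "L2 M y \<and> (\<exists>d. H10_pair (\<lambda>x. (y x - \<phi> x, d x))) \<and> (\<exists>g. weak_grad \<Omega> y g \<and> L2 M g \<and>
      (\<forall>\<psi>. test_fun \<Omega> \<psi> \<longrightarrow> integrable M (\<lambda>x. a x * deriv G (y x) * \<psi> x) \<and>
        integral\<^sup>L M (\<lambda>x. a x * (g x \<bullet> grad \<psi> x) + a x * deriv G (y x) * \<psi> x) = 0))"
    if "critical_point \<Omega> a G \<phi> y" for y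
    using that unfolding critical_point_def H1_bc_def H1_def L2_on_iff L2_vec_on_iff H1_0_iff by blast
  obtain d g where u: "L2 M u" "H10_pair (\<lambda>x. (u x - \<phi> x, d x))" "weak_grad \<Omega> u g" "L2 M g"
    and uint: "\<And>\<psi>. test_fun \<Omega> \<psi> \<Longrightarrow> integrable M (\<lambda>x. a x * deriv G (u x) * \<psi> x)"
    and ueq: "\<And>\<psi>. test_fun \<Omega> \<psi> \<Longrightarrow> integral\<^sup>L M (\<lambda>x. a x * (g x \<bullet> grad \<psi> x) + a x * deriv G (u x) * \<psi> x) = 0"
    using *[OF crit(1)] by blast
  obtain e h where v: "L2 M v" "H10_pair (\<lambda>x. (v x - \<phi> x, e x))" "weak_grad \<Omega> v h" "L2 M h"
    and vint: "\<And>\<psi>. test_fun \<Omega> \<psi> \<Longrightarrow> integrable M (\<lambda>x. a x * deriv G (v x) * \<psi> x)"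
    and veq: "\<And>\<psi>. test_fun \<Omega> \<psi> \<Longrightarrow> integral\<^sup>L M (\<lambda>x. a x * (h x \<bullet> grad \<psi> x) + a x * deriv G (v x) * \<psi> x) = 0"
    using *[OF crit(2)] by blast
  define Z where "Z x = (v x - u x, e x - d x)" for x
  have Z: "H10_pair Z" using H10_pair_diff[OF v(2) u(2)] by (simp add: Z_def[abs_def])
  have ZL: "L2 M Z" using Z unfolding H10_pair_def by blast
  have dL: "L2 M (\<lambda>x. e x - d x)" using L2_snd(1)[OF ZL] by (simp add: Z_def)
  have zL: "L2 M (\<lambda>x. v x - u x)" by (rule L2_diff(1)[OF v(1) u(1)])
  \<comment> \<open>Two gradients of v - u are around: e - d from the membership in H^1_0 and h - g
    from the equations. The definition of a critical point does not identify them;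
    \<open>weak_grad_zero_weighted\<close> does so under the weighted integral.\<close>
  have wg: "weak_grad \<Omega> (\<lambda>x. v x - u x) (\<lambda>x. e x - d x)" using weak_grad_H10_pair[OF Z] by (simp add: Z_def)
  have wg': "weak_grad \<Omega> (\<lambda>x. v x - u x) (\<lambda>x. h x - g x)" by (rule weak_grad_diff[OF v(3) u(3) v(1) v(4) u(1) u(4)])
  \<comment> \<open>Since s \<mapsto> G'(s) - m s is nondecreasing, \<open>p\<close> has the sign of
    v - u.\<close>
  define p where "p x = (deriv G (v x) - m * v x) - (deriv G (u x) - m * u x)" for x
  have "AE x in M. fst (Z x) = 0"
  proof (rule uniqueness_H10[OF Z])
    have "(\<lambda>x. deriv G (y x)) \<in> borel_measurable M" if "L2 M y" for y
      by (rule borel_measurable_continuous_on[OF cont L2_measurable[OF that]])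
    then show "p \<in> borel_measurable M" unfolding p_def[abs_def]
      using L2_measurable[OF u(1)] L2_measurable[OF v(1)] u(1) v(1) by (intro borel_measurable_diff borel_measurable_times) auto
    show "0 \<le> p x * fst (Z x)" for x
    proof (cases "u x \<le> v x")
      case True
      then have "0 \<le> p x" using mono[OF True] by (simp add: p_def algebra_simps)
      then show ?thesis using True by (simp add: Z_def)
    next
      case False
      then have "p x \<le> 0" using mono[of "v x" "u x"] by (simp add: p_def algebra_simps)
      then show ?thesis using False by (simp add: Z_def mult_nonpos_nonpos)
    qed
    fix \<psi> assume \<psi>: "test_fun \<Omega> \<psi>"
    have i: "integrable M (\<lambda>x. m * ((a x * (v x - u x)) * \<psi> x))"
      by (intro integrable_mult_right L2_integrable_mult L2_a_mult_real zL L2_test \<psi>)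
    have ap: "a x * p x * \<psi> x = a x * deriv G (v x) * \<psi> x - a x * deriv G (u x) * \<psi> x - m * ((a x * (v x - u x)) * \<psi> x)" for x
      by (simp add: p_def algebra_simps)
    show "integrable M (\<lambda>x. a x * p x * \<psi> x)"
      unfolding ap by (intro Bochner_Integration.integrable_diff vint uint \<psi> i)
    have gi: "integrable M (\<lambda>x. a x * (k x \<bullet> grad \<psi> x))" if "L2 M k" for k
      using L2_integrable_inner[OF L2_a_mult[OF that] L2_grad[OF \<psi>]] by simp
    have "bform Z (test_pair \<psi>) = integral\<^sup>L M (\<lambda>x. a x * ((e x - d x) \<bullet> grad \<psi> x) + m * ((a x * (v x - u x)) * \<psi> x))"
      unfolding bform_def by (intro Bochner_Integration.integral_cong) (auto simp: Z_def algebra_simps)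
    also have "\<dots> = integral\<^sup>L M (\<lambda>x. a x * ((h x - g x) \<bullet> grad \<psi> x)) + integral\<^sup>L M (\<lambda>x. m * ((a x * (v x - u x)) * \<psi> x))"
      using gi[OF dL] i weak_grad_zero_weighted[OF wg wg' dL L2_diff(1)[OF v(4) u(4)] \<psi>] by simp
    also have "integral\<^sup>L M (\<lambda>x. a x * ((h x - g x) \<bullet> grad \<psi> x))
      = integral\<^sup>L M (\<lambda>x. a x * (h x \<bullet> grad \<psi> x)) - integral\<^sup>L M (\<lambda>x. a x * (g x \<bullet> grad \<psi> x))"
      using gi[OF v(4)] gi[OF u(4)] by (simp add: inner_diff_left right_diff_distrib)
    finally show "bform Z (test_pair \<psi>) + integral\<^sup>L M (\<lambda>x. a x * p x * \<psi> x) = 0"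
      using ueq[OF \<psi>] veq[OF \<psi>] gi[OF v(4)] gi[OF u(4)] uint[OF \<psi>] vint[OF \<psi>] i unfolding ap by simp
  qed
  then show ?thesis by eventually_elim (simp add: Z_def)
qed

end

section \<open>The main result\<close>

definition clamp_real :: "real \<Rightarrow> real \<Rightarrow> real" where
  "clamp_real K s = max (- K) (min K s)"

lemma clamp_real_props:
  assumes "0 \<le> K"
  shows "\<bar>clamp_real K s\<bar> \<le> K" "s \<le> t \<Longrightarrow> clamp_real K s \<le> clamp_real K t"
    "s \<le> t \<Longrightarrow> clamp_real K t - clamp_real K s \<le> t - s"
    "\<bar>s\<bar> \<le> K \<Longrightarrow> clamp_real K s = s" "K \<le> s \<Longrightarrow> clamp_real K s = K" "s \<le> - K \<Longrightarrow> clamp_real K s = - K"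
  using assms by (auto simp: clamp_real_def)

text \<open>Outside of \<open>[-K, K]\<close> the nonlinearity is continued with slope \<open>\<bar>m\<bar> + 1\<close>, which is at least \<open>m\<close> and positive.
  Positivity makes the signs beyond \<open>\<plusminus>K\<close> strict, and this is what the maximum principle uses.\<close>

lemma truncated_nonlinearity:
  fixes f f' :: "real \<Rightarrow> real"
  assumes f: "\<And>s. (f has_real_derivative f' s) (at s)" and f'_cont: "continuous_on UNIV f'"
    and f'_lower: "\<And>s. m \<le> f' s" and K: "0 < K" "0 \<le> f K" "f (- K) \<le> 0"
  obtains H h L where "\<And>s r. H s + h s * r + m / 2 * r\<^sup>2 \<le> H (s + r)"
    "\<And>s r. H (s + r) \<le> H s + h s * r + L / 2 * r\<^sup>2" "continuous_on UNIV H" "0 \<le> L"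
    "\<And>s t. \<bar>h s - h t\<bar> \<le> L * \<bar>s - t\<bar>"
    "\<And>s. \<bar>s\<bar> \<le> K \<Longrightarrow> h s = f s" "\<And>s. K < s \<Longrightarrow> 0 < h s" "\<And>s. s < - K \<Longrightarrow> h s < 0"
proof -
  have K0: "0 \<le> K" using K(1) by simp
  note c = clamp_real_props[OF K0]
  define h where "h s = f (clamp_real K s) + (\<bar>m\<bar> + 1) * (s - clamp_real K s)" for s
  have "compact (f' ` {-K..K})" by (rule compact_continuous_image[OF continuous_on_subset[OF f'_cont]]) auto
  then obtain D where D: "\<And>s. s \<in> {-K..K} \<Longrightarrow> \<bar>f' s\<bar> \<le> D" using compact_imp_bounded bounded_iff by (metis imageI real_norm_def)
  have "0 \<le> D" using D[of 0] K0 by auto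
  \<comment> \<open>The slopes are bounded by \<open>D\<close> inside [-K, K] and equal |m| + 1
    outside, and the sum covers both. It also exceeds |m|, so the one-sided bound with slope m
    yields the other half of the Lipschitz estimate.\<close>
  define L where "L = D + \<bar>m\<bar> + 1"
  have L: "0 \<le> L" using \<open>0 \<le> D\<close> by (simp add: L_def)
  have f_diff: "m * (t - s) \<le> f t - f s \<and> f t - f s \<le> D * (t - s)" if st: "s \<le> t" "\<bar>s\<bar> \<le> K" "\<bar>t\<bar> \<le> K" for s t
  proof (cases "s = t")
    case False
    then have "s < t" using st(1) by simp
    from MVT2[OF this] obtain z where z: "s < z" "z < t" "f t - f s = (t - s) * f' z"
      using f by metis
    have "z \<in> {-K..K}" using z(1,2) st(2,3) by (auto simp: abs_le_iff)
    then have "f' z \<le> D" using D[of z] by simp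
    then show ?thesis
      using z f'_lower[of z] st(1) by (simp add: mult.commute[of "t - s"] mult_right_mono)
  qed simp
  have h_diff: "m * (t - s) \<le> h t - h s \<and> h t - h s \<le> L * (t - s)" if st: "s \<le> t" for s t
  proof -
    \<comment> \<open>\<open>x\<close> is the part of the increment spent inside [-K, K]; the rest t
      - s - x is spent where the continuation is affine.\<close>
    define x where "x = clamp_real K t - clamp_real K s"
    have x: "0 \<le> x" "x \<le> t - s" using c(2,3)[OF st] by (auto simp: x_def)
    have fx: "m * x \<le> f (clamp_real K t) - f (clamp_real K s)" "f (clamp_real K t) - f (clamp_real K s) \<le> D * x"
      using f_diff[OF c(2)[OF st] c(1) c(1)] by (auto simp: x_def)
    have h: "h t - h s = (f (clamp_real K t) - f (clamp_real K s)) + (\<bar>m\<bar> + 1) * (t - s - x)"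
      by (simp add: h_def x_def algebra_simps)
    have "m * (t - s - x) \<le> (\<bar>m\<bar> + 1) * (t - s - x)" using x(2) by (intro mult_right_mono) auto
    moreover have "D * x \<le> D * (t - s)" "(\<bar>m\<bar> + 1) * (t - s - x) \<le> (\<bar>m\<bar> + 1) * (t - s)"
      using x \<open>0 \<le> D\<close> by (auto intro!: mult_left_mono)
    moreover have "m * (t - s) = m * x + m * (t - s - x)" "L * (t - s) = D * (t - s) + (\<bar>m\<bar> + 1) * (t - s)"
      by (simp_all add: L_def algebra_simps)
    ultimately show ?thesis using fx unfolding h by linarith
  qed
  have lip: "\<bar>h s - h t\<bar> \<le> L * \<bar>s - t\<bar>" for s t
  proof -
    have *: "\<bar>h t - h s\<bar> \<le> L * (t - s)" if "s \<le> t" for s t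
    proof -
      have "\<bar>m\<bar> \<le> L" using \<open>0 \<le> D\<close> by (simp add: L_def)
      then have "- L * (t - s) \<le> m * (t - s)" using that by (intro mult_right_mono) auto
      then show ?thesis using h_diff[OF that] unfolding abs_le_iff by linarith
    qed
    show ?thesis using *[of s t] *[of t s] by (cases "s \<le> t") (auto simp: abs_minus_commute)
  qed
  have h_cont: "isCont h s" for s
    unfolding isCont_def
  proof (rule LIM_zero_cancel, rule Lim_null_comparison[OF always_eventually])
    show "\<forall>t. norm (h t - h s) \<le> L * \<bar>t - s\<bar>" using lip by simp
    have "((\<lambda>t. L * \<bar>t - s\<bar>) \<longlongrightarrow> L * \<bar>s - s\<bar>) (at s)" by (intro tendsto_intros)
    then show "((\<lambda>t. L * \<bar>t - s\<bar>) \<longlongrightarrow> 0) (at s)" by simp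
  qed
  obtain H where "\<forall>s::real. - \<infinity> < ereal s \<longrightarrow> ereal s < \<infinity> \<longrightarrow> (H has_vector_derivative h s) (at s)"
    using einterval_antiderivative[of "-\<infinity>" "\<infinity>" h] h_cont by auto
  then have H: "(H has_real_derivative h s) (at s)" for s
    by (simp add: has_real_derivative_iff_has_vector_derivative)
  show ?thesis
  proof (rule that[of H h L])
    show "H s + h s * r + m / 2 * r\<^sup>2 \<le> H (s + r)" for s r
      by (rule has_real_derivative_quadratic_lower[OF H]) (use h_diff in blast)
    \<comment> \<open>The upper bound is the lower bound for \<open>- H\<close>, with modulus
      \<open>- L\<close>.\<close>
    have upper: "- H s + - h s * r + (- L) / 2 * r\<^sup>2 \<le> - H (s + r)" for s r
    proof (rule has_real_derivative_quadratic_lower[where H = "\<lambda>s. - H s" and h = "\<lambda>s. - h s"])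
      show "((\<lambda>s. - H s) has_real_derivative - h t) (at t)" for t by (rule DERIV_minus[OF H])
      show "- L * (t - s) \<le> - h t - - h s" if "s \<le> t" for s t using h_diff[OF that] by simp
    qed
    show "H (s + r) \<le> H s + h s * r + L / 2 * r\<^sup>2" for s r using upper[of s r] by simp
    show "continuous_on UNIV H" using DERIV_continuous_on[of UNIV H h] H by blast
    show "h s = f s" if "\<bar>s\<bar> \<le> K" for s by (simp add: h_def c(4)[OF that])
    show "0 < h s" if "K < s" for s
    proof -
      have "0 < (\<bar>m\<bar> + 1) * (s - K)" using that by (intro mult_pos_pos) auto
      moreover have "h s = f K + (\<bar>m\<bar> + 1) * (s - K)" using c(5)[of s] that by (simp add: h_def)
      ultimately show ?thesis using K(2) by linarith
    qed
    show "h s < 0" if "s < - K" for s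
    proof -
      have "(\<bar>m\<bar> + 1) * (s + K) < 0" using that by (intro mult_pos_neg) auto
      moreover have "h s = f (- K) + (\<bar>m\<bar> + 1) * (s + K)" using c(6)[of s] that by (simp add: h_def)
      ultimately show ?thesis using K(3) by linarith
    qed
  qed (use L lip in auto)
qed

theorem theorem1p10:
  fixes \<Omega> :: "'a::euclidean_space set"
    and a \<phi> :: "'a \<Rightarrow> real"
    and G :: "real \<Rightarrow> real"
    and M :: real
  assumes dom: "open \<Omega>" "connected \<Omega>" "bounded \<Omega>" "\<Omega> \<noteq> {}"
    and a_C2: "Ck_on 2 \<Omega> a"
    and a_C2_closure: "continuous_on (closure \<Omega>) a"
        "\<forall>v. uniformly_continuous_on \<Omega> (pderiv_dir a v)"
        "\<forall>v w. uniformly_continuous_on \<Omega> (pderiv_dir (pderiv_dir a v) w)"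
    and a_pos: "\<forall>x\<in>closure \<Omega>. a x > 0"
    and G_C2: "\<forall>s. (G has_real_derivative deriv G s) (at s)"
        "\<forall>s. (deriv G has_real_derivative deriv (deriv G) s) (at s)"
        "continuous_on UNIV (deriv (deriv G))"
    and phi: "H1 \<Omega> \<phi>" "Linfty_on \<Omega> \<phi>"
    and M: "M > 0" "\<forall>s < - M. deriv G s \<le> 0" "\<forall>s>M. deriv G s \<ge> 0"
    and lap: "\<forall>x\<in>\<Omega>. laplacian (\<lambda>y. sqrt (a y)) x / sqrt (a x) \<ge> - deriv (deriv G) 0"
    and G2: "\<forall>s. s \<noteq> 0 \<longrightarrow> - deriv (deriv G) 0 > - deriv (deriv G) s"
  shows "\<exists>u. critical_point \<Omega> a G \<phi> u \<and>
           (\<forall>v. critical_point \<Omega> a G \<phi> v \<longrightarrow> (AE x in lebesgue_on \<Omega>. v x = u x))"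
proof -
  let ?M = "lebesgue_on \<Omega>"
  define m where "m = deriv (deriv G) 0"
  interpret weighted_domain \<Omega> a m
    by unfold_locales (use dom a_C2 a_C2_closure(1) a_pos lap in \<open>auto simp: m_def\<close>)
  have m_le: "m \<le> deriv (deriv G) s" for s using G2 by (cases "s = 0") (auto simp: m_def less_imp_le)
  have dG_cont: "continuous_on UNIV (deriv G)"
    using DERIV_continuous_on[of UNIV "deriv G" "deriv (deriv G)"] G_C2(2) by blast
  have mono: "m * (t - s) \<le> deriv G t - deriv G s" if "s \<le> t" for s t
  proof (cases "s = t")
    case False
    then have "s < t" using that by simp
    from MVT2[OF this] obtain z where "deriv G t - deriv G s = (t - s) * deriv (deriv G) z"
      using G_C2(2) by metis
    then show ?thesis using that m_le[of z] by (simp add: mult.commute[of "t - s"] mult_right_mono)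
  qed simp
  obtain d\<phi> where \<phi>: "weak_grad \<Omega> \<phi> d\<phi>" "L2 ?M \<phi>" "L2 ?M d\<phi>"
    using phi(1) unfolding H1_def L2_on_iff L2_vec_on_iff by blast
  obtain C where C: "AE x in ?M. \<bar>\<phi> x\<bar> \<le> C" using phi(2) unfolding Linfty_on_def by blast
  define B where "B = max C 0"
  have B: "AE x in ?M. \<bar>\<phi> x\<bar> \<le> B" "0 \<le> B" using C by (auto simp: B_def elim: eventually_mono)
  \<comment> \<open>Above \<open>M\<close>, so that G' has the right signs at \<plusminus>K, and
    strictly above the bound \<open>B\<close> of \<phi>, as the maximum principle demands.\<close>
  define K where "K = max M B + 1"
  have K: "M < K" "B < K" "0 < K" using M(1) by (auto simp: K_def)
  obtain H h L where H: "\<And>s r. H s + h s * r + m / 2 * r\<^sup>2 \<le> H (s + r)"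
    "\<And>s r. H (s + r) \<le> H s + h s * r + L / 2 * r\<^sup>2" "continuous_on UNIV H" "0 \<le> L"
    "\<And>s t. \<bar>h s - h t\<bar> \<le> L * \<bar>s - t\<bar>"
    and h: "\<And>s. \<bar>s\<bar> \<le> K \<Longrightarrow> h s = deriv G s" "\<And>s. K < s \<Longrightarrow> 0 < h s" "\<And>s. s < - K \<Longrightarrow> h s < 0"
  proof (rule truncated_nonlinearity[of "deriv G" "deriv (deriv G)" m K])
    show "0 \<le> deriv G K" "deriv G (- K) \<le> 0" using M(2,3) K(1) by auto
  qed (use G_C2 m_le K(3) in auto)
  interpret E: weighted_energy \<Omega> a m H h L
    by unfold_locales (use H in auto)
  have U0: "L2 ?M (\<lambda>x. (\<phi> x, d\<phi> x))" by (rule L2_Pair(1)[OF \<phi>(2,3)])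
  obtain Z where Z: "H10_pair Z"
    and EL: "\<And>\<eta>. test_fun \<Omega> \<eta> \<Longrightarrow> integral\<^sup>L ?M (\<lambda>x. E.dgrad (\<lambda>x. (\<phi> x, d\<phi> x) + Z x) x \<bullet> test_pair \<eta> x) = 0"
    by (rule E.euler_lagrange_solution[OF U0]) (rule that)
  have ZL: "L2 ?M Z" using Z unfolding H10_pair_def by blast
  define u where "u x = \<phi> x + fst (Z x)" for x
  define U where "U x = d\<phi> x + snd (Z x)" for x
  have uL: "L2 ?M u" unfolding u_def by (rule L2_add(1)[OF \<phi>(2) L2_fst(1)[OF ZL]])
  have UL: "L2 ?M U" unfolding U_def by (rule L2_add(1)[OF \<phi>(3) L2_snd(1)[OF ZL]])
  have huL: "L2 ?M (\<lambda>x. h (u x))" by (rule E.L2_g_compose[OF uL])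
  have EL': "integral\<^sup>L ?M (\<lambda>x. a x * (U x \<bullet> grad \<eta> x) + a x * h (u x) * \<eta> x) = 0" if "test_fun \<Omega> \<eta>" for \<eta>
  proof -
    have "a x * (U x \<bullet> grad \<eta> x) + a x * h (u x) * \<eta> x = E.dgrad (\<lambda>x. (\<phi> x, d\<phi> x) + Z x) x \<bullet> test_pair \<eta> x" for x
      by (simp add: E.dgrad_def inner_prod_def u_def U_def algebra_simps)
    then show ?thesis using EL[OF that] by simp
  qed
  have upper: "AE x in ?M. \<phi> x + fst (Z x) \<le> K"
    by (rule maximum_principle[OF Z \<phi> B K(2) huL]) (use EL' h(2) in \<open>auto simp: u_def U_def\<close>)
  \<comment> \<open>The maximum principle applied to -u. Its lower order term \<open>f\<close> is
    just a function of \<open>x\<close>, so \<open>- h (u x)\<close> serves, and it is positive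
    where u < - K.\<close>
  have lower: "AE x in ?M. - \<phi> x + fst (- Z x) \<le> K"
  proof (rule maximum_principle[OF H10_pair_uminus[OF Z] weak_grad_uminus[OF \<phi>(1)] L2_uminus[OF \<phi>(2)] L2_uminus[OF \<phi>(3)] _ B(2) K(2) L2_uminus[OF huL]])
    show "0 < - h (u x)" if "K < - \<phi> x + fst (- Z x)" for x using that h(3)[of "u x"] by (simp add: u_def)
    fix \<psi> assume \<psi>: "test_fun \<Omega> \<psi>"
    have neg: "a x * ((- d\<phi> x + snd (- Z x)) \<bullet> grad \<psi> x) + a x * - h (u x) * \<psi> x = - (a x * (U x \<bullet> grad \<psi> x) + a x * h (u x) * \<psi> x)" for x
      by (simp add: U_def inner_diff_left inner_add_left algebra_simps)
    then show "integral\<^sup>L ?M (\<lambda>x. a x * ((- d\<phi> x + snd (- Z x)) \<bullet> grad \<psi> x) + a x * - h (u x) * \<psi> x) = 0"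
      unfolding neg Bochner_Integration.integral_minus EL'[OF \<psi>] by simp
  qed (use B(1) in simp)
  \<comment> \<open>The solution takes its values in [-K, K] almost everywhere, where the truncated
    nonlinearity agrees with G'. Thus the truncated equation is the original one.\<close>
  have hG: "AE x in ?M. h (u x) = deriv G (u x)"
    using upper lower by eventually_elim (rule h(1), simp add: u_def)
  have dGm: "(\<lambda>x. deriv G (u x)) \<in> borel_measurable ?M"
    by (rule borel_measurable_continuous_on[OF dG_cont L2_measurable[OF uL]])
  have wgu: "weak_grad \<Omega> u U"
    using weak_grad_diff[OF \<phi>(1) weak_grad_H10_pair[OF H10_pair_uminus[OF Z]] \<phi>(2,3) L2_fst(1)[OF L2_uminus[OF ZL]] L2_snd(1)[OF L2_uminus[OF ZL]]]
    by (simp add: u_def[abs_def] U_def[abs_def])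
  have H1: "H1 \<Omega> u" unfolding H1_def L2_on_iff L2_vec_on_iff using uL wgu UL by blast
  have H10: "H1_0 \<Omega> (\<lambda>x. u x - \<phi> x)"
    unfolding H1_0_iff using Z by (intro exI[of _ "\<lambda>x. snd (Z x)"]) (simp add: u_def)
  have "critical_point \<Omega> a G \<phi> u"
    unfolding critical_point_def H1_bc_def L2_vec_on_iff
  proof (intro conjI exI[of _ U] allI impI H1 H10 UL wgu)
    fix \<psi> assume \<psi>: "test_fun \<Omega> \<psi>"
    have i: "integrable ?M (\<lambda>x. a x * h (u x) * \<psi> x)"
      by (rule L2_integrable_mult[OF L2_a_mult_real[OF huL] L2_test[OF \<psi>]])
    have dm: "(\<lambda>x. a x * deriv G (u x) * \<psi> x) \<in> borel_measurable ?M"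
      using dGm a_measurable L2_measurable[OF L2_test[OF \<psi>]] by (intro borel_measurable_times)
    have ae: "AE x in ?M. a x * h (u x) * \<psi> x = a x * deriv G (u x) * \<psi> x"
      using hG by eventually_elim simp
    have g: "integrable ?M (\<lambda>x. a x * (U x \<bullet> grad \<psi> x))"
      using L2_integrable_inner[OF L2_a_mult[OF UL] L2_grad[OF \<psi>]] by simp
    show "integrable ?M (\<lambda>x. a x * deriv G (u x) * \<psi> x)"
      by (rule integrable_cong_AE_imp[OF i dm ae])
    have "integral\<^sup>L ?M (\<lambda>x. a x * (U x \<bullet> grad \<psi> x) + a x * deriv G (u x) * \<psi> x)
        = integral\<^sup>L ?M (\<lambda>x. a x * (U x \<bullet> grad \<psi> x) + a x * h (u x) * \<psi> x)"
    proof (rule integral_cong_AE)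
      show "AE x in ?M. a x * (U x \<bullet> grad \<psi> x) + a x * deriv G (u x) * \<psi> x = a x * (U x \<bullet> grad \<psi> x) + a x * h (u x) * \<psi> x"
        using hG by eventually_elim simp
    qed (use dm i g in \<open>auto intro: borel_measurable_add\<close>)
    then show "integral\<^sup>L ?M (\<lambda>x. a x * (U x \<bullet> grad \<psi> x) + a x * deriv G (u x) * \<psi> x) = 0"
      using EL'[OF \<psi>] by simp
  qed
  moreover have "AE x in ?M. v x = u x" if "critical_point \<Omega> a G \<phi> v" for v
    by (rule critical_points_AE_eq[OF \<open>critical_point \<Omega> a G \<phi> u\<close> that dG_cont mono])
  ultimately show ?thesis by blast
qed

end
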